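(* Let $n\geqslant 1$, $\tau>0$, $\delta\geqslant 0$, $m>0$ with $m\tau<1$, and let $\ell>\max\{\frac n2-1,0\}$. Suppose that $(\psi_0,\psi_1,\psi_2)\in\mathcal{A}_{\delta,\ell}$ and $P_{\psi_1+\tau\psi_2}\neq 0$. Let $\psi$ be the solution to the Cauchy problem $$\begin{cases}\tau\psi_{ttt}+\psi_{tt}-\Delta\psi-(\delta+\tau)\Delta\psi_t+\displaystyle\int_0^t m\,\mathrm{e}^{-\frac{t-\eta}{\tau}}\Delta\psi(\eta,x)\,\mathrm{d}\eta=0,& x\in\mathbb{R}^n,\ t>0,\\ (\psi,\psi_t,\psi_{tt})(0,x)=(\psi_0,\psi_1,\psi_2)(x),& x\in\mathbb{R}^n.\end{cases}$$ Then $\psi$ satisfies the optimal growth/decay estimates $$\mathcal{D}_n(t)\,|P_{\psi_1+\tau\psi_2}|\lesssim\|\psi(t,\cdot)\|_{L^2}\lesssim\mathcal{D}_n(t)\,\|(\psi_0,\psi_1,\psi_2)\|_{\mathcal{A}_{\delta,\ell}}$$ for large time $t\gg1$, where $$\mathcal{D}_n(t):=\begin{cases}\sqrt{t}& \text{when } n=1,\\ \sqrt{\ln t}&\text{when } n=2,\\ t^{\frac12-\frac n4}&\text{when } n\geqslant 3.\end{cases}$$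
   Context: The unknown $\psi=\psi(t,x)$ and the data are real-valued. The solution is understood through the partial Fourier transform in $x$: for each $\xi\in\mathbb{R}^n$, $\widehat\psi(\cdot,\xi)$ is the unique solution of the linear integro-differential ODE obtained by replacing $\Delta$ by $-|\xi|^2$, with initial data $(\widehat\psi_0,\widehat\psi_1,\widehat\psi_2)(\xi)$. $P_f:=\int_{\mathbb{R}^n}f(x)\,\mathrm{d}x$ is the mean of $f$. The data space (with its natural norm, the sum of the norms of the components in the indicated intersection spaces) is $$\mathcal{A}_{\delta,\ell}:=\begin{cases}(L^2\cap L^1)\times(L^2\cap L^1)\times(L^2\cap L^1)&\text{when }\delta>0,\\ (H^{\ell}\cap L^1)\times(H^{\max\{\ell-1,0\}}\cap L^1)\times(H^{\max\{\ell-2,0\}}\cap L^1)&\text{when }\delta=0,\end{cases}$$ where all spaces are over $\mathbb{R}^n$. Convention: $f\lesssim g$ means $f\leqslant Cg$ with a constant $C>0$ independent of $t$ and of the initial data (it may depend on $n,\tau,\delta,m,\ell$). "For large time $t\gg1$" means for all $t\geqslant T_0$ with some sufficiently large $T_0$, which for the lower bound may depend on the initial data. *)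

theory Defs
  imports "HOL-Analysis.Analysis"
begin

definition square_integrable :: "('a::euclidean_space \<Rightarrow> 'b::euclidean_space) \<Rightarrow> bool" where
  "square_integrable f \<longleftrightarrow>
     f \<in> borel_measurable lborel \<and> integrable lborel (\<lambda>x. (norm (f x))\<^sup>2)"

definition L1_norm :: "('a::euclidean_space \<Rightarrow> 'b::euclidean_space) \<Rightarrow> real" where
  "L1_norm f = (LINT x|lborel. norm (f x))"

definition L2_norm :: "('a::euclidean_space \<Rightarrow> 'b::euclidean_space) \<Rightarrow> real" where
  "L2_norm f = sqrt (LINT x|lborel. (norm (f x))\<^sup>2)"

definition mean :: "('a::euclidean_space \<Rightarrow> real) \<Rightarrow> real" where
  "mean f = (LINT x|lborel. f x)"

(* Unitary normalisation; meaningful for integrable f. *)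
definition fourier :: "('a::euclidean_space \<Rightarrow> real) \<Rightarrow> 'a \<Rightarrow> complex" where
  "fourier f \<xi> =
     ((2 * pi) powr (- (real DIM('a) / 2))) *\<^sub>R (LINT x|lborel. f x *\<^sub>R cis (- (x \<bullet> \<xi>)))"

(* The Fourier transform on L^2: g is the L^2 limit of the transforms of some (equivalently,
   any) sequence of functions in the intersection of L^1 and L^2 converging to f in L^2. *)
definition has_L2_fourier :: "('a::euclidean_space \<Rightarrow> real) \<Rightarrow> ('a \<Rightarrow> complex) \<Rightarrow> bool" where
  "has_L2_fourier f g \<longleftrightarrow>
     square_integrable f \<and> square_integrable g \<and>
     (\<exists>F. (\<forall>k::nat. integrable lborel (F k) \<and> square_integrable (F k) \<and>
                    square_integrable (fourier (F k))) \<and>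
          (\<lambda>k. L2_norm (\<lambda>x. F k x - f x)) \<longlonglongrightarrow> 0 \<and>
          (\<lambda>k. L2_norm (\<lambda>\<xi>. fourier (F k) \<xi> - g \<xi>)) \<longlonglongrightarrow> 0)"

(* The Sobolev space H^s is only needed for s \<ge> 0 and intersected with L^1, so that the
   transform in its definition is the integral above. *)
definition Hs_L1 :: "real \<Rightarrow> ('a::euclidean_space \<Rightarrow> real) set" where
  "Hs_L1 s = {f. integrable lborel f \<and> square_integrable f \<and>
     integrable lborel (\<lambda>\<xi>. (1 + (norm \<xi>)\<^sup>2) powr s * (cmod (fourier f \<xi>))\<^sup>2)}"

definition Hs_norm :: "real \<Rightarrow> ('a::euclidean_space \<Rightarrow> real) \<Rightarrow> real" where
  "Hs_norm s f = sqrt (LINT \<xi>|lborel. (1 + (norm \<xi>)\<^sup>2) powr s * (cmod (fourier f \<xi>))\<^sup>2)"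

definition Hs_L1_norm :: "real \<Rightarrow> ('a::euclidean_space \<Rightarrow> real) \<Rightarrow> real" where
  "Hs_L1_norm s f = Hs_norm s f + L1_norm f"

definition L2_L1 :: "('a::euclidean_space \<Rightarrow> real) set" where
  "L2_L1 = {f. square_integrable f \<and> integrable lborel f}"

definition L2_L1_norm :: "('a::euclidean_space \<Rightarrow> real) \<Rightarrow> real" where
  "L2_L1_norm f = L2_norm f + L1_norm f"

definition data_space ::
  "real \<Rightarrow> real \<Rightarrow> (('a::euclidean_space \<Rightarrow> real) \<times> ('a \<Rightarrow> real) \<times> ('a \<Rightarrow> real)) set" where
  "data_space \<delta> l =
     (if \<delta> > 0 then L2_L1 \<times> L2_L1 \<times> L2_L1
      else Hs_L1 l \<times> Hs_L1 (max (l - 1) 0) \<times> Hs_L1 (max (l - 2) 0))"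

definition data_norm ::
  "real \<Rightarrow> real \<Rightarrow> ('a::euclidean_space \<Rightarrow> real) \<times> ('a \<Rightarrow> real) \<times> ('a \<Rightarrow> real) \<Rightarrow> real" where
  "data_norm \<delta> l = (\<lambda>(\<psi>0, \<psi>1, \<psi>2).
     if \<delta> > 0 then L2_L1_norm \<psi>0 + L2_L1_norm \<psi>1 + L2_L1_norm \<psi>2
     else Hs_L1_norm l \<psi>0 + Hs_L1_norm (max (l - 1) 0) \<psi>1 + Hs_L1_norm (max (l - 2) 0) \<psi>2)"

(* The Cauchy problem with the Laplacian replaced by -r, where r stands for |\<xi>|^2.
   y is C^2 on [0, \<infinity>) and three times differentiable on (0, \<infinity>). *)
definition solves_ode ::
  "real \<Rightarrow> real \<Rightarrow> real \<Rightarrow> real \<Rightarrow> complex \<Rightarrow> complex \<Rightarrow> complex \<Rightarrow> (real \<Rightarrow> complex) \<Rightarrow> bool" where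
  "solves_ode \<tau> \<delta> m r a0 a1 a2 y \<longleftrightarrow>
     (\<exists>y1 y2 y3.
        (\<forall>t\<ge>0. (y has_vector_derivative y1 t) (at t within {0..})) \<and>
        (\<forall>t\<ge>0. (y1 has_vector_derivative y2 t) (at t within {0..})) \<and>
        continuous_on {0..} y2 \<and>
        (\<forall>t>0. (y2 has_vector_derivative y3 t) (at t)) \<and>
        y 0 = a0 \<and> y1 0 = a1 \<and> y2 0 = a2 \<and>
        (\<forall>t>0. \<tau> *\<^sub>R y3 t + y2 t + r *\<^sub>R y t + ((\<delta> + \<tau>) * r) *\<^sub>R y1 t
               - r *\<^sub>R integral {0..t} (\<lambda>\<eta>. (m * exp (- (t - \<eta>) / \<tau>)) *\<^sub>R y \<eta>) = 0))"

(* Here u t \<xi> is the partial Fourier transform of \<psi>, and \<psi> t is its inverse transform in L^2.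
   Square integrability of u t is deliberately not a requirement: at a time where it failed,
   \<psi> t would be unconstrained, so that \<psi> t lying in L^2 has to be proved. *)
definition is_solution ::
  "real \<Rightarrow> real \<Rightarrow> real \<Rightarrow> ('a::euclidean_space \<Rightarrow> real) \<Rightarrow> ('a \<Rightarrow> real) \<Rightarrow> ('a \<Rightarrow> real) \<Rightarrow>
   (real \<Rightarrow> 'a \<Rightarrow> real) \<Rightarrow> bool" where
  "is_solution \<tau> \<delta> m \<psi>0 \<psi>1 \<psi>2 \<psi> \<longleftrightarrow>
     (\<exists>u :: real \<Rightarrow> 'a \<Rightarrow> complex.
        (\<forall>\<xi>. solves_ode \<tau> \<delta> m ((norm \<xi>)\<^sup>2) (fourier \<psi>0 \<xi>) (fourier \<psi>1 \<xi>) (fourier \<psi>2 \<xi>)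
               (\<lambda>t. u t \<xi>)) \<and>
        (\<forall>t\<ge>0. square_integrable (u t) \<longrightarrow> has_L2_fourier (\<psi> t) (u t)))"

definition growth_rate :: "nat \<Rightarrow> real \<Rightarrow> real" where
  "growth_rate n t =
     (if n = 1 then sqrt t else if n = 2 then sqrt (ln t) else t powr (1 / 2 - real n / 4))"

end

theory Submission
  imports Defs "HOL-Probability.Probability"
begin

text \<open>
  By Plancherel the problem reduces to the Fourier side, where for each frequency, with
  \<open>r = |\<xi>|\<^sup>2\<close>, one has a scalar ODE. Put \<open>q = y'\<close>, \<open>v = y + \<tau> y'\<close>, \<open>s = v'\<close> and \<open>p = w'\<close>, where \<open>w\<close> is the
  memory integral. Since \<open>w = m \<tau> v - m \<tau>\<^sup>2 q - \<tau> p\<close>, the equation becomes an oscillator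
  \<open>v'' + r (1 - m \<tau>) v = - r ((\<delta> + m \<tau>\<^sup>2) q + \<tau> p)\<close> driven by the relaxation variables
  \<open>\<tau> q' + q = s\<close> and \<open>\<tau> p' + p = m \<tau> q\<close>. Its energy
  \<open>s\<^sup>2 + r (1 - m \<tau>) v\<^sup>2 + r ((\<delta> + m \<tau>\<^sup>2) \<tau> q\<^sup>2 + 2 \<tau>\<^sup>2 q p + (2 \<tau> / m) p\<^sup>2)\<close> has derivative
  \<open>- 2 r (\<delta> q\<^sup>2 + (2 / m) p\<^sup>2)\<close>, and adding small multiples of \<open>p q\<close>, \<open>q s\<close> and \<open>s v\<close> gives
  exponential decay with rate \<open>r / (1 + r)\<close> for \<open>\<delta> > 0\<close> and \<open>r / (1 + r)\<^sup>2\<close> for \<open>\<delta> = 0\<close>;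
  the degeneracy of the latter as \<open>r\<close> grows is the loss of regularity paid for by the Sobolev norms.
  Low frequencies decide the growth: there \<open>|y|\<^sup>2\<close> is at most \<open>min t\<^sup>2 (exp (- c r t) / r)\<close> up to
  constants, while for bounded \<open>r t\<close> the solution is
  \<open>(sin (\<omega> t) / \<omega>) s(0)\<close>, \<open>\<omega>\<^sup>2 = r (1 - m \<tau>)\<close>, up to lower order terms. Both are integrated over
  \<open>\<xi>\<close> in polar coordinates.\<close>

section \<open>Gaussians and translations\<close>

text \<open>For \<delta> = 0 the energy damps \<open>p\<close> alone, and the multipliers pass this
  damping along a chain: \<open>p q\<close> from \<open>p\<close> to \<open>q\<close>,
  \<open>q s\<close> from \<open>q\<close> to \<open>s\<close>, \<open>s v\<close> from
  \<open>s\<close> to \<open>v\<close>. The first link is the costly one. To damp \<open>q\<close>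
  with strength \<open>\<theta> r\<close> the multiplier needs a coefficient of that size, and the
  product \<open>p s\<close> it leaves must be absorbed by damping of strength \<open>r\<close> in
  \<open>p\<close> and \<open>h\<close> in \<open>s\<close>, that is
  \<open>(\<theta> r)^2 <= r h\<close> up to constants; with \<open>h <= \<theta>\<close> this
  forces \<theta> down to order 1 / r. The solution is prescribed separately at each frequency, so
  measurability and square integrability in \<xi> are conclusions: the former comes from comparing
  two frequencies by Gronwall, the latter from the pointwise bounds. In the lower bound the constant
  must not depend on the data, although the errors contain all of them. Errors with a growing factor
  are traced back to \<open>a1 + \<tau> a2\<close> alone; the others stay bounded and are integrated
  over frequency shells of negligible volume, so that only the time threshold sees the data.\<close>

lemma borel_measurable_cis [measurable]: "cis \<in> borel_measurable borel"
  by (intro borel_measurable_continuous_onI continuous_intros)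

text \<open>Read off from the characteristic function of the standard normal law, whose density
  differs from this Gaussian by the factor \<open>sqrt (2 * pi)\<close>.\<close>

lemma gaussian_transform_real:
  fixes t :: real
  shows "integrable lborel (\<lambda>x::real. exp (- x\<^sup>2 / 2) *\<^sub>R cis (t * x))"
    and "(LINT x|lborel. exp (- x\<^sup>2 / 2) *\<^sub>R cis (t * x)) = complex_of_real (sqrt (2 * pi) * exp (- t\<^sup>2 / 2))"
proof -
  have "integrable lborel (\<lambda>x::real. sqrt (2 * pi) * std_normal_density x)"
    by (intro integrable_mult_right integrable_normal_density) auto
  then have int: "integrable lborel (\<lambda>x::real. exp (- x\<^sup>2 / 2))"
    by (simp add: std_normal_density_def)
  show "integrable lborel (\<lambda>x::real. exp (- x\<^sup>2 / 2) *\<^sub>R cis (t * x))"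
    by (rule Bochner_Integration.integrable_bound[OF int]) (auto simp: )
  have "(LINT x|lborel. std_normal_density x *\<^sub>R cis (t * x)) = complex_of_real (exp (- t\<^sup>2 / 2))"
    using fun_cong[OF char_std_normal_distribution, of t]
    by (simp add: char_def integral_density cis_conv_exp normal_density_nonneg)
  then have "sqrt (2 * pi) *\<^sub>R (LINT x|lborel. std_normal_density x *\<^sub>R cis (t * x)) =
      complex_of_real (sqrt (2 * pi) * exp (- t\<^sup>2 / 2))"
    by (simp add: scaleR_conv_of_real)
  then show "(LINT x|lborel. exp (- x\<^sup>2 / 2) *\<^sub>R cis (t * x)) = complex_of_real (sqrt (2 * pi) * exp (- t\<^sup>2 / 2))"
    unfolding integral_scaleR_right[symmetric] by (simp add: std_normal_density_def)
qed

text \<open>Lebesgue measure is the image of the product of one-dimensional Lebesgue measures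
  indexed by \<open>Basis\<close>, and both the Gaussian and the phase split into products over the
  coordinates.\<close>

lemma gaussian_transform:
  fixes x :: "'a::euclidean_space"
  shows "integrable lborel (\<lambda>\<xi>::'a. exp (- (norm \<xi>)\<^sup>2 / 2) *\<^sub>R cis (x \<bullet> \<xi>))"
    and "(LINT \<xi>|lborel. exp (- (norm \<xi>)\<^sup>2 / 2) *\<^sub>R cis (x \<bullet> \<xi>)) =
       complex_of_real (sqrt (2 * pi) ^ DIM('a) * exp (- (norm x)\<^sup>2 / 2))"
proof -
  interpret product_sigma_finite "\<lambda>_::'a. lborel :: real measure"
    by unfold_locales
  let ?f = "\<lambda>b (z::real). exp (- z\<^sup>2 / 2) *\<^sub>R cis ((x \<bullet> b) * z)"
  let ?T = "\<lambda>f. \<Sum>b\<in>Basis. f b *\<^sub>R b :: 'a"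
  have nrm: "(norm z)\<^sup>2 = (\<Sum>b\<in>Basis. (z \<bullet> b)\<^sup>2)" for z :: 'a
    unfolding power2_norm_eq_inner euclidean_inner[of z z] by (simp add: power2_eq_square)
  have cis_sum: "cis (sum g B) = (\<Prod>b\<in>B. cis (g b))" if "finite B" for g :: "'a \<Rightarrow> real" and B
    using that by (induction B rule: finite_induct) (auto simp flip: cis_mult)
  have eq: "exp (- (norm (?T z))\<^sup>2 / 2) *\<^sub>R cis (x \<bullet> ?T z) = (\<Prod>b\<in>Basis. ?f b (z b))" for z
  proof -
    have "exp (- (norm (?T z))\<^sup>2 / 2) = (\<Prod>b\<in>Basis. exp (- (z b)\<^sup>2 / 2))"
      by (simp add: nrm exp_sum[symmetric] sum_negf sum_divide_distrib)
    moreover have "cis (x \<bullet> ?T z) = (\<Prod>b\<in>Basis. cis ((x \<bullet> b) * z b))"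
      by (simp add: cis_sum[symmetric] inner_sum_right mult.commute)
    ultimately show ?thesis
      by (simp add: scaleR_conv_of_real prod.distrib)
  qed
  have meas: "?T \<in> measurable (\<Pi>\<^sub>M b\<in>Basis. lborel) borel"
    by measurable
  have fint: "integrable lborel (?f b)" for b
    by (rule gaussian_transform_real)
  have "integrable (\<Pi>\<^sub>M b\<in>Basis. lborel) (\<lambda>z. \<Prod>b\<in>Basis. ?f b (z b))"
    by (rule product_integrable_prod) (use fint in auto)
  then have "integrable (distr (\<Pi>\<^sub>M b\<in>Basis. lborel) borel ?T) (\<lambda>\<xi>::'a. exp (- (norm \<xi>)\<^sup>2 / 2) *\<^sub>R cis (x \<bullet> \<xi>))"
    using meas by (subst integrable_distr_eq) (simp_all add: eq[simplified])
  then show "integrable lborel (\<lambda>\<xi>::'a. exp (- (norm \<xi>)\<^sup>2 / 2) *\<^sub>R cis (x \<bullet> \<xi>))"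
    by (simp add: lborel_eq[where 'a='a])
  have "(LINT \<xi>|lborel. exp (- (norm \<xi>)\<^sup>2 / 2) *\<^sub>R cis (x \<bullet> \<xi>)) =
      integral\<^sup>L (\<Pi>\<^sub>M b\<in>Basis. lborel) (\<lambda>z. \<Prod>b\<in>Basis. ?f b (z b))"
    using meas by (subst lborel_eq[where 'a='a], subst integral_distr) (simp_all add: eq[simplified])
  also have "\<dots> = (\<Prod>b\<in>Basis. integral\<^sup>L lborel (?f b))"
    by (rule product_integral_prod) (use fint in auto)
  also have "\<dots> = (\<Prod>b\<in>Basis. complex_of_real (sqrt (2 * pi) * exp (- (x \<bullet> b)\<^sup>2 / 2)))"
    by (intro prod.cong refl gaussian_transform_real(2))
  also have "\<dots> = complex_of_real (sqrt (2 * pi) ^ DIM('a) * exp (- (norm x)\<^sup>2 / 2))"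
    by (simp add: prod.distrib nrm exp_sum sum_negf[symmetric] sum_divide_distrib flip: of_real_prod)
  finally show "(LINT \<xi>|lborel. exp (- (norm \<xi>)\<^sup>2 / 2) *\<^sub>R cis (x \<bullet> \<xi>)) =
       complex_of_real (sqrt (2 * pi) ^ DIM('a) * exp (- (norm x)\<^sup>2 / 2))" .
qed

section \<open>Continuity of translations in L^1\<close>

lemma lborel_distr_shift: "distr lborel borel (\<lambda>x. x + h) = (lborel :: 'a::euclidean_space measure)"
  using lborel_distr_plus[of h] by (simp add: add.commute[of _ h])

lemma integrable_shift:
  fixes f :: "'a::euclidean_space \<Rightarrow> 'b::{banach, second_countable_topology}"
  assumes "integrable lborel f"
  shows "integrable lborel (\<lambda>x. f (x + h))"
  using assms integrable_distr[of "\<lambda>x. x + h" lborel borel f] by (simp add: lborel_distr_shift)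

lemma integral_shift:
  fixes f :: "'a::euclidean_space \<Rightarrow> 'b::{banach, second_countable_topology}"
  assumes "f \<in> borel_measurable borel"
  shows "(LINT x|lborel. f (x + h)) = integral\<^sup>L lborel f"
  using assms integral_distr[of "\<lambda>x. x + h" lborel borel f] by (simp add: lborel_distr_shift)

text \<open>Replacing \<open>f\<close> by \<open>g\<close> costs their distance twice, once at
  \<open>x\<close> and once at \<open>x + h\<close>; translation invariance makes the two costs
  equal.\<close>

lemma L1_translation_approx:
  fixes f g :: "'a::euclidean_space \<Rightarrow> real"
  assumes f: "integrable lborel f" and g: "integrable lborel g"
  shows "(LINT x|lborel. \<bar>f (x + h) - f x\<bar>) \<le>
    (LINT x|lborel. \<bar>g (x + h) - g x\<bar>) + 2 * (LINT x|lborel. \<bar>f x - g x\<bar>)"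
proof -
  have [measurable]: "f \<in> borel_measurable borel" "g \<in> borel_measurable borel"
    using f g by auto
  have d: "integrable lborel (\<lambda>x. \<bar>f x - g x\<bar>)"
    using f g by auto
  note sh = integrable_shift[OF f, of h] integrable_shift[OF g, of h] integrable_shift[OF d, of h]
  have "(LINT x|lborel. \<bar>f (x + h) - f x\<bar>) \<le>
      (LINT x|lborel. \<bar>g (x + h) - g x\<bar> + \<bar>f x - g x\<bar> + \<bar>f (x + h) - g (x + h)\<bar>)"
    using f g d sh by (intro integral_mono) auto
  also have "\<dots> = (LINT x|lborel. \<bar>g (x + h) - g x\<bar>) + (LINT x|lborel. \<bar>f x - g x\<bar>) +
      (LINT x|lborel. \<bar>f (x + h) - g (x + h)\<bar>)"
    using f g d sh by simp
  also have "(LINT x|lborel. \<bar>f (x + h) - g (x + h)\<bar>) = (LINT x|lborel. \<bar>f x - g x\<bar>)"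
    by (rule integral_shift) measurable
  finally show ?thesis by simp
qed

text \<open>The functions with convergent translates form a closed set in L^1, so approximation by
  good functions suffices.\<close>

lemma L1_translation_limit:
  fixes f :: "'a::euclidean_space \<Rightarrow> real" and h :: "nat \<Rightarrow> 'a"
  assumes f: "integrable lborel f"
    and appr: "\<And>e. e > 0 \<Longrightarrow> \<exists>g. integrable lborel g \<and> (LINT x|lborel. \<bar>f x - g x\<bar>) \<le> e \<and>
      (\<lambda>k. LINT x|lborel. \<bar>g (x + h k) - g x\<bar>) \<longlonglongrightarrow> 0"
  shows "(\<lambda>k. LINT x|lborel. \<bar>f (x + h k) - f x\<bar>) \<longlonglongrightarrow> 0"
proof (rule LIMSEQ_I)
  fix e :: real assume e: "e > 0"
  from appr[of "e / 4"] e obtain g where g: "integrable lborel g" "(LINT x|lborel. \<bar>f x - g x\<bar>) \<le> e / 4"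
      "(\<lambda>k. LINT x|lborel. \<bar>g (x + h k) - g x\<bar>) \<longlonglongrightarrow> 0" by auto
  from LIMSEQ_D[OF g(3), of "e / 2"] e obtain N where
    N: "\<And>k. k \<ge> N \<Longrightarrow> \<bar>LINT x|lborel. \<bar>g (x + h k) - g x\<bar>\<bar> < e / 2" by auto
  show "\<exists>N. \<forall>k\<ge>N. norm ((LINT x|lborel. \<bar>f (x + h k) - f x\<bar>) - 0) < e"
  proof (intro exI[of _ N] allI impI)
    fix k assume "k \<ge> N"
    with N[of k] L1_translation_approx[OF f g(1), of "h k"] g(2)
    show "norm ((LINT x|lborel. \<bar>f (x + h k) - f x\<bar>) - 0) < e"
      using Bochner_Integration.integral_nonneg[of lborel "\<lambda>x. \<bar>f (x + h k) - f x\<bar>"] by simp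
  qed
qed

lemma L1_translation_open:
  fixes U :: "'a::euclidean_space set"
  assumes U: "open U" "emeasure lborel U < \<infinity>" and h: "h \<longlonglongrightarrow> 0"
  shows "(\<lambda>k. LINT x|lborel. \<bar>indicator U (x + h k) - indicator U x :: real\<bar>) \<longlonglongrightarrow> 0"
proof -
  let ?i = "indicator U :: 'a \<Rightarrow> real"
  have i: "integrable lborel ?i"
    using U by (auto simp: integrable_indicator_iff)
  have [measurable]: "U \<in> sets borel" using U by auto
  \<comment> \<open>Openness gives only the one-sided pointwise convergence; translation invariance makes it suffice.\<close>
  have "(\<lambda>k. LINT x|lborel. max 0 (?i x - ?i (x + h k))) \<longlonglongrightarrow> (LINT x|(lborel :: 'a measure). 0)"
  proof (rule integral_dominated_convergence[where w = ?i])
    show "AE x in lborel. (\<lambda>k. max 0 (?i x - ?i (x + h k))) \<longlonglongrightarrow> 0"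
    proof (rule AE_I2)
      fix x
      show "(\<lambda>k. max 0 (?i x - ?i (x + h k))) \<longlonglongrightarrow> 0"
      proof (cases "x \<in> U")
        case True
        have "(\<lambda>k. x + h k) \<longlonglongrightarrow> x + 0"
          by (intro tendsto_intros h)
        then have "\<forall>\<^sub>F k in sequentially. x + h k \<in> U"
          using U(1) True by (auto dest: topological_tendstoD)
        then show ?thesis
          by (intro tendsto_eventually) (auto elim!: eventually_mono simp: True)
      qed (auto split: split_indicator)
    qed
  qed (use i in \<open>auto split: split_indicator\<close>)
  then have lim: "(\<lambda>k. 2 * (LINT x|lborel. max 0 (?i x - ?i (x + h k)))) \<longlonglongrightarrow> 0"
    by (auto intro: tendsto_eq_intros)
  \<comment> \<open>An absolute value is twice the negative part plus the number itself, and the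
    number integrates to 0 because both indicators have the same integral.\<close>
  have "(LINT x|lborel. \<bar>?i (x + h k) - ?i x\<bar>) = 2 * (LINT x|lborel. max 0 (?i x - ?i (x + h k)))" for k
  proof -
    note sh = integrable_shift[OF i, of "h k"]
    have "(LINT x|lborel. \<bar>?i (x + h k) - ?i x\<bar>) =
        (LINT x|lborel. 2 * max 0 (?i x - ?i (x + h k)) + (?i (x + h k) - ?i x))"
      by (intro Bochner_Integration.integral_cong) (auto split: split_indicator)
    also have "\<dots> = 2 * (LINT x|lborel. max 0 (?i x - ?i (x + h k))) +
        ((LINT x|lborel. ?i (x + h k)) - (LINT x|lborel. ?i x))"
      using i sh by (subst Bochner_Integration.integral_add) auto
    also have "(LINT x|lborel. ?i (x + h k)) = (LINT x|lborel. ?i x)"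
      by (rule integral_shift) measurable
    finally show ?thesis by simp
  qed
  then show ?thesis using lim by simp
qed

text \<open>Induction along the construction of the integral. The essential case is an indicator,
  where outer regularity supplies an open superset of nearly the same measure; sums and dominated
  limits are passed through by \<open>L1_translation_limit\<close> and the triangle
  inequality.\<close>

lemma L1_translation_continuous:
  fixes f :: "'a::euclidean_space \<Rightarrow> real" and h :: "nat \<Rightarrow> 'a"
  assumes "integrable lborel f" and h: "h \<longlonglongrightarrow> 0"
  shows "(\<lambda>k. LINT x|lborel. \<bar>f (x + h k) - f x\<bar>) \<longlonglongrightarrow> 0"
  using assms(1)
proof (induction rule: integrable_induct)
  case (base A c)
  have A: "A \<in> sets borel" using base by simp
  have int: "integrable lborel (indicator A :: 'a \<Rightarrow> real)"
    using base by (auto simp: integrable_indicator_iff)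
  have "(\<lambda>k. LINT x|lborel. \<bar>indicator A (x + h k) - indicator A x :: real\<bar>) \<longlonglongrightarrow> 0"
  proof (rule L1_translation_limit[OF int])
    fix e :: real assume e: "e > 0"
    obtain U where U: "open U" "A \<subseteq> U" "emeasure lborel (U - A) < e"
      using outer_regular_lborel[OF A e] by auto
    have [measurable]: "U \<in> sets borel" "A \<in> sets borel" using U A by auto
    have "emeasure lborel U = emeasure lborel A + emeasure lborel (U - A)"
      using U A by (subst plus_emeasure) (auto simp: Un_absorb1)
    also have "\<dots> < \<infinity>"
      using base U by (auto simp: ennreal_add_less_top intro: less_trans)
    finally have fin: "emeasure lborel U < \<infinity>" .
    have "(LINT x|lborel. \<bar>indicator A x - indicator U x\<bar>) = (LINT x|lborel. indicator (U - A) x :: real)"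
      using U(2) by (intro Bochner_Integration.integral_cong) (auto split: split_indicator)
    also have "\<dots> = measure lborel (U - A)"
      by simp
    also have "\<dots> \<le> e"
      using U(3) e by (simp add: measure_def enn2real_leI less_imp_le)
    finally show "\<exists>g. integrable lborel g \<and> (LINT x|lborel. \<bar>indicator A x - g x\<bar>) \<le> e \<and>
      (\<lambda>k. LINT x|lborel. \<bar>g (x + h k) - g x\<bar>) \<longlonglongrightarrow> 0"
      using fin U L1_translation_open[OF U(1) fin h]
      by (intro exI[of _ "indicator U"]) (auto simp: integrable_indicator_iff)
  qed
  then have "(\<lambda>k. \<bar>c\<bar> * (LINT x|lborel. \<bar>indicator A (x + h k) - indicator A x :: real\<bar>)) \<longlonglongrightarrow> 0"
    by (auto intro: tendsto_eq_intros)
  moreover have "\<bar>indicator A y *\<^sub>R c - indicator A x *\<^sub>R c\<bar> = \<bar>c\<bar> * \<bar>indicator A y - indicator A x\<bar>" for x y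
    by (simp add: algebra_simps flip: abs_mult)
  ultimately show ?case by simp
next
  case (add f g)
  have [measurable]: "f \<in> borel_measurable borel" "g \<in> borel_measurable borel"
    using add by auto
  have lim: "(\<lambda>k. (LINT x|lborel. \<bar>f (x + h k) - f x\<bar>) + (LINT x|lborel. \<bar>g (x + h k) - g x\<bar>)) \<longlonglongrightarrow> 0"
    using tendsto_add[OF add.IH] by simp
  show ?case
  proof (rule tendsto_sandwich[OF always_eventually always_eventually tendsto_const lim]; intro allI)
    fix k
    note sh = integrable_shift[OF add.hyps(1), of "h k"] integrable_shift[OF add.hyps(2), of "h k"]
    have "(LINT x|lborel. \<bar>f (x + h k) + g (x + h k) - (f x + g x)\<bar>) \<le>
        (LINT x|lborel. \<bar>f (x + h k) - f x\<bar> + \<bar>g (x + h k) - g x\<bar>)"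
      using add.hyps sh by (intro integral_mono) auto
    also have "\<dots> = (LINT x|lborel. \<bar>f (x + h k) - f x\<bar>) + (LINT x|lborel. \<bar>g (x + h k) - g x\<bar>)"
      using add.hyps sh by (intro Bochner_Integration.integral_add) auto
    finally show "(LINT x|lborel. \<bar>f (x + h k) + g (x + h k) - (f x + g x)\<bar>) \<le>
        (LINT x|lborel. \<bar>f (x + h k) - f x\<bar>) + (LINT x|lborel. \<bar>g (x + h k) - g x\<bar>)" .
  qed simp
next
  case (lim f s)
  have [measurable]: "f \<in> borel_measurable borel" "s i \<in> borel_measurable borel" for i
    using lim.hyps(1,4) by auto
  \<comment> \<open>The induction rule dominates the approximations \<open>s i\<close> by twice
    \<open>abs f\<close>, hence the factor 3 for the differences.\<close>
  have "(\<lambda>i. LINT x|lborel. \<bar>f x - s i x\<bar>) \<longlonglongrightarrow> (LINT x|(lborel :: 'a measure). 0)"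
  proof (rule integral_dominated_convergence[where w = "\<lambda>x. 3 * \<bar>f x\<bar>"])
    show "AE x in lborel. (\<lambda>i. \<bar>f x - s i x\<bar>) \<longlonglongrightarrow> 0"
    proof (rule AE_I2)
      fix x
      have "(\<lambda>i. \<bar>f x - s i x\<bar>) \<longlonglongrightarrow> \<bar>f x - f x\<bar>"
        by (intro tendsto_intros lim.hyps(2)) auto
      then show "(\<lambda>i. \<bar>f x - s i x\<bar>) \<longlonglongrightarrow> 0" by simp
    qed
    show "AE x in lborel. norm \<bar>f x - s i x\<bar> \<le> 3 * \<bar>f x\<bar>" for i
      using lim.hyps(3)[of _ i] by (intro AE_I2) (smt (verit) real_norm_def space_borel space_lborel UNIV_I)
  qed (use lim.hyps(4) in auto)
  then have conv: "(\<lambda>i. LINT x|lborel. \<bar>f x - s i x\<bar>) \<longlonglongrightarrow> 0" by simp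
  show ?case
  proof (rule L1_translation_limit[OF lim.hyps(4)])
    fix e :: real assume "e > 0"
    from LIMSEQ_D[OF conv this] obtain N where "\<And>i. i \<ge> N \<Longrightarrow> \<bar>LINT x|lborel. \<bar>f x - s i x\<bar>\<bar> < e" by auto
    from this[of N] show "\<exists>g. integrable lborel g \<and> (LINT x|lborel. \<bar>f x - g x\<bar>) \<le> e \<and>
      (\<lambda>k. LINT x|lborel. \<bar>g (x + h k) - g x\<bar>) \<longlonglongrightarrow> 0"
      using lim.hyps(1) lim.IH by (intro exI[of _ "s N"]) auto
  qed
qed

section \<open>The Fourier integral and its pairing with Gaussians\<close>

lemma integrable_fourier_integrand:
  fixes f :: "'a::euclidean_space \<Rightarrow> real"
  assumes "integrable lborel f"
  shows "integrable lborel (\<lambda>x. f x *\<^sub>R cis (- (x \<bullet> \<xi>)))"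
proof (rule Bochner_Integration.integrable_bound[OF assms])
  have [measurable]: "f \<in> borel_measurable borel" using assms by auto
  show "(\<lambda>x. f x *\<^sub>R cis (- (x \<bullet> \<xi>))) \<in> borel_measurable lborel"
    by measurable
qed auto

lemma continuous_fourier:
  fixes f :: "'a::euclidean_space \<Rightarrow> real"
  assumes f: "integrable lborel f"
  shows "continuous_on UNIV (fourier f)"
proof (unfold continuous_on_sequentially, intro ballI allI impI)
  fix s :: "nat \<Rightarrow> 'a" and \<xi> assume "(\<forall>n. s n \<in> UNIV) \<and> s \<longlonglongrightarrow> \<xi>"
  then have s: "s \<longlonglongrightarrow> \<xi>" by simp
  have [measurable]: "f \<in> borel_measurable borel" using f by auto
  have "(\<lambda>k. LINT x|lborel. f x *\<^sub>R cis (- (x \<bullet> s k))) \<longlonglongrightarrow> (LINT x|lborel. f x *\<^sub>R cis (- (x \<bullet> \<xi>)))"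
  proof (rule integral_dominated_convergence[where w = "\<lambda>x. \<bar>f x\<bar>"])
    have "isCont cis t" for t
      using continuous_on_cis[of UNIV "\<lambda>x. x"] by (simp add: continuous_on_eq_continuous_at)
    then show "AE x in lborel. (\<lambda>k. f x *\<^sub>R cis (- (x \<bullet> s k))) \<longlonglongrightarrow> f x *\<^sub>R cis (- (x \<bullet> \<xi>))"
      by (intro AE_I2 tendsto_scaleR tendsto_const isCont_tendsto_compose[of _ cis]
            tendsto_minus tendsto_inner s)
  qed (use f in auto)
  then show "(fourier f \<circ> s) \<longlonglongrightarrow> fourier f \<xi>"
    unfolding fourier_def o_def by (intro tendsto_intros)
qed

lemma borel_measurable_fourier [measurable]:
  "integrable lborel f \<Longrightarrow> fourier f \<in> borel_measurable borel"
  by (rule borel_measurable_continuous_onI) (rule continuous_fourier)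

lemma norm_fourier_le:
  fixes f :: "'a::euclidean_space \<Rightarrow> real"
  assumes f: "integrable lborel f"
  shows "cmod (fourier f \<xi>) \<le> L1_norm f"
proof -
  have "cmod (LINT x|lborel. f x *\<^sub>R cis (- (x \<bullet> \<xi>))) \<le> (LINT x|lborel. norm (f x *\<^sub>R cis (- (x \<bullet> \<xi>))))"
    by (rule integral_norm_bound)
  then have b: "cmod (LINT x|lborel. f x *\<^sub>R cis (- (x \<bullet> \<xi>))) \<le> L1_norm f"
    by (simp add: L1_norm_def)
  have "(2 * pi) powr (- (real DIM('a) / 2)) \<le> (2 * pi) powr 0"
    using pi_ge_two by (intro powr_mono) auto
  then have "(2 * pi) powr (- (real DIM('a) / 2)) \<le> 1"
    by simp
  then have "(2 * pi) powr (- (real DIM('a) / 2)) * cmod (LINT x|lborel. f x *\<^sub>R cis (- (x \<bullet> \<xi>))) \<le> 1 * L1_norm f"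
    using b by (intro mult_mono) auto
  then show ?thesis by (simp add: fourier_def)
qed

lemma
  fixes f :: "'a::euclidean_space \<Rightarrow> 'b::{banach, second_countable_topology}"
  assumes c: "c > 0"
  shows integrable_scaling: "integrable lborel f \<Longrightarrow> integrable lborel (\<lambda>x. f (c *\<^sub>R x))"
    and integral_scaling: "f \<in> borel_measurable borel \<Longrightarrow>
      c ^ DIM('a) *\<^sub>R (LINT x|lborel. f (c *\<^sub>R x)) = integral\<^sup>L lborel f"
proof -
  have l: "lborel = density (distr lborel borel (\<lambda>x::'a. c *\<^sub>R x)) (\<lambda>_. ennreal (c ^ DIM('a)))"
    using lborel_affine[of c "0::'a"] c by (simp add: ennreal_power)
  show "c ^ DIM('a) *\<^sub>R (LINT x|lborel. f (c *\<^sub>R x)) = integral\<^sup>L lborel f" if [measurable]: "f \<in> borel_measurable borel"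
    using c by (subst (2) l, subst integral_density) (auto simp: integral_distr)
  show "integrable lborel (\<lambda>x. f (c *\<^sub>R x))" if f: "integrable lborel f"
  proof -
    have [measurable]: "f \<in> borel_measurable borel" using f by auto
    from f have "integrable (distr lborel borel (\<lambda>x::'a. c *\<^sub>R x)) (\<lambda>x. c ^ DIM('a) *\<^sub>R f x)"
      using c by (subst (asm) l, subst (asm) integrable_density) auto
    then have "integrable lborel (\<lambda>x. c ^ DIM('a) *\<^sub>R f (c *\<^sub>R x))"
      by (subst (asm) integrable_distr_eq) auto
    then have "integrable lborel (\<lambda>x. inverse (c ^ DIM('a)) *\<^sub>R c ^ DIM('a) *\<^sub>R f (c *\<^sub>R x))"
      by (rule integrable_scaleR_right)
    then show ?thesis using c by simp
  qed
qed

lemma integrable_gaussian: "integrable lborel (\<lambda>\<xi>::'a::euclidean_space. exp (- (norm \<xi>)\<^sup>2 / 2))"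
  using integrable_norm[OF gaussian_transform(1)[of 0]] by simp

lemma integral_gaussian: "(LINT \<xi>|lborel. exp (- (norm (\<xi>::'a::euclidean_space))\<^sup>2 / 2)) = sqrt (2 * pi) ^ DIM('a)"
proof -
  have "complex_of_real (LINT \<xi>|lborel. exp (- (norm (\<xi>::'a))\<^sup>2 / 2)) = complex_of_real (sqrt (2 * pi) ^ DIM('a))"
    using gaussian_transform(2)[of "0::'a"] by (simp add: scaleR_conv_of_real del: of_real_power)
  then show ?thesis using of_real_eq_iff by blast
qed

text \<open>Fubini moves the transform from \<open>g\<close> onto the Gaussian, which reproduces
  itself up to a constant.\<close>

lemma gaussian_multiplication_formula:
  fixes g :: "'a::euclidean_space \<Rightarrow> real"
  assumes g: "integrable lborel g"
  shows "(LINT \<xi>|lborel. exp (- (norm \<xi>)\<^sup>2 / 2) *\<^sub>R (LINT x|lborel. g x *\<^sub>R cis (- (x \<bullet> \<xi>)))) =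
    complex_of_real (sqrt (2 * pi) ^ DIM('a) * (LINT x|lborel. g x * exp (- (norm x)\<^sup>2 / 2)))"
proof -
  have [measurable]: "g \<in> borel_measurable borel" using g by auto
  have int: "integrable (lborel \<Otimes>\<^sub>M lborel)
      (\<lambda>(\<xi>::'a, x). exp (- (norm \<xi>)\<^sup>2 / 2) *\<^sub>R g x *\<^sub>R cis (- (x \<bullet> \<xi>)))" (is "integrable _ (\<lambda>(\<xi>, x). ?K \<xi> x)")
  proof (rule lborel_pair.Fubini_integrable)
    show "integrable lborel (\<lambda>\<xi>. LINT x|lborel. norm (case (\<xi>, x) of (\<xi>, x) \<Rightarrow> ?K \<xi> x))"
      using integrable_mult_left[OF integrable_gaussian, of "LINT x|lborel. \<bar>g x\<bar>"] by (simp add: abs_mult)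
    show "AE \<xi> in lborel. integrable lborel (\<lambda>x. case (\<xi>, x) of (\<xi>, x) \<Rightarrow> ?K \<xi> x)"
      by (auto intro!: integrable_fourier_integrand g)
  qed measurable
  have "(LINT \<xi>|lborel. exp (- (norm \<xi>)\<^sup>2 / 2) *\<^sub>R (LINT x|lborel. g x *\<^sub>R cis (- (x \<bullet> \<xi>)))) =
      (LINT \<xi>|lborel. LINT x|lborel. ?K \<xi> x)"
    unfolding integral_scaleR_right ..
  also have "\<dots> = (LINT x|lborel. LINT \<xi>|lborel. ?K \<xi> x)"
    by (rule lborel_pair.Fubini_integral[OF int, symmetric])
  also have "\<dots> = (LINT x|lborel. complex_of_real (sqrt (2 * pi) ^ DIM('a)) * complex_of_real (g x * exp (- (norm x)\<^sup>2 / 2)))"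
  proof (rule Bochner_Integration.integral_cong[OF refl])
    fix x :: 'a
    have "(LINT \<xi>|lborel. ?K \<xi> x) = (LINT \<xi>|lborel. g x *\<^sub>R (exp (- (norm \<xi>)\<^sup>2 / 2) *\<^sub>R cis ((- x) \<bullet> \<xi>)))"
      by (simp add: mult.commute)
    also have "\<dots> = g x *\<^sub>R complex_of_real (sqrt (2 * pi) ^ DIM('a) * exp (- (norm (- x))\<^sup>2 / 2))"
      unfolding integral_scaleR_right gaussian_transform(2) ..
    finally show "(LINT \<xi>|lborel. ?K \<xi> x) = complex_of_real (sqrt (2 * pi) ^ DIM('a)) * complex_of_real (g x * exp (- (norm x)\<^sup>2 / 2))"
      by (simp add: scaleR_conv_of_real mult_ac)
  qed
  also have "\<dots> = complex_of_real (sqrt (2 * pi) ^ DIM('a)) * complex_of_real (LINT x|lborel. g x * exp (- (norm x)\<^sup>2 / 2))"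
    unfolding integral_mult_right_zero integral_complex_of_real ..
  finally show ?thesis by simp
qed

text \<open>Meant for \<open>c\<close> tending to 0: the Gaussian weight on the left tends to 1,
  while on the right \<open>g\<close> is evaluated closer and closer to the origin. In the limit
  this is Fourier inversion at 0.\<close>

lemma gaussian_multiplication_scaled:
  fixes g :: "'a::euclidean_space \<Rightarrow> real"
  assumes g: "integrable lborel g" and c: "c > 0"
  shows "(LINT \<xi>|lborel. exp (- (norm (c *\<^sub>R \<xi>))\<^sup>2 / 2) *\<^sub>R (LINT x|lborel. g x *\<^sub>R cis (- (x \<bullet> \<xi>)))) =
    complex_of_real (sqrt (2 * pi) ^ DIM('a) * (LINT x|lborel. g (c *\<^sub>R x) * exp (- (norm x)\<^sup>2 / 2)))"
proof -
  have [measurable]: "g \<in> borel_measurable borel" using g by auto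
  let ?F = "\<lambda>\<xi>. LINT x|lborel. g x *\<^sub>R cis (- (x \<bullet> \<xi>))"
  have F: "?F \<xi> = c ^ DIM('a) *\<^sub>R (LINT x|lborel. g (c *\<^sub>R x) *\<^sub>R cis (- (x \<bullet> (c *\<^sub>R \<xi>))))" for \<xi>
    by (subst integral_scaling[OF c, symmetric]) auto
  have "(LINT \<xi>|lborel. exp (- (norm (c *\<^sub>R \<xi>))\<^sup>2 / 2) *\<^sub>R ?F \<xi>) =
      c ^ DIM('a) *\<^sub>R (LINT \<xi>|lborel. exp (- (norm (c *\<^sub>R \<xi>))\<^sup>2 / 2) *\<^sub>R
         (LINT x|lborel. g (c *\<^sub>R x) *\<^sub>R cis (- (x \<bullet> (c *\<^sub>R \<xi>)))))"
    unfolding F by (subst integral_scaleR_right[symmetric]) (simp add: mult_ac)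
  also have "\<dots> = (LINT \<xi>|lborel. exp (- (norm \<xi>)\<^sup>2 / 2) *\<^sub>R
         (LINT x|lborel. g (c *\<^sub>R x) *\<^sub>R cis (- (x \<bullet> \<xi>))))"
    by (rule integral_scaling[OF c]) measurable
  also have "\<dots> = complex_of_real (sqrt (2 * pi) ^ DIM('a) * (LINT x|lborel. g (c *\<^sub>R x) * exp (- (norm x)\<^sup>2 / 2)))"
    by (rule gaussian_multiplication_formula[OF integrable_scaling[OF c g]])
  finally show ?thesis .
qed

section \<open>Plancherel's theorem\<close>

text \<open>The convolution of \<open>f\<close> with its reflection. Its transform is the squared
  modulus of the transform of \<open>f\<close> and its value at 0 is the squared L^2 norm, so
  Plancherel becomes inversion at the single point 0.\<close>

definition autocorrelation :: "('a::euclidean_space \<Rightarrow> real) \<Rightarrow> 'a \<Rightarrow> real" where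
  "autocorrelation f h = (LINT x|lborel. f x * f (x + h))"

lemma square_integrable_shift:
  fixes f :: "'a::euclidean_space \<Rightarrow> real"
  assumes "square_integrable f"
  shows "integrable lborel (\<lambda>x. (f (x + h))\<^sup>2)" "integrable lborel (\<lambda>x. f x * f (x + h))"
    "(LINT x|lborel. (f (x + h))\<^sup>2) = (LINT x|lborel. (f x)\<^sup>2)"
proof -
  have [measurable]: "f \<in> borel_measurable borel" and f: "integrable lborel (\<lambda>x. (f x)\<^sup>2)"
    using assms by (auto simp: square_integrable_def)
  show i: "integrable lborel (\<lambda>x. (f (x + h))\<^sup>2)"
    by (rule integrable_shift[OF f])
  show "integrable lborel (\<lambda>x. f x * f (x + h))"
  proof (rule Bochner_Integration.integrable_bound[OF Bochner_Integration.integrable_add[OF f i]])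
    have "\<bar>a * b\<bar> \<le> a\<^sup>2 + b\<^sup>2" for a b :: real
      using sum_squares_bound[of "\<bar>a\<bar>" "\<bar>b\<bar>"] mult_nonneg_nonneg[of "\<bar>a\<bar>" "\<bar>b\<bar>"]
      unfolding abs_mult power2_abs by linarith
    then show "AE x in lborel. norm (f x * f (x + h)) \<le> norm ((f x)\<^sup>2 + (f (x + h))\<^sup>2)"
      by simp
  qed measurable
  show "(LINT x|lborel. (f (x + h))\<^sup>2) = (LINT x|lborel. (f x)\<^sup>2)"
    by (rule integral_shift) measurable
qed

text \<open>Expanding the squares, since \<open>f\<close> and its translate have the same norm. The
  first identity reduces continuity at 0 to continuity of translations in L^2; both together bound
  the autocorrelation by its value at 0.\<close>

lemma autocorrelation_defect:
  fixes f :: "'a::euclidean_space \<Rightarrow> real"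
  assumes f: "square_integrable f"
  shows "autocorrelation f 0 - autocorrelation f h = (LINT x|lborel. (f (x + h) - f x)\<^sup>2) / 2"
    and "autocorrelation f 0 + autocorrelation f h = (LINT x|lborel. (f (x + h) + f x)\<^sup>2) / 2"
    and "integrable lborel (\<lambda>x. (f (x + h) - f x)\<^sup>2)"
proof -
  have i: "integrable lborel (\<lambda>x. (f x)\<^sup>2)" using f by (simp add: square_integrable_def)
  note s = square_integrable_shift[OF f, of h]
  have e: "(f (x + h) - f x)\<^sup>2 = (f (x + h))\<^sup>2 + (f x)\<^sup>2 - 2 * (f x * f (x + h))"
    "(f (x + h) + f x)\<^sup>2 = (f (x + h))\<^sup>2 + (f x)\<^sup>2 + 2 * (f x * f (x + h))" for x
    by (simp_all add: power2_diff power2_sum)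
  have a0: "autocorrelation f 0 = (LINT x|lborel. (f x)\<^sup>2)"
    by (simp add: autocorrelation_def power2_eq_square)
  show "autocorrelation f 0 - autocorrelation f h = (LINT x|lborel. (f (x + h) - f x)\<^sup>2) / 2"
    "autocorrelation f 0 + autocorrelation f h = (LINT x|lborel. (f (x + h) + f x)\<^sup>2) / 2"
    unfolding a0 unfolding autocorrelation_def e using i s by simp_all
  show "integrable lborel (\<lambda>x. (f (x + h) - f x)\<^sup>2)"
    unfolding e using i s by simp
qed

lemma abs_autocorrelation_le:
  fixes f :: "'a::euclidean_space \<Rightarrow> real"
  assumes f: "square_integrable f"
  shows "\<bar>autocorrelation f h\<bar> \<le> autocorrelation f 0"
proof -
  have "0 \<le> autocorrelation f 0 - autocorrelation f h" "0 \<le> autocorrelation f 0 + autocorrelation f h"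
    unfolding autocorrelation_defect[OF f] by simp_all
  then show ?thesis by linarith
qed

text \<open>Continuity of translations is known in L^1 only. It is applied to the signed square
  \<open>f x * abs (f x)\<close>, whose L^1 distance to its translate controls the squared L^2
  distance of \<open>f\<close> to its translate.\<close>

lemma autocorrelation_tendsto:
  fixes f :: "'a::euclidean_space \<Rightarrow> real"
  assumes f: "square_integrable f" and h: "h \<longlonglongrightarrow> 0"
  shows "(\<lambda>k::nat. autocorrelation f (h k)) \<longlonglongrightarrow> autocorrelation f 0"
proof -
  have [measurable]: "f \<in> borel_measurable borel" and i: "integrable lborel (\<lambda>x. (f x)\<^sup>2)"
    using f by (auto simp: square_integrable_def)
  let ?s = "\<lambda>x. f x * \<bar>f x\<bar>"
  have si: "integrable lborel ?s"
    by (rule Bochner_Integration.integrable_bound[OF i]) (auto simp: abs_mult power2_eq_square)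
  \<comment> \<open>For equal signs the signed squares differ by a difference of squares; for
    opposite signs they add up to the full sum of squares.\<close>
  have sq: "(a - b)\<^sup>2 \<le> 2 * \<bar>a * \<bar>a\<bar> - b * \<bar>b\<bar>\<bar>" for a b :: real
  proof -
    have same: "(x - y)\<^sup>2 \<le> \<bar>x\<^sup>2 - y\<^sup>2\<bar>" if "0 \<le> x" "0 \<le> y" for x y :: real
    proof -
      have "(x - y)\<^sup>2 = \<bar>x - y\<bar> * \<bar>x - y\<bar>" by (simp add: power2_eq_square)
      also have "\<dots> \<le> \<bar>x + y\<bar> * \<bar>x - y\<bar>" using that by (intro mult_right_mono) auto
      also have "\<dots> = \<bar>x\<^sup>2 - y\<^sup>2\<bar>" by (simp add: power2_eq_square algebra_simps flip: abs_mult)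
      finally show ?thesis .
    qed
    have opp: "(x + y)\<^sup>2 \<le> 2 * (x\<^sup>2 + y\<^sup>2)" for x y :: real
      using zero_le_power2[of "x - y"] unfolding power2_sum power2_diff by (simp add: algebra_simps)
    consider "0 \<le> a" "0 \<le> b" | "a \<le> 0" "b \<le> 0" | "0 \<le> a" "b \<le> 0" | "a \<le> 0" "0 \<le> b"
      by linarith
    then show ?thesis
    proof cases
      case 1
      have "\<bar>a * \<bar>a\<bar> - b * \<bar>b\<bar>\<bar> = \<bar>a\<^sup>2 - b\<^sup>2\<bar>"
        using 1 by (simp add: power2_eq_square)
      then have "(a - b)\<^sup>2 \<le> \<bar>a * \<bar>a\<bar> - b * \<bar>b\<bar>\<bar>" using same[OF 1] by simp
      then show ?thesis by (rule order_trans) simp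
    next
      case 2
      have "\<bar>a * \<bar>a\<bar> - b * \<bar>b\<bar>\<bar> = \<bar>a\<^sup>2 - b\<^sup>2\<bar>"
        using 2 by (simp add: power2_eq_square)
      moreover have "(a - b)\<^sup>2 \<le> \<bar>a\<^sup>2 - b\<^sup>2\<bar>"
        using same[of "- a" "- b"] 2 by (simp add: power2_commute[of b a])
      ultimately have "(a - b)\<^sup>2 \<le> \<bar>a * \<bar>a\<bar> - b * \<bar>b\<bar>\<bar>" by simp
      then show ?thesis by (rule order_trans) simp
    next
      case 3
      have "\<bar>a * \<bar>a\<bar> - b * \<bar>b\<bar>\<bar> = a\<^sup>2 + b\<^sup>2"
        using 3 by (simp add: power2_eq_square)
      then show ?thesis using opp[of a "- b"] by simp
    next
      case 4
      have "\<bar>a * \<bar>a\<bar> - b * \<bar>b\<bar>\<bar> = \<bar>- (a\<^sup>2 + b\<^sup>2)\<bar>"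
        using 4 by (simp add: power2_eq_square)
      then show ?thesis using opp[of a "- b"] by simp
    qed
  qed
  have lim: "(\<lambda>k. LINT x|lborel. \<bar>?s (x + h k) - ?s x\<bar>) \<longlonglongrightarrow> 0"
    by (rule L1_translation_continuous[OF si h])
  have "(\<lambda>k. autocorrelation f 0 - autocorrelation f (h k)) \<longlonglongrightarrow> 0"
  proof (rule tendsto_sandwich[OF always_eventually always_eventually tendsto_const lim]; intro allI)
    fix k
    show "0 \<le> autocorrelation f 0 - autocorrelation f (h k)"
      using abs_autocorrelation_le[OF f, of "h k"] by linarith
    have "(LINT x|lborel. (f (x + h k) - f x)\<^sup>2) \<le> (LINT x|lborel. 2 * \<bar>?s (x + h k) - ?s x\<bar>)"
      using integrable_shift[OF si, of "h k"] si autocorrelation_defect(3)[OF f]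
      by (intro integral_mono sq) auto
    then show "autocorrelation f 0 - autocorrelation f (h k) \<le> (LINT x|lborel. \<bar>?s (x + h k) - ?s x\<bar>)"
      unfolding autocorrelation_defect(1)[OF f] by simp
  qed
  then have "(\<lambda>k. autocorrelation f 0 - (autocorrelation f 0 - autocorrelation f (h k))) \<longlonglongrightarrow> autocorrelation f 0 - 0"
    by (intro tendsto_intros)
  then show ?thesis by simp
qed

text \<open>Fubini for \<open>f x * f (x + h)\<close>. The phase factors into one part in
  \<open>x\<close> and one in \<open>x + h\<close>; the second gives the transform of
  \<open>f\<close> and the first its complex conjugate, as \<open>f\<close> is real.\<close>

lemma
  fixes f :: "'a::euclidean_space \<Rightarrow> real"
  assumes f: "integrable lborel f" and f2: "square_integrable f"
  shows integrable_autocorrelation: "integrable lborel (autocorrelation f)"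
    and fourier_autocorrelation: "(LINT h|lborel. autocorrelation f h *\<^sub>R cis (- (h \<bullet> \<xi>))) =
      complex_of_real ((cmod (LINT x|lborel. f x *\<^sub>R cis (- (x \<bullet> \<xi>))))\<^sup>2)"
proof -
  have [measurable]: "f \<in> borel_measurable borel" using f by auto
  let ?N = "LINT x|lborel. \<bar>f x\<bar>"
  have N: "(LINT h|lborel. \<bar>f (x + h)\<bar>) = ?N" for x
    using integral_shift[of "\<lambda>x. \<bar>f x\<bar>" x] by (simp add: add.commute)
  have sh: "integrable lborel (\<lambda>h. f (x + h))" for x
    using integrable_shift[OF f, of x] by (simp add: add.commute)
  have int: "integrable (lborel \<Otimes>\<^sub>M lborel) (\<lambda>(x, h). f x * f (x + h))"
  proof (rule lborel_pair.Fubini_integrable)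
    show "integrable lborel (\<lambda>x. LINT h|lborel. norm (case (x, h) of (x, h) \<Rightarrow> f x * f (x + h)))"
      using f by (simp add: abs_mult N)
    show "AE x in lborel. integrable lborel (\<lambda>h. case (x, h) of (x, h) \<Rightarrow> f x * f (x + h))"
      using sh by simp
  qed measurable
  from lborel_pair.integrable_snd[OF int]
  show "integrable lborel (autocorrelation f)"
    unfolding autocorrelation_def[abs_def] .
  have intc: "integrable (lborel \<Otimes>\<^sub>M lborel) (\<lambda>(x, h). (f x * f (x + h)) *\<^sub>R cis (- (h \<bullet> \<xi>)))"
    by (rule Bochner_Integration.integrable_bound[OF int]) (auto simp: split_beta')
  let ?F = "LINT x|lborel. f x *\<^sub>R cis (- (x \<bullet> \<xi>))"
  have "(LINT h|lborel. autocorrelation f h *\<^sub>R cis (- (h \<bullet> \<xi>))) =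
      (LINT h|lborel. LINT x|lborel. (f x * f (x + h)) *\<^sub>R cis (- (h \<bullet> \<xi>)))"
    unfolding autocorrelation_def
    by (intro Bochner_Integration.integral_cong refl integral_scaleR_left[symmetric])
      (use square_integrable_shift(2)[OF f2] in auto)
  also have "\<dots> = (LINT x|lborel. LINT h|lborel. (f x * f (x + h)) *\<^sub>R cis (- (h \<bullet> \<xi>)))"
    by (rule lborel_pair.Fubini_integral[OF intc])
  also have "\<dots> = (LINT x|lborel. (f x *\<^sub>R cis (x \<bullet> \<xi>)) * ?F)"
  proof (rule Bochner_Integration.integral_cong[OF refl])
    fix x
    have c: "cis (- (h \<bullet> \<xi>)) = cis (x \<bullet> \<xi>) * cis (- ((h + x) \<bullet> \<xi>))" for h
      by (simp add: cis_mult inner_left_distrib)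
    have "(LINT h|lborel. (f x * f (x + h)) *\<^sub>R cis (- (h \<bullet> \<xi>))) =
        (LINT h|lborel. (f x *\<^sub>R cis (x \<bullet> \<xi>)) * (f (h + x) *\<^sub>R cis (- ((h + x) \<bullet> \<xi>))))"
      by (intro Bochner_Integration.integral_cong refl, subst c)
        (simp add: scaleR_conv_of_real mult_ac add.commute)
    also have "\<dots> = (f x *\<^sub>R cis (x \<bullet> \<xi>)) * (LINT h|lborel. f (h + x) *\<^sub>R cis (- ((h + x) \<bullet> \<xi>)))"
      by (rule integral_mult_right_zero)
    also have "(LINT h|lborel. f (h + x) *\<^sub>R cis (- ((h + x) \<bullet> \<xi>))) = ?F"
      by (rule integral_shift[of "\<lambda>z. f z *\<^sub>R cis (- (z \<bullet> \<xi>))"]) measurable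
    finally show "(LINT h|lborel. (f x * f (x + h)) *\<^sub>R cis (- (h \<bullet> \<xi>))) = (f x *\<^sub>R cis (x \<bullet> \<xi>)) * ?F" .
  qed
  also have "\<dots> = (LINT x|lborel. f x *\<^sub>R cis (x \<bullet> \<xi>)) * ?F"
    by (rule integral_mult_left_zero)
  also have "(LINT x|lborel. f x *\<^sub>R cis (x \<bullet> \<xi>)) = cnj ?F"
    using Bochner_Integration.integral_cnj[of lborel "\<lambda>x. f x *\<^sub>R cis (- (x \<bullet> \<xi>))"] by (simp add: cis_cnj)
  also have "cnj ?F * ?F = complex_of_real ((cmod ?F)\<^sup>2)"
    by (simp only: complex_norm_square mult.commute)
  finally show "(LINT h|lborel. autocorrelation f h *\<^sub>R cis (- (h \<bullet> \<xi>))) = complex_of_real ((cmod ?F)\<^sup>2)" .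
qed

text \<open>The squared transform is tested against Gaussians that increase to 1. On the frequency
  side monotone convergence applies and yields integrability as well; on the other side dominated
  convergence applies, with limit a multiple of the autocorrelation at 0.\<close>

lemma plancherel_unnormalized:
  fixes f :: "'a::euclidean_space \<Rightarrow> real"
  assumes f: "integrable lborel f" "square_integrable f"
  defines "F \<equiv> \<lambda>\<xi>. LINT x|lborel. f x *\<^sub>R cis (- (x \<bullet> \<xi>))"
  shows "has_bochner_integral lborel (\<lambda>\<xi>. (cmod (F \<xi>))\<^sup>2) ((2 * pi) ^ DIM('a) * (LINT x|lborel. (f x)\<^sup>2))"
proof -
  have [measurable]: "f \<in> borel_measurable borel" using f by auto
  have [measurable]: "F \<in> borel_measurable borel" unfolding F_def by measurable
  let ?\<rho> = "autocorrelation f" and ?S = "sqrt (2 * pi) ^ DIM('a)"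
  have \<rho>: "integrable lborel ?\<rho>" by (rule integrable_autocorrelation[OF f])
  have [measurable]: "?\<rho> \<in> borel_measurable borel" using \<rho> by auto
  define c where "c k = inverse (real (Suc k))" for k
  have c: "c k > 0" for k by (simp add: c_def)
  have cl: "c \<longlonglongrightarrow> 0" unfolding c_def[abs_def] by (rule LIMSEQ_inverse_real_of_nat)
  let ?g = "\<lambda>k \<xi>. exp (- (norm (c k *\<^sub>R \<xi>))\<^sup>2 / 2) * (cmod (F \<xi>))\<^sup>2"
  have Fb: "(cmod (F \<xi>))\<^sup>2 \<le> (LINT x|lborel. \<bar>f x\<bar>)\<^sup>2" for \<xi>
  proof (rule power_mono)
    show "cmod (F \<xi>) \<le> (LINT x|lborel. \<bar>f x\<bar>)"
      unfolding F_def by (rule order_trans[OF integral_norm_bound]) simp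
  qed simp
  have gint: "integrable lborel (?g k)" for k
  proof (rule Bochner_Integration.integrable_bound)
    show "integrable lborel (\<lambda>\<xi>::'a. exp (- (norm (c k *\<^sub>R \<xi>))\<^sup>2 / 2) * (LINT x|lborel. \<bar>f x\<bar>)\<^sup>2)"
      by (intro integrable_mult_left integrable_scaling[OF c integrable_gaussian])
    show "AE \<xi> in lborel. norm (?g k \<xi>) \<le> norm (exp (- (norm (c k *\<^sub>R \<xi>))\<^sup>2 / 2) * (LINT x|lborel. \<bar>f x\<bar>)\<^sup>2)"
      using Fb by (auto intro!: mult_left_mono simp: abs_mult)
  qed measurable
  have gval: "(LINT \<xi>|lborel. ?g k \<xi>) = ?S * (LINT x|lborel. ?\<rho> (c k *\<^sub>R x) * exp (- (norm x)\<^sup>2 / 2))" for k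
  proof -
    have "complex_of_real (LINT \<xi>|lborel. ?g k \<xi>) =
        (LINT \<xi>|lborel. exp (- (norm (c k *\<^sub>R \<xi>))\<^sup>2 / 2) *\<^sub>R (LINT h|lborel. ?\<rho> h *\<^sub>R cis (- (h \<bullet> \<xi>))))"
      unfolding fourier_autocorrelation[OF f] F_def by (simp add: scaleR_conv_of_real flip: integral_complex_of_real)
    also have "\<dots> = complex_of_real (?S * (LINT x|lborel. ?\<rho> (c k *\<^sub>R x) * exp (- (norm x)\<^sup>2 / 2)))"
      by (rule gaussian_multiplication_scaled[OF \<rho> c])
    finally show ?thesis using of_real_eq_iff by blast
  qed
  have "(\<lambda>k. LINT x|lborel. ?\<rho> (c k *\<^sub>R x) * exp (- (norm (x::'a))\<^sup>2 / 2)) \<longlonglongrightarrow>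
      (LINT x|lborel. ?\<rho> 0 * exp (- (norm (x::'a))\<^sup>2 / 2))"
  proof (rule integral_dominated_convergence[where w = "\<lambda>x. ?\<rho> 0 * exp (- (norm x)\<^sup>2 / 2)"])
    show "AE x in lborel. (\<lambda>k. ?\<rho> (c k *\<^sub>R x) * exp (- (norm (x::'a))\<^sup>2 / 2)) \<longlonglongrightarrow> ?\<rho> 0 * exp (- (norm x)\<^sup>2 / 2)"
    proof (intro AE_I2 tendsto_mult tendsto_const autocorrelation_tendsto f)
      fix x :: 'a
      show "(\<lambda>k. c k *\<^sub>R x) \<longlonglongrightarrow> 0"
        using tendsto_scaleR[OF cl tendsto_const, of x] by simp
    qed
    show "AE x in lborel. norm (?\<rho> (c k *\<^sub>R x) * exp (- (norm (x::'a))\<^sup>2 / 2)) \<le> ?\<rho> 0 * exp (- (norm x)\<^sup>2 / 2)" for k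
      using abs_autocorrelation_le[OF f(2)] by (auto intro!: mult_right_mono simp: abs_mult)
    show "integrable lborel (\<lambda>x::'a. ?\<rho> 0 * exp (- (norm x)\<^sup>2 / 2))"
      by (intro integrable_mult_right integrable_gaussian)
  qed measurable
  then have "(\<lambda>k. ?S * (LINT x|lborel. ?\<rho> (c k *\<^sub>R x) * exp (- (norm (x::'a))\<^sup>2 / 2))) \<longlonglongrightarrow> ?S * (?\<rho> 0 * ?S)"
    by (intro tendsto_mult tendsto_const) (simp add: integral_gaussian[simplified])
  also have "?S * (?\<rho> 0 * ?S) = (2 * pi) ^ DIM('a) * (LINT x|lborel. (f x)\<^sup>2)"
  proof -
    have "(sqrt (2 * pi))\<^sup>2 = 2 * pi" by (rule real_sqrt_pow2) simp
    then have "?S * ?S = (2 * pi) ^ DIM('a)"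
      by (simp only: power_mult_distrib[symmetric] power2_eq_square)
    moreover have "?\<rho> 0 = (LINT x|lborel. (f x)\<^sup>2)"
      by (simp add: autocorrelation_def power2_eq_square)
    ultimately show ?thesis by (metis mult.assoc mult.commute)
  qed
  finally have lim: "(\<lambda>k. LINT \<xi>|lborel. ?g k \<xi>) \<longlonglongrightarrow> (2 * pi) ^ DIM('a) * (LINT x|lborel. (f x)\<^sup>2)"
    unfolding gval .
  show ?thesis
  proof (rule has_bochner_integral_monotone_convergence[OF gint _ _ lim])
    show "AE \<xi> in lborel. mono (\<lambda>k. ?g k \<xi>)"
    proof (intro AE_I2 monoI mult_right_mono)
      fix \<xi> :: 'a and k j :: nat assume "k \<le> j"
      then have "c j \<le> c k" by (simp add: c_def field_simps)
      then have "norm (c j *\<^sub>R \<xi>) \<le> norm (c k *\<^sub>R \<xi>)"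
        using c[of j] c[of k] by (auto intro!: mult_right_mono)
      then have "(norm (c j *\<^sub>R \<xi>))\<^sup>2 \<le> (norm (c k *\<^sub>R \<xi>))\<^sup>2"
        by (intro power_mono) auto
      then show "exp (- (norm (c k *\<^sub>R \<xi>))\<^sup>2 / 2) \<le> exp (- (norm (c j *\<^sub>R \<xi>))\<^sup>2 / 2)"
        by simp
    qed auto
    show "AE \<xi> in lborel. (\<lambda>k. ?g k \<xi>) \<longlonglongrightarrow> (cmod (F \<xi>))\<^sup>2"
    proof (rule AE_I2)
      fix \<xi> :: 'a
      have "(\<lambda>k. ?g k \<xi>) \<longlonglongrightarrow> exp (- (norm (0 *\<^sub>R \<xi>))\<^sup>2 / 2) * (cmod (F \<xi>))\<^sup>2"
        by (intro tendsto_intros cl) auto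
      then show "(\<lambda>k. ?g k \<xi>) \<longlonglongrightarrow> (cmod (F \<xi>))\<^sup>2" by simp
    qed
  qed measurable
qed

lemma plancherel:
  fixes f :: "'a::euclidean_space \<Rightarrow> real"
  assumes f: "integrable lborel f" "square_integrable f"
  shows "square_integrable (fourier f)" and "L2_norm (fourier f) = L2_norm f"
proof -
  let ?F = "\<lambda>\<xi>. LINT x|lborel. f x *\<^sub>R cis (- (x \<bullet> \<xi>))"
  have nn: "(a powr (- (real n / 2)))\<^sup>2 * a ^ n = 1" if "a > 0" for a :: real and n
  proof -
    have "a ^ n = a powr real n" "(a powr (- (real n / 2)))\<^sup>2 = a powr (- real n)"
      using that by (simp_all add: powr_realpow powr_powr flip: powr_numeral)
    then show ?thesis using that by (simp flip: powr_add)
  qed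
  have n: "((2 * pi) powr (- (real DIM('a) / 2)))\<^sup>2 * (2 * pi) ^ DIM('a) = 1"
    by (rule nn) simp
  have sq: "(cmod (fourier f \<xi>))\<^sup>2 = ((2 * pi) powr (- (real DIM('a) / 2)))\<^sup>2 * (cmod (?F \<xi>))\<^sup>2" for \<xi>
    by (simp add: fourier_def power_mult_distrib)
  have "has_bochner_integral lborel (\<lambda>\<xi>. (cmod (fourier f \<xi>))\<^sup>2)
      (((2 * pi) powr (- (real DIM('a) / 2)))\<^sup>2 * ((2 * pi) ^ DIM('a) * (LINT x|lborel. (f x)\<^sup>2)))"
    unfolding sq by (intro has_bochner_integral_mult_right plancherel_unnormalized f)
  then have "has_bochner_integral lborel (\<lambda>\<xi>. (cmod (fourier f \<xi>))\<^sup>2) (LINT x|lborel. (f x)\<^sup>2)"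
    by (simp only: mult.assoc[symmetric] n mult_1_left)
  then show "square_integrable (fourier f)" "L2_norm (fourier f) = L2_norm f"
    using f(1) by (auto simp: square_integrable_def L2_norm_def has_bochner_integral_iff)
qed

section \<open>Minkowski's inequality and the transform on L^2\<close>

lemma square_integrable_add:
  fixes f g :: "'a::euclidean_space \<Rightarrow> 'b::euclidean_space"
  assumes "square_integrable f" "square_integrable g"
  shows "square_integrable (\<lambda>x. f x + g x)"
proof -
  have [measurable]: "f \<in> borel_measurable borel" "g \<in> borel_measurable borel"
    and i: "integrable lborel (\<lambda>x. (norm (f x))\<^sup>2)" "integrable lborel (\<lambda>x. (norm (g x))\<^sup>2)"
    using assms by (auto simp: square_integrable_def)
  have "integrable lborel (\<lambda>x. (norm (f x + g x))\<^sup>2)"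
  proof (rule Bochner_Integration.integrable_bound)
    show "integrable lborel (\<lambda>x. 2 * ((norm (f x))\<^sup>2 + (norm (g x))\<^sup>2))"
      using i by simp
    have "(norm (f x + g x))\<^sup>2 \<le> 2 * ((norm (f x))\<^sup>2 + (norm (g x))\<^sup>2)" for x
      using power_mono[OF norm_triangle_ineq[of "f x" "g x"], of 2]
        zero_le_power2[of "norm (f x) - norm (g x)"]
      by (simp add: power2_sum power2_diff)
    then show "AE x in lborel. norm ((norm (f x + g x))\<^sup>2) \<le> norm (2 * ((norm (f x))\<^sup>2 + (norm (g x))\<^sup>2))"
      by simp
  qed measurable
  then show ?thesis by (simp add: square_integrable_def)
qed

lemma square_integrable_diff:
  fixes f g :: "'a::euclidean_space \<Rightarrow> 'b::euclidean_space"
  assumes "square_integrable f" "square_integrable g"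
  shows "square_integrable (\<lambda>x. f x - g x)"
  using square_integrable_add[OF assms(1), of "\<lambda>x. - g x"] assms(2)
  by (simp add: square_integrable_def)

lemma L2_norm_nonneg [simp]: "0 \<le> L2_norm f"
  by (simp add: L2_norm_def)

lemma L2_norm_power2: "(L2_norm f)\<^sup>2 = (LINT x|lborel. (norm (f x))\<^sup>2)"
  by (simp add: L2_norm_def)

lemma L2_norm_triangle:
  fixes f g :: "'a::euclidean_space \<Rightarrow> 'b::euclidean_space"
  assumes f: "square_integrable f" and g: "square_integrable g"
  shows "L2_norm (\<lambda>x. f x + g x) \<le> L2_norm f + L2_norm g"
proof -
  let ?A = "L2_norm f" and ?B = "L2_norm g"
  have i: "integrable lborel (\<lambda>x. (norm (f x))\<^sup>2)" "integrable lborel (\<lambda>x. (norm (g x))\<^sup>2)"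
    "integrable lborel (\<lambda>x. (norm (f x + g x))\<^sup>2)"
    using f g square_integrable_add[OF f g] by (auto simp: square_integrable_def)
  have *: "(L2_norm (\<lambda>x. f x + g x))\<^sup>2 \<le> (?A + ?B)\<^sup>2 + e" if "e > 0" for e
  proof -
    \<comment> \<open>The shift by \<open>d\<close> keeps both weights positive even if a norm
      vanishes; its size keeps the final excess \<open>2 * d * (?A + ?B)\<close> below
      \<open>e\<close>.\<close>
    define d where "d = e / (2 * (?A + ?B + 1))"
    have d: "d > 0" "2 * d * (?A + ?B) \<le> e"
      using that by (auto simp: d_def divide_simps add_nonneg_pos)
    define a b where "a = ?A + d" and "b = ?B + d"
    have ab: "a > 0" "b > 0" using d by (auto simp: a_def b_def add_nonneg_pos)
    \<comment> \<open>convexity of the square with weights proportional to the (perturbed) norms\<close>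
    have cvx: "(x + y)\<^sup>2 \<le> (a + b) * (x\<^sup>2 / a + y\<^sup>2 / b)" for x y :: real
    proof -
      have "(a + b) * (x\<^sup>2 / a + y\<^sup>2 / b) - (x + y)\<^sup>2 = (b * x - a * y)\<^sup>2 / (a * b)"
        using ab by (simp add: field_simps power2_eq_square)
      also have "\<dots> \<ge> 0" using ab by simp
      finally show ?thesis by simp
    qed
    have "(L2_norm (\<lambda>x. f x + g x))\<^sup>2 \<le> (LINT x|lborel. (a + b) * ((norm (f x))\<^sup>2 / a + (norm (g x))\<^sup>2 / b))"
      unfolding L2_norm_power2 using i
      by (intro integral_mono order_trans[OF power_mono[OF norm_triangle_ineq] cvx]) auto
    also have "\<dots> = (a + b) * (?A\<^sup>2 / a + ?B\<^sup>2 / b)"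
      using i by (simp add: L2_norm_power2)
    also have "\<dots> \<le> (a + b) * (?A + ?B)"
    proof (intro mult_left_mono add_mono)
      show "?A\<^sup>2 / a \<le> ?A" "?B\<^sup>2 / b \<le> ?B"
        using ab d by (auto simp: a_def b_def divide_simps power2_eq_square intro: mult_left_mono)
    qed (use ab in auto)
    also have "\<dots> = (?A + ?B)\<^sup>2 + 2 * d * (?A + ?B)"
      by (simp add: a_def b_def power2_eq_square algebra_simps)
    finally show ?thesis using d by linarith
  qed
  have "(L2_norm (\<lambda>x. f x + g x))\<^sup>2 \<le> (?A + ?B)\<^sup>2"
    by (rule field_le_epsilon) (rule *)
  then show ?thesis by (rule power2_le_imp_le) simp
qed

lemma L2_norm_diff_le:
  fixes f g :: "'a::euclidean_space \<Rightarrow> 'b::euclidean_space"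
  assumes f: "square_integrable f" and g: "square_integrable g"
  shows "\<bar>L2_norm f - L2_norm g\<bar> \<le> L2_norm (\<lambda>x. f x - g x)"
proof -
  have "L2_norm (\<lambda>x. g x - f x) = L2_norm (\<lambda>x. f x - g x)"
    by (simp add: L2_norm_def norm_minus_commute)
  then show ?thesis
    using L2_norm_triangle[OF square_integrable_diff[OF f g] g] L2_norm_triangle[OF square_integrable_diff[OF g f] f]
    by simp
qed

lemma L2_norm_tendsto:
  fixes f :: "'a::euclidean_space \<Rightarrow> 'b::euclidean_space"
  assumes F: "\<And>k. square_integrable (F k)" and f: "square_integrable f"
    and lim: "(\<lambda>k. L2_norm (\<lambda>x. F k x - f x)) \<longlonglongrightarrow> 0"
  shows "(\<lambda>k. L2_norm (F k)) \<longlonglongrightarrow> L2_norm f"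
proof -
  have "(\<lambda>k. L2_norm (F k) - L2_norm f) \<longlonglongrightarrow> 0"
    by (rule Lim_null_comparison[OF always_eventually lim]) (use L2_norm_diff_le[OF F f] in auto)
  then show ?thesis by (simp add: LIM_zero_iff)
qed

text \<open>Both norms are limits of the norms of the approximating functions, and for these
  Plancherel is already available.\<close>

lemma has_L2_fourier_norm:
  assumes "has_L2_fourier f g"
  shows "square_integrable f" "L2_norm f = L2_norm g"
proof -
  obtain F where F: "\<And>k::nat. integrable lborel (F k)" "\<And>k. square_integrable (F k)"
      "\<And>k. square_integrable (fourier (F k))"
      "(\<lambda>k. L2_norm (\<lambda>x. F k x - f x)) \<longlonglongrightarrow> 0" "(\<lambda>k. L2_norm (\<lambda>\<xi>. fourier (F k) \<xi> - g \<xi>)) \<longlonglongrightarrow> 0"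
    and f: "square_integrable f" and g: "square_integrable g"
    using assms unfolding has_L2_fourier_def by blast
  show "square_integrable f" by fact
  have "(\<lambda>k. L2_norm (F k)) \<longlonglongrightarrow> L2_norm f"
    by (rule L2_norm_tendsto[OF F(2) f F(4)])
  moreover have "(\<lambda>k. L2_norm (F k)) \<longlonglongrightarrow> L2_norm g"
    using L2_norm_tendsto[OF F(3) g F(5)] by (simp add: plancherel(2)[OF F(1,2)])
  ultimately show "L2_norm f = L2_norm g" by (rule LIMSEQ_unique)
qed

section \<open>Integrals of radial functions\<close>

text \<open>The derivative at radius 1 of the volume of a ball. In dimension one it equals 2,
  counting the two end points.\<close>

definition sphere_area :: "nat \<Rightarrow> real" where
  "sphere_area n = real n * unit_ball_vol (real n)"

lemma sphere_area_pos: "n > 0 \<Longrightarrow> sphere_area n > 0"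
  by (simp add: sphere_area_def)

text \<open>It suffices to compare the measures on the half-lines \<open>{..a}\<close>, which are
  stable under intersection. Their preimages are balls, and the volume of a ball is the integral of
  the density by the fundamental theorem of calculus.\<close>

lemma distr_norm_lborel:
  "distr (lborel :: 'a::euclidean_space measure) borel norm =
    density lborel (\<lambda>\<rho>. ennreal (indicator {0..} \<rho> * (sphere_area DIM('a) * \<rho> ^ (DIM('a) - 1))))"
  (is "?M = density lborel (\<lambda>\<rho>. ennreal (?w \<rho>))")
proof (rule measure_eqI_generator_eq[where E = "range atMost" and \<Omega> = UNIV and A = "\<lambda>i::nat. {..real i}"])
  have w: "?w \<rho> \<ge> 0" for \<rho>
    by (auto simp: sphere_area_def split: split_indicator)
  show eq: "emeasure ?M X = emeasure (density lborel (\<lambda>\<rho>. ennreal (?w \<rho>))) X" if X: "X \<in> range atMost" for X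
  proof -
    obtain a where a: "X = {..a}" using X by auto
    have M: "emeasure ?M X = emeasure lborel (cball (0::'a) a)"
      by (subst emeasure_distr) (auto simp: a cball_def intro!: arg_cong2[where f = emeasure])
    have N: "emeasure (density lborel (\<lambda>\<rho>. ennreal (?w \<rho>))) X =
        (\<integral>\<^sup>+\<rho>. ennreal (sphere_area DIM('a) * \<rho> ^ (DIM('a) - 1)) * indicator {0..a} \<rho> \<partial>lborel)"
      by (subst emeasure_density) (auto simp: a intro!: nn_integral_cong split: split_indicator)
    show ?thesis
    proof (cases "a \<ge> 0")
      case True
      have "(\<integral>\<^sup>+\<rho>. ennreal (sphere_area DIM('a) * \<rho> ^ (DIM('a) - 1)) * indicator {0..a} \<rho> \<partial>lborel) =
          ennreal (unit_ball_vol DIM('a) * a ^ DIM('a) - unit_ball_vol DIM('a) * 0 ^ DIM('a))"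
        using True
        by (intro nn_integral_FTC_Icc) (auto simp: sphere_area_def intro!: derivative_eq_intros)
      then show ?thesis unfolding M N using True by (simp add: emeasure_cball)
    next
      case False
      then show ?thesis unfolding M N by simp
    qed
  qed
  show "emeasure ?M {..real i} \<noteq> \<infinity>" for i
  proof -
    have "emeasure ?M {..real i} = emeasure lborel (cball (0::'a) (real i))"
      by (subst emeasure_distr) (auto simp: cball_def intro!: arg_cong2[where f = emeasure])
    then show ?thesis by (simp add: emeasure_cball)
  qed
  show "Int_stable (range atMost :: real set set)"
    by (auto simp: Int_stable_def)
  show "sets ?M = sigma_sets UNIV (range atMost)"
    by (simp add: borel_eq_atMost)
  show "sets (density lborel (\<lambda>\<rho>. ennreal (?w \<rho>))) = sigma_sets UNIV (range atMost)"
    by (simp add: borel_eq_atMost)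
  show "(\<Union>i. {..real i}) = UNIV"
    by (auto intro: real_arch_simple)
qed auto

lemma nn_integral_radial:
  assumes [measurable]: "g \<in> borel_measurable borel"
  shows "(\<integral>\<^sup>+\<xi>. g (norm (\<xi>::'a::euclidean_space)) \<partial>lborel) =
    (\<integral>\<^sup>+\<rho>. ennreal (indicator {0..} \<rho> * (sphere_area DIM('a) * \<rho> ^ (DIM('a) - 1))) * g \<rho> \<partial>lborel)"
proof -
  have "(\<integral>\<^sup>+\<xi>. g (norm (\<xi>::'a)) \<partial>lborel) = (\<integral>\<^sup>+\<rho>. g \<rho> \<partial>distr (lborel :: 'a measure) borel norm)"
    by (simp add: nn_integral_distr)
  then show ?thesis
    unfolding distr_norm_lborel by (simp add: nn_integral_density)
qed

lemma integral_radial: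
  fixes g :: "real \<Rightarrow> real"
  assumes [measurable]: "g \<in> borel_measurable borel"
  shows "(LINT \<xi>|lborel. g (norm (\<xi>::'a::euclidean_space))) =
      sphere_area DIM('a) * (LINT \<rho>:{0..}|lborel. \<rho> ^ (DIM('a) - 1) * g \<rho>)"
proof -
  let ?w = "\<lambda>\<rho>::real. indicator {0..} \<rho> * (sphere_area DIM('a) * \<rho> ^ (DIM('a) - 1))"
  have w: "AE \<rho> in lborel. ?w \<rho> \<ge> 0"
    by (auto simp: sphere_area_def split: split_indicator)
  have [measurable]: "?w \<in> borel_measurable borel" by measurable
  have "(LINT \<xi>|lborel. g (norm (\<xi>::'a))) = integral\<^sup>L (distr (lborel :: 'a measure) borel norm) g"
    by (subst integral_distr) auto
  also have "\<dots> = (LINT \<rho>|lborel. ?w \<rho> *\<^sub>R g \<rho>)"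
    unfolding distr_norm_lborel by (subst integral_density) (use w in auto)
  also have "\<dots> = (LINT \<rho>|lborel. sphere_area DIM('a) * (indicator {0..} \<rho> *\<^sub>R (\<rho> ^ (DIM('a) - 1) * g \<rho>)))"
    by (simp add: mult_ac)
  also have "\<dots> = sphere_area DIM('a) * (LINT \<rho>:{0..}|lborel. \<rho> ^ (DIM('a) - 1) * g \<rho>)"
    unfolding set_lebesgue_integral_def by (rule integral_mult_right_zero)
  finally show "(LINT \<xi>|lborel. g (norm (\<xi>::'a))) =
      sphere_area DIM('a) * (LINT \<rho>:{0..}|lborel. \<rho> ^ (DIM('a) - 1) * g \<rho>)" .
qed

section \<open>The scalar equation as a first-order system\<close>

text \<open>The target is an arbitrary normed space because the transform is complex while the
  energy method is real: the system passes through the bounded linear maps \<open>Re\<close> and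
  \<open>Im\<close>. The memory has become the local variable \<open>p\<close>, and \<open>r\<close>
  appears in the equation for \<open>s\<close> only.\<close>

definition memory_system ::
  "real \<Rightarrow> real \<Rightarrow> real \<Rightarrow> real \<Rightarrow> (real \<Rightarrow> 'b::real_normed_vector) \<Rightarrow> (real \<Rightarrow> 'b) \<Rightarrow> (real \<Rightarrow> 'b) \<Rightarrow> (real \<Rightarrow> 'b) \<Rightarrow> bool" where
  "memory_system \<tau> \<delta> m r v s q p \<longleftrightarrow>
     continuous_on {0..} v \<and> continuous_on {0..} s \<and> continuous_on {0..} q \<and> continuous_on {0..} p \<and>
     (\<forall>t>0. (v has_vector_derivative s t) (at t) \<and>
       (s has_vector_derivative - ((r * (1 - m * \<tau>)) *\<^sub>R v t + (r * (\<delta> + m * \<tau>\<^sup>2)) *\<^sub>R q t + (r * \<tau>) *\<^sub>R p t)) (at t) \<and>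
       (q has_vector_derivative (1 / \<tau>) *\<^sub>R (s t - q t)) (at t) \<and>
       (p has_vector_derivative m *\<^sub>R q t - (1 / \<tau>) *\<^sub>R p t) (at t))"

lemma memory_system_bounded_linear:
  assumes "memory_system \<tau> \<delta> m r v s q p" and L: "bounded_linear L"
  shows "memory_system \<tau> \<delta> m r (\<lambda>t. L (v t)) (\<lambda>t. L (s t)) (\<lambda>t. L (q t)) (\<lambda>t. L (p t))"
proof -
  note lin = linear_simps[OF L]
  have c: "continuous_on {0..} (\<lambda>t. L (f t))" if "continuous_on {0..} f" for f
    using bounded_linear.continuous_on[OF L that] .
  have d: "((\<lambda>t. L (f t)) has_vector_derivative L f') (at t)" if "(f has_vector_derivative f') (at t)" for f f' t
    using bounded_linear.has_vector_derivative[OF L that] .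
  show ?thesis
    unfolding memory_system_def
  proof (intro conjI allI impI)
    fix t :: real assume t: "t > 0"
    note D = assms(1)[unfolded memory_system_def, THEN conjunct2, THEN conjunct2, THEN conjunct2, THEN conjunct2,
        rule_format, OF t]
    show "((\<lambda>t. L (v t)) has_vector_derivative L (s t)) (at t)"
      using D by (auto intro: d)
    show "((\<lambda>t. L (s t)) has_vector_derivative - ((r * (1 - m * \<tau>)) *\<^sub>R L (v t) +
        (r * (\<delta> + m * \<tau>\<^sup>2)) *\<^sub>R L (q t) + (r * \<tau>) *\<^sub>R L (p t))) (at t)"
      using d[OF D[THEN conjunct2, THEN conjunct1]] by (simp only: lin)
    show "((\<lambda>t. L (q t)) has_vector_derivative (1 / \<tau>) *\<^sub>R (L (s t) - L (q t))) (at t)"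
      using d[OF D[THEN conjunct2, THEN conjunct2, THEN conjunct1]] by (simp only: lin)
    show "((\<lambda>t. L (p t)) has_vector_derivative m *\<^sub>R L (q t) - (1 / \<tau>) *\<^sub>R L (p t)) (at t)"
      using d[OF D[THEN conjunct2, THEN conjunct2, THEN conjunct2]] by (simp only: lin)
  qed (use assms(1) in \<open>auto simp: memory_system_def intro!: c\<close>)
qed

lemma has_vector_derivative_within_atLeast_at:
  "(f has_vector_derivative D) (at t within {0..}) \<Longrightarrow> t > 0 \<Longrightarrow> (f has_vector_derivative D) (at t)"
  for t :: real
  using at_within_interior[of t "{0..}"] by simp

text \<open>The exponential kernel factors, so the memory term is a decaying exponential times an
  antiderivative; this is what makes the nonlocal equation local.\<close>

lemma memory_convolution_derivative:
  fixes y :: "real \<Rightarrow> complex" and m \<tau> :: real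
  assumes y: "continuous_on {0..} y" and \<tau>: "\<tau> \<noteq> 0"
  defines "w \<equiv> \<lambda>t. integral {0..t} (\<lambda>\<eta>. (m * exp (- (t - \<eta>) / \<tau>)) *\<^sub>R y \<eta>)"
  shows "continuous_on {0..} w"
    and "t > 0 \<Longrightarrow> (w has_vector_derivative m *\<^sub>R y t - (1 / \<tau>) *\<^sub>R w t) (at t)"
    and "w 0 = 0"
proof -
  let ?f = "\<lambda>\<eta>. (m * exp (\<eta> / \<tau>)) *\<^sub>R y \<eta>"
  define g where "g t = integral {0..t} ?f" for t
  have w: "w t = exp (- t / \<tau>) *\<^sub>R g t" for t
  proof -
    have "integral {0..t} (\<lambda>\<eta>. (m * exp (- (t - \<eta>) / \<tau>)) *\<^sub>R y \<eta>) = integral {0..t} (\<lambda>\<eta>. exp (- t / \<tau>) *\<^sub>R ?f \<eta>)"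
    proof (rule integral_cong)
      fix \<eta>
      have "exp (- (t - \<eta>) / \<tau>) = exp (- t / \<tau>) * exp (\<eta> / \<tau>)"
        by (simp add: diff_divide_distrib flip: exp_add)
      then show "(m * exp (- (t - \<eta>) / \<tau>)) *\<^sub>R y \<eta> = exp (- t / \<tau>) *\<^sub>R ?f \<eta>" by simp
    qed
    then show ?thesis by (simp only: w_def g_def integral_cmul)
  qed
  have dg: "(g has_vector_derivative ?f t) (at t within {0..})" if "t \<ge> 0" for t
  proof -
    have "continuous_on {0..t + 1} ?f"
      using continuous_on_subset[OF y, of "{0..t + 1}"] by (intro continuous_intros) (auto simp: \<tau>)
    then have "(g has_vector_derivative ?f t) (at t within {0..t + 1})"
      unfolding g_def[abs_def] by (rule integral_has_vector_derivative) (use that in auto)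
    moreover have "at t within {0..t + 1} = at t within {0..}"
      by (rule at_within_nhd[of t "{..<t + 1}"]) auto
    ultimately show ?thesis by simp
  qed
  have dw: "(w has_vector_derivative m *\<^sub>R y t - (1 / \<tau>) *\<^sub>R w t) (at t within {0..})" if "t \<ge> 0" for t
  proof -
    have e: "((\<lambda>t. exp (- t / \<tau>)) has_vector_derivative - (1 / \<tau>) * exp (- t / \<tau>)) (at t within {0..})"
      unfolding has_real_derivative_iff_has_vector_derivative[symmetric]
      by (auto intro!: derivative_eq_intros simp: \<tau>)
    have "(w has_vector_derivative exp (- t / \<tau>) *\<^sub>R ?f t + (- (1 / \<tau>) * exp (- t / \<tau>)) *\<^sub>R g t) (at t within {0..})"
      unfolding w[abs_def]
      by (rule bounded_bilinear.has_vector_derivative[OF bounded_bilinear_scaleR e dg[OF that]])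
    moreover have "exp (- t / \<tau>) * exp (t / \<tau>) = 1"
      by (simp flip: exp_add)
    ultimately show ?thesis by (simp add: w algebra_simps)
  qed
  show "continuous_on {0..} w"
    unfolding continuous_on_eq_continuous_within
    using dw by (auto intro: has_vector_derivative_continuous)
  show "(w has_vector_derivative m *\<^sub>R y t - (1 / \<tau>) *\<^sub>R w t) (at t)" if "t > 0"
    using has_vector_derivative_within_atLeast_at[OF dw that] that by simp
  show "w 0 = 0" by (simp add: w g_def)
qed

lemma solves_ode_memory_system:
  assumes ode: "solves_ode \<tau> \<delta> m r a0 a1 a2 y" and \<tau>: "\<tau> > 0"
  obtains v s q p where "memory_system \<tau> \<delta> m r v s q p" "\<And>t. t \<ge> 0 \<Longrightarrow> y t = v t - \<tau> *\<^sub>R q t"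
    "v 0 = a0 + \<tau> *\<^sub>R a1" "s 0 = a1 + \<tau> *\<^sub>R a2" "q 0 = a1" "p 0 = m *\<^sub>R a0"
proof -
  obtain y1 y2 y3 where d0: "\<And>t. t \<ge> 0 \<Longrightarrow> (y has_vector_derivative y1 t) (at t within {0..})"
    and d1: "\<And>t. t \<ge> 0 \<Longrightarrow> (y1 has_vector_derivative y2 t) (at t within {0..})"
    and c2: "continuous_on {0..} y2" and d2: "\<And>t. t > 0 \<Longrightarrow> (y2 has_vector_derivative y3 t) (at t)"
    and init: "y 0 = a0" "y1 0 = a1" "y2 0 = a2"
    and eq: "\<And>t. t > 0 \<Longrightarrow> \<tau> *\<^sub>R y3 t + y2 t + r *\<^sub>R y t + ((\<delta> + \<tau>) * r) *\<^sub>R y1 t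
               - r *\<^sub>R integral {0..t} (\<lambda>\<eta>. (m * exp (- (t - \<eta>) / \<tau>)) *\<^sub>R y \<eta>) = 0"
    using ode unfolding solves_ode_def by blast
  have c0: "continuous_on {0..} y" and c1: "continuous_on {0..} y1"
    unfolding continuous_on_eq_continuous_within
    using d0 d1 by (auto intro: has_vector_derivative_continuous)
  define w where "w t = integral {0..t} (\<lambda>\<eta>. (m * exp (- (t - \<eta>) / \<tau>)) *\<^sub>R y \<eta>)" for t
  have \<tau>0: "\<tau> \<noteq> 0" using \<tau> by simp
  note w = memory_convolution_derivative[OF c0 \<tau>0, where m = m, folded w_def]
  note D0 = has_vector_derivative_within_atLeast_at[OF d0] and D1 = has_vector_derivative_within_atLeast_at[OF d1]
  let ?v = "\<lambda>t. y t + \<tau> *\<^sub>R y1 t" and ?s = "\<lambda>t. y1 t + \<tau> *\<^sub>R y2 t" and ?p = "\<lambda>t. m *\<^sub>R y t - (1 / \<tau>) *\<^sub>R w t"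
  have "memory_system \<tau> \<delta> m r ?v ?s y1 ?p"
    unfolding memory_system_def
  proof (intro conjI allI impI)
    fix t :: real assume t: "t > 0"
    have t': "t \<ge> 0" using t by simp
    note sc = bounded_linear.has_vector_derivative[OF bounded_linear_scaleR_right]
    note D0' = D0[OF t' t] and D1' = D1[OF t' t]
    show "(?v has_vector_derivative ?s t) (at t)"
      by (rule has_vector_derivative_add[OF D0' sc[OF D1']])
    have y3: "\<tau> *\<^sub>R y3 t = - (y2 t + r *\<^sub>R y t + ((\<delta> + \<tau>) * r) *\<^sub>R y1 t - r *\<^sub>R w t)"
      using eq[OF t, folded w_def] unfolding eq_neg_iff_add_eq_0 by (simp add: algebra_simps)
    have "y2 t + \<tau> *\<^sub>R y3 t =
        - ((r * (1 - m * \<tau>)) *\<^sub>R ?v t + (r * (\<delta> + m * \<tau>\<^sup>2)) *\<^sub>R y1 t + (r * \<tau>) *\<^sub>R ?p t)"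
      unfolding y3 using \<tau> by (simp add: algebra_simps power2_eq_square)
    moreover have "(?s has_vector_derivative y2 t + \<tau> *\<^sub>R y3 t) (at t)"
      by (rule has_vector_derivative_add[OF D1' sc[OF d2[OF t]]])
    ultimately show "(?s has_vector_derivative
        - ((r * (1 - m * \<tau>)) *\<^sub>R ?v t + (r * (\<delta> + m * \<tau>\<^sup>2)) *\<^sub>R y1 t + (r * \<tau>) *\<^sub>R ?p t)) (at t)"
      by simp
    show "(y1 has_vector_derivative (1 / \<tau>) *\<^sub>R (?s t - y1 t)) (at t)"
      using D1' \<tau> by simp
    have "(?p has_vector_derivative m *\<^sub>R y1 t - (1 / \<tau>) *\<^sub>R (m *\<^sub>R y t - (1 / \<tau>) *\<^sub>R w t)) (at t)"
      by (intro has_vector_derivative_diff sc D0' w(2) t)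
    then show "(?p has_vector_derivative m *\<^sub>R y1 t - (1 / \<tau>) *\<^sub>R ?p t) (at t)" .
  qed (intro continuous_intros c0 c1 c2 w(1))+
  then show thesis
    by (rule that) (use init w(3) in \<open>auto\<close>)
qed

section \<open>Gronwall inequalities\<close>

lemma nonincreasing_from_0:
  fixes f :: "real \<Rightarrow> real"
  assumes "continuous_on {0..} f" "\<And>t. t > 0 \<Longrightarrow> (f has_real_derivative f' t) (at t)"
    and "\<And>t. t > 0 \<Longrightarrow> f' t \<le> 0" and "t \<ge> 0"
  shows "f t \<le> f 0"
proof (rule DERIV_nonpos_imp_decreasing_open[OF \<open>t \<ge> 0\<close>])
  show "continuous_on {0..t} f"
    using assms(1) by (rule continuous_on_subset) auto
qed (use assms in blast)

lemma gronwall: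
  fixes F :: "real \<Rightarrow> real"
  assumes c: "continuous_on {0..} F" and d: "\<And>t. t > 0 \<Longrightarrow> (F has_real_derivative F' t) (at t)"
    and le: "\<And>t. t > 0 \<Longrightarrow> F' t \<le> k * F t" and t: "t \<ge> 0"
  shows "F t \<le> exp (k * t) * F 0"
proof -
  have "exp (- k * t) * F t \<le> exp (- k * 0) * F 0"
  proof (rule nonincreasing_from_0[OF _ _ _ t])
    show "continuous_on {0..} (\<lambda>t. exp (- k * t) * F t)"
      by (intro continuous_intros c)
    fix t :: real assume t: "t > 0"
    show "((\<lambda>t. exp (- k * t) * F t) has_real_derivative exp (- k * t) * (F' t - k * F t)) (at t)"
      by (auto intro!: derivative_eq_intros d[OF t] simp: algebra_simps)
    show "exp (- k * t) * (F' t - k * F t) \<le> 0"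
      using le[OF t] by (intro mult_nonneg_nonpos) auto
  qed
  then have "exp (k * t) * (exp (- k * t) * F t) \<le> exp (k * t) * F 0"
    by (intro mult_left_mono) auto
  then show ?thesis by (simp flip: exp_add mult.assoc)
qed

lemma gronwall_linear:
  fixes F :: "real \<Rightarrow> real"
  assumes c: "continuous_on {0..} F" and d: "\<And>t. t > 0 \<Longrightarrow> (F has_real_derivative F' t) (at t)"
    and le: "\<And>t. t > 0 \<Longrightarrow> F' t \<le> k * F t + A" and k: "k \<noteq> 0" and t: "t \<ge> 0"
  shows "F t \<le> exp (k * t) * (F 0 + A / k) - A / k"
proof -
  have "F t + A / k \<le> exp (k * t) * (F 0 + A / k)"
  proof (rule gronwall[OF _ _ _ t])
    show "continuous_on {0..} (\<lambda>t. F t + A / k)"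
      by (intro continuous_intros c)
    fix t :: real assume t: "t > 0"
    show "((\<lambda>t. F t + A / k) has_real_derivative F' t) (at t)"
      by (auto intro!: derivative_eq_intros d[OF t])
    show "F' t \<le> k * (F t + A / k)"
      using le[OF t] k by (simp add: distrib_left)
  qed
  then show ?thesis by simp
qed

text \<open>After multiplication by \<open>exp (g * t)\<close> the forcing is constant. The growth
  so introduced costs at most half of the damping \<open>k\<close>, so the product stays bounded and
  the rate of the forcing is inherited.\<close>

lemma gronwall_forced:
  fixes F :: "real \<Rightarrow> real"
  assumes c: "continuous_on {0..} F" and d: "\<And>t. t > 0 \<Longrightarrow> (F has_real_derivative F' t) (at t)"
    and le: "\<And>t. t > 0 \<Longrightarrow> F' t \<le> - k * F t + A * exp (- g * t)" and pos: "\<And>t. F t \<ge> 0"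
    and k: "k > 0" "g \<le> k / 2" "A \<ge> 0" and t: "t \<ge> 0"
  shows "F t \<le> exp (- g * t) * (F 0 + 2 * A / k)"
proof -
  have "exp (g * t) * F t \<le> exp (- (k / 2) * t) * (exp (g * 0) * F 0 + A / (- (k / 2))) - A / (- (k / 2))"
  proof (rule gronwall_linear[OF _ _ _ _ t])
    show "continuous_on {0..} (\<lambda>t. exp (g * t) * F t)"
      by (intro continuous_intros c)
    fix t :: real assume t: "t > 0"
    show "((\<lambda>t. exp (g * t) * F t) has_real_derivative exp (g * t) * (F' t + g * F t)) (at t)"
      by (auto intro!: derivative_eq_intros d[OF t] simp: field_simps)
    have "F' t + g * F t \<le> - (k / 2) * F t + A * exp (- g * t)"
      using le[OF t] mult_right_mono[OF k(2) pos[of t]] by simp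
    then have "exp (g * t) * (F' t + g * F t) \<le> exp (g * t) * (- (k / 2) * F t + A * exp (- g * t))"
      by (intro mult_left_mono) auto
    also have "\<dots> = - (k / 2) * (exp (g * t) * F t) + A"
      by (simp add: algebra_simps flip: exp_add)
    finally show "exp (g * t) * (F' t + g * F t) \<le> - (k / 2) * (exp (g * t) * F t) + A" .
  qed (use k in auto)
  also have "\<dots> = exp (- (k / 2) * t) * F 0 + (2 * A / k) * (1 - exp (- (k / 2) * t))"
    using k by (simp add: field_simps)
  also have "\<dots> \<le> 1 * F 0 + (2 * A / k) * 1"
    using k t pos[of 0] by (intro add_mono mult_right_mono mult_left_mono) auto
  finally have "exp (- g * t) * (exp (g * t) * F t) \<le> exp (- g * t) * (F 0 + 2 * A / k)"
    by (intro mult_left_mono) auto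
  then show ?thesis by (simp flip: exp_add mult.assoc)
qed

section \<open>Exponential decay\<close>

text \<open>Completing the square. It is the tool for absorbing mixed products: a product is
  dominated as soon as its coefficient satisfies the discriminant condition.\<close>

lemma discriminant_bound:
  fixes A B K x y :: real
  assumes "A \<ge> 0" "B \<ge> 0" "K\<^sup>2 \<le> 4 * A * B"
  shows "K * x * y \<le> A * x\<^sup>2 + B * y\<^sup>2"
proof (cases "A = 0")
  case True
  with assms have "K = 0" by simp
  then show ?thesis using assms by simp
next
  case False
  have "4 * A * (A * x\<^sup>2 + B * y\<^sup>2 - K * x * y) = (2 * A * x - K * y)\<^sup>2 + (4 * A * B - K\<^sup>2) * y\<^sup>2"
    by (simp add: power2_eq_square algebra_simps)
  also have "\<dots> \<ge> 0" using assms by simp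
  finally show ?thesis using False assms(1) by (simp add: zero_le_mult_iff)
qed

text \<open>Each pair encodes a constraint \<open>a * X <= Y\<close>, which holds for all small
  positive \<open>a\<close> because \<open>Y\<close> is positive. It provides one smallness
  parameter for a whole list of constraints.\<close>

lemma finitely_many_small:
  fixes xs :: "(real \<times> real) list"
  assumes "\<forall>(X, Y) \<in> set xs. Y > 0"
  shows "\<exists>a>0. a \<le> 1 \<and> (\<forall>(X, Y) \<in> set xs. a * X \<le> Y)"
  using assms
proof (induction xs)
  case Nil
  then show ?case by (auto intro: exI[of _ 1])
next
  case (Cons z xs)
  obtain X Y where z: "z = (X, Y)" by (cases z)
  from Cons obtain a where a: "a > 0" "a \<le> 1" "\<forall>(X, Y) \<in> set xs. a * X \<le> Y" "Y > 0"
    by (auto simp: z)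
  let ?a = "min a (Y / (\<bar>X\<bar> + 1))"
  have pos: "?a > 0" using a by (auto simp: add_nonneg_pos)
  have "?a * X \<le> Y"
  proof -
    have "?a * X \<le> ?a * (\<bar>X\<bar> + 1)" using pos by (intro mult_left_mono) auto
    also have "\<dots> \<le> Y / (\<bar>X\<bar> + 1) * (\<bar>X\<bar> + 1)" by (intro mult_right_mono) auto
    also have "\<dots> = Y" by simp
    finally show ?thesis .
  qed
  moreover have "?a * X' \<le> Y'" if "(X', Y') \<in> set xs" "Y' > 0" for X' Y'
  proof (cases "X' \<ge> 0")
    case True
    then have "?a * X' \<le> a * X'" by (intro mult_right_mono) auto
    then show ?thesis using a that by fastforce
  next
    case False
    then have "?a * X' \<le> 0" using pos by (intro mult_nonneg_nonpos) auto
    then show ?thesis using that by simp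
  qed
  ultimately show ?case
    using Cons.prems pos a by (intro exI[of _ ?a]) (auto simp: z)
qed

text \<open>The right-hand side is minus the derivative of the function \<open>L\<close> used in
  \<open>lyapunov_decay\<close>, where \<open>k\<close>, \<open>b * h\<close> and
  \<open>b' * h\<close> are the coefficients of the multipliers. The damping of \<open>q\<close> has
  strength \<open>\<theta> * r\<close>, that of \<open>s\<close> has strength \<open>h\<close>, that
  of \<open>v\<close> strength \<open>h * r\<close>. The constraints \<open>c1\<close> to
  \<open>c9\<close> serve the nine unwanted terms \<open>T1\<close> to \<open>T8\<close> (with
  \<open>T6'\<close>) in this order.\<close>

lemma lyapunov_dissipation:
  fixes \<tau> m r \<theta> h a b b' n \<alpha> \<beta> N k p q s v :: real
  assumes pos: "\<tau> > 0" "m > 0" "r \<ge> 0" "\<alpha> \<ge> 0" "\<beta> > 0" "b > 0" "b' > 0" "n > 0"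
    and h: "0 \<le> h" "h \<le> 1" "h \<le> \<theta>" "h \<le> \<theta> * r"
    and k: "k\<^sup>2 \<le> a\<^sup>2 * r * h" and N: "N \<ge> n * \<theta> * r"
    and c1: "4 * m * a\<^sup>2 \<le> b * \<tau>" and c2: "16 * m * a\<^sup>2 \<le> n * \<tau>\<^sup>2" and c3: "16 * b \<le> n * \<tau>"
    and c4: "8 * b * \<alpha> \<le> n" and c5: "4 * m * b\<^sup>2 * \<tau>\<^sup>2 \<le> n" and c6: "8 * b\<^sup>2 * \<beta> \<le> n * b'"
    and c7: "8 * b' * \<alpha>\<^sup>2 \<le> n * \<beta>" and c8: "2 * m * b' * \<tau>\<^sup>2 \<le> \<beta>" and c9: "4 * \<tau> * b' \<le> b"
  shows "n / 4 * \<theta> * r * q\<^sup>2 + 2 * r / m * p\<^sup>2 + b * h / (2 * \<tau>) * s\<^sup>2 + b' * \<beta> * h * r / 4 * v\<^sup>2 \<le>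
    N * q\<^sup>2 + 4 * r / m * p\<^sup>2 + k * (p * s / \<tau> - 2 * p * q / \<tau>)
    + b * h * (s\<^sup>2 / \<tau> - q * s / \<tau> - \<beta> * r * q * v - r * \<alpha> * q\<^sup>2 - r * \<tau> * q * p)
    - b' * h * (s\<^sup>2 - \<beta> * r * v\<^sup>2 - r * \<alpha> * q * v - r * \<tau> * p * v)"
proof -
  have th: "\<theta> \<ge> 0" using h by simp
  have hr: "h * r \<le> \<theta> * r" using h pos by (intro mult_right_mono) auto
  have hh: "h * h \<le> \<theta> * 1" using h by (intro mult_mono) auto
  have nn: "0 \<le> n / 8 * \<theta> * r" "0 \<le> r / (2 * m)" "0 \<le> b * h / (8 * \<tau>)" "0 \<le> b' * \<beta> * h * r / 4"
    using pos h th by auto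
  have T1: "(- k / \<tau>) * p * s \<le> r / (2 * m) * p\<^sup>2 + b * h / (8 * \<tau>) * s\<^sup>2"
  proof (rule discriminant_bound[OF nn(2,3)])
    have "(- k / \<tau>)\<^sup>2 \<le> a\<^sup>2 * r * h / \<tau>\<^sup>2"
      using k pos by (simp add: power_divide divide_right_mono)
    also have "\<dots> = (4 * m * a\<^sup>2) * (r * h / (4 * m * \<tau>\<^sup>2))"
      using pos by (simp add: field_simps)
    also have "\<dots> \<le> (b * \<tau>) * (r * h / (4 * m * \<tau>\<^sup>2))"
      using pos h by (intro mult_right_mono c1) auto
    also have "\<dots> = 4 * (r / (2 * m)) * (b * h / (8 * \<tau>))"
      using pos by (simp add: field_simps power2_eq_square)
    finally show "(- k / \<tau>)\<^sup>2 \<le> 4 * (r / (2 * m)) * (b * h / (8 * \<tau>))" .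
  qed
  have T2: "(2 * k / \<tau>) * q * p \<le> n / 8 * \<theta> * r * q\<^sup>2 + r / (2 * m) * p\<^sup>2"
  proof (rule discriminant_bound[OF nn(1,2)])
    have "(2 * k / \<tau>)\<^sup>2 \<le> 4 * (a\<^sup>2 * r * h) / \<tau>\<^sup>2"
      using k pos by (simp add: power_divide divide_right_mono power_mult_distrib)
    also have "\<dots> = (16 * m * a\<^sup>2) * (r * h / (4 * m * \<tau>\<^sup>2))"
      using pos by (simp add: field_simps)
    also have "\<dots> \<le> (n * \<tau>\<^sup>2) * (r * (\<theta> * r) / (4 * m * \<tau>\<^sup>2))"
      using pos h th by (intro mult_mono c2 divide_right_mono mult_left_mono) auto
    also have "\<dots> = 4 * (n / 8 * \<theta> * r) * (r / (2 * m))"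
      using pos by (simp add: field_simps power2_eq_square)
    finally show "(2 * k / \<tau>)\<^sup>2 \<le> 4 * (n / 8 * \<theta> * r) * (r / (2 * m))" .
  qed
  have T3: "(b * h / \<tau>) * q * s \<le> n / 8 * \<theta> * r * q\<^sup>2 + b * h / (8 * \<tau>) * s\<^sup>2"
  proof (rule discriminant_bound[OF nn(1,3)])
    have "(b * h / \<tau>)\<^sup>2 = (16 * b) * h * (b * h / (16 * \<tau>\<^sup>2))"
      using pos by (simp add: field_simps power2_eq_square)
    also have "\<dots> \<le> (n * \<tau>) * (\<theta> * r) * (b * h / (16 * \<tau>\<^sup>2))"
      using pos h th by (intro mult_right_mono mult_mono c3) auto
    also have "\<dots> = 4 * (n / 8 * \<theta> * r) * (b * h / (8 * \<tau>))"
      using pos by (simp add: field_simps power2_eq_square)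
    finally show "(b * h / \<tau>)\<^sup>2 \<le> 4 * (n / 8 * \<theta> * r) * (b * h / (8 * \<tau>))" .
  qed
  have T4: "(b * h * r * \<alpha>) * q\<^sup>2 \<le> n / 8 * \<theta> * r * q\<^sup>2"
  proof (rule mult_right_mono)
    have "b * h * r * \<alpha> = (8 * b * \<alpha>) * (h * r) / 8" by simp
    also have "\<dots> \<le> n * (\<theta> * r) / 8"
      using pos h th by (intro divide_right_mono mult_mono c4 hr) auto
    finally show "b * h * r * \<alpha> \<le> n / 8 * \<theta> * r" by simp
  qed simp
  have T5: "(b * h * r * \<tau>) * q * p \<le> n / 8 * \<theta> * r * q\<^sup>2 + r / (2 * m) * p\<^sup>2"
  proof (rule discriminant_bound[OF nn(1,2)])
    have "(b * h * r * \<tau>)\<^sup>2 = (4 * m * b\<^sup>2 * \<tau>\<^sup>2) * (h * h) * (r\<^sup>2 / (4 * m))"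
      using pos by (simp add: field_simps power2_eq_square)
    also have "\<dots> \<le> n * (\<theta> * 1) * (r\<^sup>2 / (4 * m))"
      using pos h th by (intro mult_right_mono mult_mono c5 hh) auto
    also have "\<dots> = 4 * (n / 8 * \<theta> * r) * (r / (2 * m))"
      using pos by (simp add: field_simps power2_eq_square)
    finally show "(b * h * r * \<tau>)\<^sup>2 \<le> 4 * (n / 8 * \<theta> * r) * (r / (2 * m))" .
  qed
  have T6: "(b * h * \<beta> * r) * q * v \<le> n / 8 * \<theta> * r * q\<^sup>2 + b' * \<beta> * h * r / 4 * v\<^sup>2"
  proof (rule discriminant_bound[OF nn(1,4)])
    have "(b * h * \<beta> * r)\<^sup>2 = (8 * b\<^sup>2 * \<beta>) * h * (\<beta> * h * r\<^sup>2 / 8)"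
      using pos by (simp add: field_simps power2_eq_square)
    also have "\<dots> \<le> (n * b') * \<theta> * (\<beta> * h * r\<^sup>2 / 8)"
      using pos h th by (intro mult_right_mono mult_mono c6 h) auto
    also have "\<dots> = 4 * (n / 8 * \<theta> * r) * (b' * \<beta> * h * r / 4)"
      using pos by (simp add: field_simps power2_eq_square)
    finally show "(b * h * \<beta> * r)\<^sup>2 \<le> 4 * (n / 8 * \<theta> * r) * (b' * \<beta> * h * r / 4)" .
  qed
  have T6': "(- (b' * h * r * \<alpha>)) * q * v \<le> n / 8 * \<theta> * r * q\<^sup>2 + b' * \<beta> * h * r / 4 * v\<^sup>2"
  proof (rule discriminant_bound[OF nn(1,4)])
    have "(- (b' * h * r * \<alpha>))\<^sup>2 = (8 * b' * \<alpha>\<^sup>2) * h * (b' * h * r\<^sup>2 / 8)"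
      using pos by (simp add: field_simps power2_eq_square)
    also have "\<dots> \<le> (n * \<beta>) * \<theta> * (b' * h * r\<^sup>2 / 8)"
      using pos h th by (intro mult_right_mono mult_mono c7 h) auto
    also have "\<dots> = 4 * (n / 8 * \<theta> * r) * (b' * \<beta> * h * r / 4)"
      using pos by (simp add: field_simps power2_eq_square)
    finally show "(- (b' * h * r * \<alpha>))\<^sup>2 \<le> 4 * (n / 8 * \<theta> * r) * (b' * \<beta> * h * r / 4)" .
  qed
  have T7: "(- (b' * h * r * \<tau>)) * p * v \<le> r / (2 * m) * p\<^sup>2 + b' * \<beta> * h * r / 4 * v\<^sup>2"
  proof (rule discriminant_bound[OF nn(2,4)])
    have "(- (b' * h * r * \<tau>))\<^sup>2 = (2 * m * b' * \<tau>\<^sup>2) * h * (b' * h * r\<^sup>2 / (2 * m))"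
      using pos by (simp add: field_simps power2_eq_square)
    also have "\<dots> \<le> \<beta> * 1 * (b' * h * r\<^sup>2 / (2 * m))"
      using pos h th by (intro mult_right_mono mult_mono c8 h) auto
    also have "\<dots> = 4 * (r / (2 * m)) * (b' * \<beta> * h * r / 4)"
      using pos by (simp add: field_simps power2_eq_square)
    finally show "(- (b' * h * r * \<tau>))\<^sup>2 \<le> 4 * (r / (2 * m)) * (b' * \<beta> * h * r / 4)" .
  qed
  have T8: "b' * h * s\<^sup>2 \<le> b * h / (4 * \<tau>) * s\<^sup>2"
  proof (rule mult_right_mono)
    have "b' * h \<le> b / (4 * \<tau>) * h"
      using c9 pos h by (intro mult_right_mono) (auto simp: field_simps)
    then show "b' * h \<le> b * h / (4 * \<tau>)" by simp
  qed simp
  have TN: "n * \<theta> * r * q\<^sup>2 \<le> N * q\<^sup>2"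
    by (intro mult_right_mono N) simp
  have id: "N * q\<^sup>2 + 4 * r / m * p\<^sup>2 + k * (p * s / \<tau> - 2 * p * q / \<tau>)
    + b * h * (s\<^sup>2 / \<tau> - q * s / \<tau> - \<beta> * r * q * v - r * \<alpha> * q\<^sup>2 - r * \<tau> * q * p)
    - b' * h * (s\<^sup>2 - \<beta> * r * v\<^sup>2 - r * \<alpha> * q * v - r * \<tau> * p * v) =
    N * q\<^sup>2 + 4 * (r / m * p\<^sup>2) - (- k / \<tau>) * p * s - (2 * k / \<tau>) * q * p + b * h / \<tau> * s\<^sup>2 - (b * h / \<tau>) * q * s
    - (b * h * \<beta> * r) * q * v - (b * h * r * \<alpha>) * q\<^sup>2 - (b * h * r * \<tau>) * q * p
    - b' * h * s\<^sup>2 + b' * \<beta> * h * r * v\<^sup>2 - (- (b' * h * r * \<alpha>)) * q * v - (- (b' * h * r * \<tau>)) * p * v"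
    by (simp add: algebra_simps)
  have e: "n / 4 * \<theta> * r * q\<^sup>2 = (n * \<theta> * r * q\<^sup>2) / 4" "n / 8 * \<theta> * r * q\<^sup>2 = (n * \<theta> * r * q\<^sup>2) / 8"
    "2 * r / m * p\<^sup>2 = 2 * (r / m * p\<^sup>2)" "r / (2 * m) * p\<^sup>2 = (r / m * p\<^sup>2) / 2"
    "b * h / (2 * \<tau>) * s\<^sup>2 = (b * h / \<tau> * s\<^sup>2) / 2" "b * h / (8 * \<tau>) * s\<^sup>2 = (b * h / \<tau> * s\<^sup>2) / 8"
    "b * h / (4 * \<tau>) * s\<^sup>2 = (b * h / \<tau> * s\<^sup>2) / 4"
    "b' * \<beta> * h * r / 4 * v\<^sup>2 = (b' * \<beta> * h * r * v\<^sup>2) / 4"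
    by simp_all
  \<comment> \<open>\<open>Q\<close>, \<open>P\<close>, \<open>S\<close>, \<open>V\<close> are the
    damping terms of \<open>q\<close>, \<open>p\<close>, \<open>s\<close>, \<open>v\<close>. Six
    unwanted terms spend an eighth of \<open>Q\<close> each, four spend half of \<open>P\<close> out
    of the available \<open>4 * P\<close>, three spend together half of \<open>S\<close>, and three
    spend a quarter of \<open>V\<close> each; the left-hand side is what remains.\<close>
  have gen: "Q / 4 + 2 * P + S / 2 + V / 4 \<le>
      NQ + 4 * P - t1 - t2 + S - t3 - t6 - t4 - t5 - t8 + V - t6' - t7"
    if "t1 \<le> P / 2 + S / 8" "t2 \<le> Q / 8 + P / 2" "t3 \<le> Q / 8 + S / 8" "t4 \<le> Q / 8" "t5 \<le> Q / 8 + P / 2"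
      "t6 \<le> Q / 8 + V / 4" "t6' \<le> Q / 8 + V / 4" "t7 \<le> P / 2 + V / 4" "t8 \<le> S / 4" "Q \<le> NQ"
    for P Q S V NQ t1 t2 t3 t4 t5 t6 t6' t7 t8 :: real
    using that by linarith
  show ?thesis
    unfolding id using T1 T2 T3 T4 T5 T6 T6' T7 T8 TN unfolding e by (rule gen)
qed

text \<open>The energy stripped of its constants. The weights \<open>r\<close> are those of the
  energy, so at low frequencies only \<open>s\<close> is controlled without loss.\<close>

definition state_size :: "real \<Rightarrow> real \<Rightarrow> real \<Rightarrow> real \<Rightarrow> real \<Rightarrow> real" where
  "state_size r v s q p = s\<^sup>2 + r * v\<^sup>2 + r * q\<^sup>2 + r * p\<^sup>2"

lemma memory_system_real_derivatives:
  fixes v s q p :: "real \<Rightarrow> real"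
  assumes "memory_system \<tau> \<delta> m r v s q p" "t > 0"
  shows "(v has_real_derivative s t) (at t)"
    "(s has_real_derivative - (r * (1 - m * \<tau>) * v t + r * (\<delta> + m * \<tau>\<^sup>2) * q t + r * \<tau> * p t)) (at t)"
    "(q has_real_derivative (s t - q t) / \<tau>) (at t)"
    "(p has_real_derivative m * q t - p t / \<tau>) (at t)"
  using assms by (auto simp: memory_system_def has_real_derivative_iff_has_vector_derivative mult_ac)

lemma memory_system_continuous:
  assumes "memory_system \<tau> \<delta> m r v s q p"
  shows "continuous_on {0..} v" "continuous_on {0..} s" "continuous_on {0..} q" "continuous_on {0..} p"
  using assms by (auto simp: memory_system_def)

text \<open>\<open>L\<close> is the energy with the multipliers added. Since
  \<open>a + b + b'\<close> is at most \<open>c1\<close>, it stays comparable to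
  \<open>state_size\<close>, and its dissipation dominates a multiple of
  \<open>h * state_size\<close>, so Gronwall applies. The parameters are left free because the two
  cases of \<delta> choose them differently.\<close>

lemma lyapunov_decay:
  fixes v s q p :: "real \<Rightarrow> real" and \<tau> \<delta> m :: real
  defines "\<alpha> \<equiv> \<delta> + m * \<tau>\<^sup>2" and "\<beta> \<equiv> 1 - m * \<tau>"
  defines "C1 \<equiv> 2 + \<alpha> * \<tau> + \<tau>\<^sup>2 + 2 * \<tau> / m"
  assumes sys: "memory_system \<tau> \<delta> m r v s q p"
    and pos: "\<tau> > 0" "m > 0" "r \<ge> 0" "\<delta> \<ge> 0" "m * \<tau> < 1" "a \<ge> 0" "b > 0" "b' > 0" "n > 0"
    and h: "0 \<le> h" "h \<le> 1" "h \<le> \<theta>" "h \<le> \<theta> * r" "h \<le> r"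
    and k: "k\<^sup>2 \<le> a\<^sup>2 * r * h" and N: "2 * r * \<delta> + k * m \<ge> n * \<theta> * r"
    and c: "4 * m * a\<^sup>2 \<le> b * \<tau>" "16 * m * a\<^sup>2 \<le> n * \<tau>\<^sup>2" "16 * b \<le> n * \<tau>"
      "8 * b * \<alpha> \<le> n" "4 * m * b\<^sup>2 * \<tau>\<^sup>2 \<le> n" "8 * b\<^sup>2 * \<beta> \<le> n * b'"
      "8 * b' * \<alpha>\<^sup>2 \<le> n * \<beta>" "2 * m * b' * \<tau>\<^sup>2 \<le> \<beta>" "4 * \<tau> * b' \<le> b"
    and c1: "c1 > 0" "c1 \<le> 1" "c1 \<le> \<beta>" "c1 \<le> \<tau> / (2 * m)" "c1 \<le> m * \<tau> ^ 3 / 4" "a + b + b' \<le> c1"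
    and d: "d \<ge> 0" "d \<le> n / 4" "d \<le> 2 / m" "d \<le> b / (2 * \<tau>)" "d \<le> b' * \<beta> / 4"
    and t: "t \<ge> 0"
  shows "state_size r (v t) (s t) (q t) (p t) \<le>
    2 * C1 / c1 * exp (- (d / C1 * h) * t) * state_size r (v 0) (s 0) (q 0) (p 0)"
proof -
  have al: "\<alpha> \<ge> m * \<tau>\<^sup>2" "\<alpha> \<ge> 0" and be: "\<beta> > 0" "\<beta> \<le> 1"
    using pos by (auto simp: \<alpha>_def \<beta>_def)
  have C1: "C1 \<ge> 2" using pos al by (auto simp: C1_def intro!: add_nonneg_nonneg)
  \<comment> \<open>Each coefficient cancels one mixed product in the derivative of the energy:
    \<open>\<alpha> * \<tau>\<close> the product \<open>q s\<close>,
    \<open>2 * \<tau>\<^sup>2\<close> the product \<open>p s\<close>, and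
    \<open>2 * \<tau> / m\<close> the product \<open>q p\<close>.\<close>
  define Q where "Q q p = \<alpha> * \<tau> * q\<^sup>2 + 2 * \<tau>\<^sup>2 * q * p + 2 * \<tau> / m * p\<^sup>2" for q p :: real
  define L where "L v s q p = s\<^sup>2 + r * \<beta> * v\<^sup>2 + r * Q q p - k * p * q - b * h * q * s + b' * h * s * v" for v s q p :: real
  have cross: "\<bar>k * x * y\<bar> \<le> a / 2 * (r * x\<^sup>2 + r * y\<^sup>2)"
    "\<bar>b * h * x * y\<bar> \<le> b / 2 * (r * x\<^sup>2 + y\<^sup>2)" "\<bar>b' * h * y * x\<bar> \<le> b' / 2 * (r * x\<^sup>2 + y\<^sup>2)" for x y :: real
  proof -
    have hr: "h\<^sup>2 \<le> r" using mult_mono[OF h(2) h(5)] h pos by (simp add: power2_eq_square)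
    have "r * h \<le> r * r" using h pos by (intro mult_left_mono) auto
    then have "a\<^sup>2 * (r * h) \<le> a\<^sup>2 * (r * r)" by (rule mult_left_mono) simp
    moreover have eq: "4 * (a / 2 * r) * (a / 2 * r) = a\<^sup>2 * (r * r)" by (simp add: power2_eq_square)
    ultimately have kk: "k\<^sup>2 \<le> 4 * (a / 2 * r) * (a / 2 * r)" using k by (metis mult.assoc order_trans)
    have gen: "\<bar>K * x * y\<bar> \<le> A * x\<^sup>2 + B * y\<^sup>2" if "A \<ge> 0" "B \<ge> 0" "K\<^sup>2 \<le> 4 * A * B" for A B K :: real
      using discriminant_bound[OF that, of x y] discriminant_bound[of A B "- K" x y] that by simp
    show "\<bar>k * x * y\<bar> \<le> a / 2 * (r * x\<^sup>2 + r * y\<^sup>2)"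
      using gen[OF _ _ kk] pos by (simp add: algebra_simps)
    have B: "(B * h)\<^sup>2 \<le> 4 * (B / 2 * r) * (B / 2)" for B :: real
      using mult_left_mono[OF hr, of "B\<^sup>2"] by (simp add: power2_eq_square mult_ac)
    show "\<bar>b * h * x * y\<bar> \<le> b / 2 * (r * x\<^sup>2 + y\<^sup>2)"
      using gen[OF _ _ B[of b]] pos by (simp add: algebra_simps)
    show "\<bar>b' * h * y * x\<bar> \<le> b' / 2 * (r * x\<^sup>2 + y\<^sup>2)"
      using gen[OF _ _ B[of b']] pos by (simp add: algebra_simps)
  qed
  \<comment> \<open>The mixed term uses three quarters of each square, with
    \<open>\<alpha> * \<tau>\<close> replaced by its lower bound \<open>m * \<tau> ^ 3\<close>. The
    quarters left over are the bounds \<open>m * \<tau> ^ 3 / 4\<close> and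
    \<open>\<tau> / (2 * m)\<close> imposed on \<open>c1\<close>.\<close>
  have Qlow: "c1 * q\<^sup>2 + c1 * p\<^sup>2 \<le> Q q p" for q p
  proof -
    have "(- 2 * \<tau>\<^sup>2) * q * p \<le> (3 / 4 * (m * \<tau> ^ 3)) * q\<^sup>2 + (3 / 2 * (\<tau> / m)) * p\<^sup>2"
      by (rule discriminant_bound) (use pos in \<open>auto simp: field_simps power2_eq_square power3_eq_cube\<close>)
    moreover have "m * \<tau> ^ 3 * q\<^sup>2 \<le> \<alpha> * \<tau> * q\<^sup>2"
      using mult_right_mono[OF al(1), of \<tau>] pos by (intro mult_right_mono) (auto simp: power2_eq_square power3_eq_cube)
    moreover have "c1 * q\<^sup>2 \<le> m * \<tau> ^ 3 / 4 * q\<^sup>2" "c1 * p\<^sup>2 \<le> \<tau> / (2 * m) * p\<^sup>2"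
      using mult_right_mono[OF c1(5), of "q\<^sup>2"] mult_right_mono[OF c1(4), of "p\<^sup>2"] by simp_all
    moreover have "\<tau> / (2 * m) * p\<^sup>2 = (\<tau> / m * p\<^sup>2) / 2" by simp
    ultimately show ?thesis by (simp add: Q_def)
  qed
  have Qup: "Q q p \<le> (C1 - 2) * (q\<^sup>2 + p\<^sup>2)" for q p
  proof -
    have "2 * \<tau>\<^sup>2 * q * p \<le> \<tau>\<^sup>2 * q\<^sup>2 + \<tau>\<^sup>2 * p\<^sup>2"
      by (rule discriminant_bound) (auto simp: power2_eq_square)
    moreover have "0 \<le> \<alpha> * \<tau> * p\<^sup>2" "0 \<le> 2 * \<tau> / m * q\<^sup>2"
      using pos al by auto
    ultimately show ?thesis by (simp add: Q_def C1_def algebra_simps)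
  qed
  have dist: "\<bar>L v s q p - (s\<^sup>2 + r * \<beta> * v\<^sup>2 + r * Q q p)\<bar> \<le> c1 / 2 * state_size r v s q p" for v s q p
  proof -
    have "\<bar>L v s q p - (s\<^sup>2 + r * \<beta> * v\<^sup>2 + r * Q q p)\<bar> \<le> \<bar>k * p * q\<bar> + \<bar>b * h * q * s\<bar> + \<bar>b' * h * s * v\<bar>"
      by (simp add: L_def)
    also have "\<dots> \<le> a / 2 * (r * p\<^sup>2 + r * q\<^sup>2) + b / 2 * (r * q\<^sup>2 + s\<^sup>2) + b' / 2 * (r * v\<^sup>2 + s\<^sup>2)"
      by (intro add_mono cross)
    also have "\<dots> \<le> a / 2 * state_size r v s q p + b / 2 * state_size r v s q p + b' / 2 * state_size r v s q p"
      using pos by (intro add_mono mult_left_mono) (auto simp: state_size_def)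
    also have "\<dots> = (a + b + b') / 2 * state_size r v s q p" by (simp add: algebra_simps)
    also have "\<dots> \<le> c1 / 2 * state_size r v s q p"
      using c1 pos by (intro mult_right_mono) (auto simp: state_size_def)
    finally show ?thesis .
  qed
  have Llow: "c1 / 2 * state_size r v s q p \<le> L v s q p" for v s q p
  proof -
    have "c1 * state_size r v s q p = c1 * s\<^sup>2 + r * c1 * v\<^sup>2 + r * (c1 * q\<^sup>2 + c1 * p\<^sup>2)"
      by (simp add: state_size_def algebra_simps)
    also have "\<dots> \<le> 1 * s\<^sup>2 + r * \<beta> * v\<^sup>2 + r * Q q p"
      using c1 pos by (intro add_mono mult_right_mono mult_left_mono Qlow) auto
    finally have "c1 * state_size r v s q p \<le> s\<^sup>2 + r * \<beta> * v\<^sup>2 + r * Q q p" by simp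
    then show ?thesis using abs_le_D2[OF dist[of v s q p]] by linarith
  qed
  have Lup: "L v s q p \<le> C1 * state_size r v s q p" for v s q p
  proof -
    have "1 * s\<^sup>2 + r * \<beta> * v\<^sup>2 + r * Q q p \<le> (C1 - 1) * s\<^sup>2 + r * (C1 - 1) * v\<^sup>2 + r * ((C1 - 1) * (q\<^sup>2 + p\<^sup>2))"
      using C1 be pos by (intro add_mono mult_right_mono mult_left_mono order_trans[OF Qup]) auto
    also have "\<dots> = (C1 - 1) * state_size r v s q p" by (simp add: state_size_def algebra_simps)
    finally have "s\<^sup>2 + r * \<beta> * v\<^sup>2 + r * Q q p \<le> (C1 - 1) * state_size r v s q p" by simp
    moreover have "c1 / 2 * state_size r v s q p \<le> 1 * state_size r v s q p"
      using c1 pos by (intro mult_right_mono) (auto simp: state_size_def)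
    ultimately have "s\<^sup>2 + r * \<beta> * v\<^sup>2 + r * Q q p + c1 / 2 * state_size r v s q p \<le> C1 * state_size r v s q p"
      by (simp add: algebra_simps)
    then show ?thesis using abs_le_D1[OF dist[of v s q p]] by linarith
  qed
  define D where "D v s q p = (2 * r * \<delta> + k * m) * q\<^sup>2 + 4 * r / m * p\<^sup>2 + k * (p * s / \<tau> - 2 * p * q / \<tau>)
    + b * h * (s\<^sup>2 / \<tau> - q * s / \<tau> - \<beta> * r * q * v - r * \<alpha> * q\<^sup>2 - r * \<tau> * q * p)
    - b' * h * (s\<^sup>2 - \<beta> * r * v\<^sup>2 - r * \<alpha> * q * v - r * \<tau> * p * v)" for v s q p :: real
  have Dlow: "d * h * state_size r v s q p \<le> D v s q p" for v s q p
  proof -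
    have "d * h * state_size r v s q p = d * h * r * q\<^sup>2 + d * h * r * p\<^sup>2 + d * h * s\<^sup>2 + d * h * r * v\<^sup>2"
      by (simp add: state_size_def algebra_simps)
    also have "\<dots> \<le> n / 4 * \<theta> * r * q\<^sup>2 + 2 / m * 1 * r * p\<^sup>2 + b / (2 * \<tau>) * h * s\<^sup>2 + b' * \<beta> / 4 * h * r * v\<^sup>2"
      using d h pos by (intro add_mono mult_right_mono mult_mono) auto
    also have "\<dots> = n / 4 * \<theta> * r * q\<^sup>2 + 2 * r / m * p\<^sup>2 + b * h / (2 * \<tau>) * s\<^sup>2 + b' * \<beta> * h * r / 4 * v\<^sup>2"
      by simp
    also have "\<dots> \<le> D v s q p"
      unfolding D_def
      by (rule lyapunov_dissipation[OF pos(1-3) al(2) be(1) pos(7-9) h(1-4) k N c])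
    finally show ?thesis .
  qed
  let ?L = "\<lambda>t. L (v t) (s t) (q t) (p t)"
  have "?L t \<le> exp (- (d / C1 * h) * t) * ?L 0"
  proof (rule gronwall[OF _ _ _ t])
    show "continuous_on {0..} ?L"
      unfolding L_def Q_def by (intro continuous_intros memory_system_continuous[OF sys])
    fix t :: real assume t: "t > 0"
    note der = memory_system_real_derivatives[OF sys t, folded \<alpha>_def \<beta>_def]
    have id: "2 * s * s' + r * \<beta> * (2 * v * s) + r * (\<alpha> * \<tau> * (2 * q * q') + 2 * \<tau>\<^sup>2 * (q' * p + q * p') + 2 * \<tau> / m * (2 * p * p'))
        - k * (p' * q + p * q') - b * h * (q' * s + q * s') + b' * h * (s' * v + s * s) = - D v s q p"
      if "s' = - (r * \<beta> * v + r * \<alpha> * q + r * \<tau> * p)" "q' = (s - q) / \<tau>" "p' = m * q - p / \<tau>" for v s q p s' q' p' :: real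
    proof -
      have "\<alpha> = \<delta> + m * \<tau>\<^sup>2" by (simp add: \<alpha>_def)
      then show ?thesis
        unfolding that D_def using pos by (simp add: field_simps power2_eq_square power3_eq_cube)
    qed
    show "(?L has_real_derivative - D (v t) (s t) (q t) (p t)) (at t)"
      unfolding id[OF refl refl refl, symmetric] unfolding L_def Q_def
      using pos by (auto intro!: derivative_eq_intros der simp: field_simps)
    have "d / C1 * h * L (v t) (s t) (q t) (p t) \<le> d / C1 * h * (C1 * state_size r (v t) (s t) (q t) (p t))"
      using d h C1 by (intro mult_left_mono Lup) auto
    also have "\<dots> = d * h * state_size r (v t) (s t) (q t) (p t)"
      using C1 by simp
    finally show "- D (v t) (s t) (q t) (p t) \<le> - (d / C1 * h) * L (v t) (s t) (q t) (p t)"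
      using Dlow[of "v t" "s t" "q t" "p t"] by simp
  qed
  also have "\<dots> \<le> exp (- (d / C1 * h) * t) * (C1 * state_size r (v 0) (s 0) (q 0) (p 0))"
    by (intro mult_left_mono Lup) auto
  finally have "c1 / 2 * state_size r (v t) (s t) (q t) (p t) \<le>
      exp (- (d / C1 * h) * t) * (C1 * state_size r (v 0) (s 0) (q 0) (p 0))"
    using Llow[of "v t" "s t" "q t" "p t"] by linarith
  then show ?thesis using c1 by (simp add: field_simps)
qed

definition decay_rate :: "real \<Rightarrow> real \<Rightarrow> real" where
  "decay_rate \<delta> r = (if \<delta> > 0 then r / (1 + r) else r / (1 + r)\<^sup>2)"

lemma decay_rate_bounds:
  assumes "r \<ge> 0"
  shows "0 \<le> decay_rate \<delta> r" "decay_rate \<delta> r \<le> 1" "decay_rate \<delta> r \<le> r"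
proof -
  have "(1 + r)\<^sup>2 \<ge> 1 + r" using assms by (simp add: power2_eq_square algebra_simps)
  then have le: "r / (1 + r)\<^sup>2 \<le> r / (1 + r)"
    using assms by (intro divide_left_mono) auto
  have up: "r / (1 + r) \<le> 1" "r / (1 + r) \<le> r"
    using assms by (auto simp: field_simps)
  have "0 \<le> r / (1 + r)" "0 \<le> r / (1 + r)\<^sup>2" using assms by simp_all
  then show "0 \<le> decay_rate \<delta> r" by (simp only: decay_rate_def split: if_splits) blast
  show "decay_rate \<delta> r \<le> 1" "decay_rate \<delta> r \<le> r"
    unfolding decay_rate_def using up order_trans[OF le up(1)] order_trans[OF le up(2)]
    by (simp_all only: split: if_splits) blast+
qed

lemma memory_system_decay:
  assumes pos: "\<tau> > 0" "m > 0" "\<delta> \<ge> 0" "m * \<tau> < 1"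
  obtains C c where "C > 0" "c > 0"
    "\<And>r (v :: real \<Rightarrow> real) s q p t. r \<ge> 0 \<Longrightarrow> memory_system \<tau> \<delta> m r v s q p \<Longrightarrow> t \<ge> 0 \<Longrightarrow>
      state_size r (v t) (s t) (q t) (p t) \<le>
      C * exp (- (c * decay_rate \<delta> r) * t) * state_size r (v 0) (s 0) (q 0) (p 0)"
proof -
  define \<alpha> \<beta> where "\<alpha> = \<delta> + m * \<tau>\<^sup>2" and "\<beta> = 1 - m * \<tau>"
  have al: "\<alpha> > 0" and be: "\<beta> > 0" using pos by (auto simp: \<alpha>_def \<beta>_def add_nonneg_pos)
  define c1 where "c1 = min 1 (min \<beta> (min (\<tau> / (2 * m)) (m * \<tau> ^ 3 / 4)))"
  have c1: "c1 > 0" "c1 \<le> 1" "c1 \<le> \<beta>" "c1 \<le> \<tau> / (2 * m)" "c1 \<le> m * \<tau> ^ 3 / 4"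
    using pos be by (auto simp: c1_def)
  define C1 where "C1 = 2 + \<alpha> * \<tau> + \<tau>\<^sup>2 + 2 * \<tau> / m"
  have C1: "C1 > 0" using pos al by (auto simp: C1_def intro!: add_pos_nonneg add_nonneg_nonneg)
  define dd where "dd n b b' = min (n / 4) (min (2 / m) (min (b / (2 * \<tau>)) (b' * \<beta> / 4)))" for n b b'
  have dd: "dd n b b' > 0" "dd n b b' \<le> n / 4" "dd n b b' \<le> 2 / m" "dd n b b' \<le> b / (2 * \<tau>)" "dd n b b' \<le> b' * \<beta> / 4"
    if "n > 0" "b > 0" "b' > 0" for n b b'
    using that pos be by (auto simp: dd_def)
  show thesis
  proof (cases "\<delta> > 0")
    case True
    \<comment> \<open>For positive \<delta> the energy damps \<open>q\<close> by itself, so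
      \<open>a\<close> and \<open>k\<close> are 0 and \<open>n\<close> is
      \<open>2 * \<delta>\<close>. The choice \<open>b' = b / (4 * \<tau>)\<close> turns the
      constraint \<open>4 * \<tau> * b' <= b\<close> into an equality; the list holds what the other
      constraints demand of \<open>b\<close>.\<close>
    let ?xs = "[(16, 2 * \<delta> * \<tau>), (8 * \<alpha>, 2 * \<delta>), (4 * m * \<tau>\<^sup>2, 2 * \<delta>), (8 * \<beta>, 2 * \<delta> / (4 * \<tau>)),
      (8 / (4 * \<tau>) * \<alpha>\<^sup>2, 2 * \<delta> * \<beta>), (2 * m / (4 * \<tau>) * \<tau>\<^sup>2, \<beta>), (1 + 1 / (4 * \<tau>), c1)]"
    have "\<forall>(X, Y) \<in> set ?xs. Y > 0" using True pos be c1 by auto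
    from finitely_many_small[OF this] obtain b where b: "b > 0" "b \<le> 1" "b * 16 \<le> 2 * \<delta> * \<tau>"
        "b * (8 * \<alpha>) \<le> 2 * \<delta>" "b * (4 * m * \<tau>\<^sup>2) \<le> 2 * \<delta>" "b * (8 * \<beta>) \<le> 2 * \<delta> / (4 * \<tau>)"
        "b * (8 / (4 * \<tau>) * \<alpha>\<^sup>2) \<le> 2 * \<delta> * \<beta>" "b * (2 * m / (4 * \<tau>) * \<tau>\<^sup>2) \<le> \<beta>" "b * (1 + 1 / (4 * \<tau>)) \<le> c1"
      by auto
    define b' where "b' = b / (4 * \<tau>)"
    have b': "b' > 0" using b pos by (simp add: b'_def)
    define n where "n = 2 * \<delta>"
    have n: "n > 0" using True by (simp add: n_def)
    note d = dd[OF n b(1) b']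
    show thesis
    proof (rule that[of "2 * C1 / c1" "dd n b b' / C1"])
      fix r t :: real and v s q p :: "real \<Rightarrow> real"
      assume r: "r \<ge> 0" and sys: "memory_system \<tau> \<delta> m r v s q p" and t: "t \<ge> 0"
      show "state_size r (v t) (s t) (q t) (p t) \<le>
        2 * C1 / c1 * exp (- (dd n b b' / C1 * decay_rate \<delta> r) * t) * state_size r (v 0) (s 0) (q 0) (p 0)"
        unfolding C1_def
      proof (rule lyapunov_decay[OF sys, where a = 0 and k = 0 and \<theta> = 1 and b = b and b' = b' and n = n, folded \<alpha>_def \<beta>_def])
        have "4 * m * b\<^sup>2 * \<tau>\<^sup>2 = b * (b * (4 * m * \<tau>\<^sup>2))" by (simp add: power2_eq_square)
        also have "\<dots> \<le> 1 * (2 * \<delta>)" by (rule mult_mono[OF b(2,5)]) (use b pos in auto)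
        finally show "4 * m * b\<^sup>2 * \<tau>\<^sup>2 \<le> n" by (simp add: n_def)
        show "8 * b\<^sup>2 * \<beta> \<le> n * b'"
          using mult_left_mono[OF b(6), of b] b(1) by (simp add: n_def b'_def power2_eq_square mult_ac)
        show "8 * b' * \<alpha>\<^sup>2 \<le> n * \<beta>" "2 * m * b' * \<tau>\<^sup>2 \<le> \<beta>"
          using b(7,8) by (simp_all add: n_def b'_def mult_ac)
        show "0 + b + b' \<le> c1" using b(9) by (simp add: b'_def algebra_simps)
        show "decay_rate \<delta> r \<le> 1" "decay_rate \<delta> r \<le> 1 * r" "decay_rate \<delta> r \<le> r" "0 \<le> decay_rate \<delta> r"
          using decay_rate_bounds[OF r] by auto
      qed (use pos r t n b b' c1 d decay_rate_bounds[OF r] in \<open>auto simp: n_def b'_def mult_ac\<close>)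
    qed (use C1 c1 d in auto)
  next
    case False
    then have \<delta>: "\<delta> = 0" using pos by simp
    \<comment> \<open>All parameters are powers of one small \<open>a\<close>: \<open>n\<close> has
      order \<open>a\<close>, \<open>b\<close> order \<open>a^2\<close>, \<open>b'\<close> order
      \<open>a^3\<close>. The factor in \<open>b\<close> turns
      \<open>4 * m * a\<^sup>2 <= b * \<tau>\<close> into an equality, and \<open>M\<close> does the
      same for \<open>8 * b\<^sup>2 * \<beta> <= n * b'\<close>. Every other constraint then has a
      power of \<open>a\<close> to spare.\<close>
    define M where "M = 128 * m * \<beta> / \<tau>\<^sup>2"
    have M: "M > 0" using pos be by (simp add: M_def)
    let ?xs = "[(16, \<tau>\<^sup>2), (64 / \<tau>, \<tau>), (32 * \<alpha> / \<tau>, 1), (64 * m\<^sup>2, 1), (8 * M * \<alpha>\<^sup>2, m * \<beta>),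
      (2 * m * M * \<tau>\<^sup>2, \<beta>), (4 * \<tau> * M, 4 * m / \<tau>), (1 + 4 * m / \<tau> + M, c1)]"
    have "\<forall>(X, Y) \<in> set ?xs. Y > 0" using pos be c1 by auto
    from finitely_many_small[OF this] obtain a where a: "a > 0" "a \<le> 1" "a * 16 \<le> \<tau>\<^sup>2" "a * (64 / \<tau>) \<le> \<tau>"
        "a * (32 * \<alpha> / \<tau>) \<le> 1" "a * (64 * m\<^sup>2) \<le> 1" "a * (8 * M * \<alpha>\<^sup>2) \<le> m * \<beta>"
        "a * (2 * m * M * \<tau>\<^sup>2) \<le> \<beta>" "a * (4 * \<tau> * M) \<le> 4 * m / \<tau>" "a * (1 + 4 * m / \<tau> + M) \<le> c1"
      by auto
    define b where "b = 4 * m / \<tau> * a\<^sup>2"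
    define b' where "b' = M * a ^ 3"
    define n where "n = a * m"
    have b: "b > 0" and b': "b' > 0" and n: "n > 0" using a pos M by (auto simp: b_def b'_def n_def)
    note d = dd[OF n b b']
    have a2: "a\<^sup>2 \<le> a" and a3: "a ^ 3 \<le> a\<^sup>2" "a ^ 3 \<le> a"
      using a power_decreasing[of 1 2 a] power_decreasing[of 2 3 a] power_decreasing[of 1 3 a] by auto
    show thesis
    proof (rule that[of "2 * C1 / c1" "dd n b b' / C1"])
      fix r t :: real and v s q p :: "real \<Rightarrow> real"
      assume r: "r \<ge> 0" and sys: "memory_system \<tau> \<delta> m r v s q p" and t: "t \<ge> 0"
      \<comment> \<open>With \<open>k = a * \<theta> * r\<close> the multiplier damps
        \<open>q\<close> by exactly \<open>n * \<theta> * r\<close>, and the rate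
        \<open>h = \<theta>^2 * r\<close> is the least one allowed by
        \<open>k^2 <= a^2 * r * h\<close>. For this \<theta> it is also below both \<theta> and
        \<open>\<theta> * r\<close>.\<close>
      let ?k = "a * r / (1 + r)" and ?\<theta> = "1 / (1 + r)"
      have dr: "decay_rate \<delta> r = r / (1 + r)\<^sup>2" by (simp add: decay_rate_def \<delta>)
      show "state_size r (v t) (s t) (q t) (p t) \<le>
        2 * C1 / c1 * exp (- (dd n b b' / C1 * decay_rate \<delta> r) * t) * state_size r (v 0) (s 0) (q 0) (p 0)"
        unfolding C1_def
      proof (rule lyapunov_decay[OF sys, where a = a and k = ?k and \<theta> = ?\<theta> and b = b and b' = b' and n = n, folded \<alpha>_def \<beta>_def])
        show "?k\<^sup>2 \<le> a\<^sup>2 * r * decay_rate \<delta> r"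
          unfolding dr using r by (simp add: power2_eq_square mult_ac)
        have "r / (1 + r)\<^sup>2 = ?\<theta> * (r / (1 + r))" by (simp add: power2_eq_square)
        also have "\<dots> \<le> ?\<theta> * 1" using r by (intro mult_left_mono) auto
        finally show "decay_rate \<delta> r \<le> ?\<theta>" unfolding dr by simp
        have "(1 + r)\<^sup>2 \<ge> 1 + r" using r by (simp add: power2_eq_square algebra_simps)
        then have "r / (1 + r)\<^sup>2 \<le> r / (1 + r)" using r by (intro divide_left_mono) auto
        then show "decay_rate \<delta> r \<le> ?\<theta> * r" unfolding dr by simp
        show "n * ?\<theta> * r \<le> 2 * r * \<delta> + ?k * m" by (simp add: n_def \<delta> mult_ac)
        show "decay_rate \<delta> r \<le> 1" "decay_rate \<delta> r \<le> r" "0 \<le> decay_rate \<delta> r"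
          using decay_rate_bounds[OF r] by auto
        show "4 * m * a\<^sup>2 \<le> b * \<tau>" using pos by (simp add: b_def)
        show "16 * m * a\<^sup>2 \<le> n * \<tau>\<^sup>2"
          using mult_left_mono[OF a(3), of "a * m"] a pos by (simp add: n_def power2_eq_square mult_ac)
        show "16 * b \<le> n * \<tau>"
          using mult_left_mono[OF a(4), of "a * m"] a pos by (simp add: n_def b_def power2_eq_square mult_ac)
        show "8 * b * \<alpha> \<le> n"
          using mult_left_mono[OF a(5), of "a * m"] a pos by (simp add: n_def b_def power2_eq_square mult_ac)
        have "4 * m * b\<^sup>2 * \<tau>\<^sup>2 = 64 * m ^ 3 * (a * a ^ 3)"
          using pos by (simp add: b_def power2_eq_square power3_eq_cube)
        also have "\<dots> \<le> 64 * m ^ 3 * (a * a)"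
          using a a3 pos by (intro mult_left_mono) auto
        also have "\<dots> = (a * m) * (a * (64 * m\<^sup>2))" by (simp add: power2_eq_square power3_eq_cube)
        also have "\<dots> \<le> (a * m) * 1" using a pos by (intro mult_left_mono) auto
        finally show "4 * m * b\<^sup>2 * \<tau>\<^sup>2 \<le> n" by (simp add: n_def)
        show "8 * b\<^sup>2 * \<beta> \<le> n * b'"
          using pos by (simp add: n_def b_def b'_def M_def power2_eq_square power3_eq_cube mult_ac)
        have "8 * b' * \<alpha>\<^sup>2 = (8 * M * \<alpha>\<^sup>2) * a ^ 3" by (simp add: b'_def)
        also have "\<dots> \<le> (8 * M * \<alpha>\<^sup>2) * a\<^sup>2" using M a3 by (intro mult_left_mono) auto
        also have "\<dots> = a * (a * (8 * M * \<alpha>\<^sup>2))" by (simp add: power2_eq_square)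
        also have "\<dots> \<le> a * (m * \<beta>)" using a by (intro mult_left_mono) auto
        finally show "8 * b' * \<alpha>\<^sup>2 \<le> n * \<beta>" by (simp add: n_def mult_ac)
        have "2 * m * b' * \<tau>\<^sup>2 = (2 * m * M * \<tau>\<^sup>2) * a ^ 3" by (simp add: b'_def)
        also have "\<dots> \<le> (2 * m * M * \<tau>\<^sup>2) * a" using M a3 pos by (intro mult_left_mono) auto
        finally show "2 * m * b' * \<tau>\<^sup>2 \<le> \<beta>" using a(8) by (simp add: mult_ac)
        show "4 * \<tau> * b' \<le> b"
          using mult_left_mono[OF a(9), of "a\<^sup>2"] by (simp add: b_def b'_def power2_eq_square power3_eq_cube mult_ac)
        have "a + b + b' \<le> a + 4 * m / \<tau> * a + M * a"
          unfolding b_def b'_def using a2 a3 M pos by (intro add_mono mult_left_mono) auto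
        also have "\<dots> = a * (1 + 4 * m / \<tau> + M)" by (simp add: algebra_simps)
        finally show "a + b + b' \<le> c1" using a(10) by simp
      qed (use pos r t n b b' c1 d a in auto)
    qed (use C1 c1 d in auto)
  qed
qed

section \<open>Estimates in terms of the initial data\<close>

definition real_solution ::
  "real \<Rightarrow> real \<Rightarrow> real \<Rightarrow> real \<Rightarrow> real \<Rightarrow> real \<Rightarrow> real \<Rightarrow> (real \<Rightarrow> real) \<Rightarrow> bool" where
  "real_solution \<tau> \<delta> m r a0 a1 a2 y \<longleftrightarrow>
     (\<exists>v s q p. memory_system \<tau> \<delta> m r v s q p \<and> (\<forall>t\<ge>0. y t = v t - \<tau> * q t) \<and>
        v 0 = a0 + \<tau> * a1 \<and> s 0 = a1 + \<tau> * a2 \<and> q 0 = a1 \<and> p 0 = m * a0)"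

lemma solves_ode_real_solution:
  assumes "solves_ode \<tau> \<delta> m r a0 a1 a2 y" "\<tau> > 0"
  shows "real_solution \<tau> \<delta> m r (Re a0) (Re a1) (Re a2) (\<lambda>t. Re (y t))"
    and "real_solution \<tau> \<delta> m r (Im a0) (Im a1) (Im a2) (\<lambda>t. Im (y t))"
proof -
  obtain v s q p where sys: "memory_system \<tau> \<delta> m r v s q p" and y: "\<And>t. t \<ge> 0 \<Longrightarrow> y t = v t - \<tau> *\<^sub>R q t"
    and i: "v 0 = a0 + \<tau> *\<^sub>R a1" "s 0 = a1 + \<tau> *\<^sub>R a2" "q 0 = a1" "p 0 = m *\<^sub>R a0"
    using solves_ode_memory_system[OF assms] by blast
  show "real_solution \<tau> \<delta> m r (Re a0) (Re a1) (Re a2) (\<lambda>t. Re (y t))"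
    unfolding real_solution_def
    by (intro exI conjI, rule memory_system_bounded_linear[OF sys bounded_linear_Re]) (auto simp: y i)
  show "real_solution \<tau> \<delta> m r (Im a0) (Im a1) (Im a2) (\<lambda>t. Im (y t))"
    unfolding real_solution_def
    by (intro exI conjI, rule memory_system_bounded_linear[OF sys bounded_linear_Im]) (auto simp: y i)
qed

lemma square_add_le: "(x + y)\<^sup>2 \<le> 2 * x\<^sup>2 + 2 * y\<^sup>2" for x y :: real
  using zero_le_power2[of "x - y"] by (simp add: power2_eq_square algebra_simps)

lemma initial_state_size:
  assumes "r \<ge> 0"
  shows "state_size r (a0 + \<tau> * a1) (a1 + \<tau> * a2) a1 (m * a0) \<le>
    (3 + 2 * \<tau>\<^sup>2 + m\<^sup>2) * (a1\<^sup>2 + a2\<^sup>2 + r * (a0\<^sup>2 + a1\<^sup>2))"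
proof -
  have "(a1 + \<tau> * a2)\<^sup>2 \<le> 2 * a1\<^sup>2 + 2 * \<tau>\<^sup>2 * a2\<^sup>2" "(a0 + \<tau> * a1)\<^sup>2 \<le> 2 * a0\<^sup>2 + 2 * \<tau>\<^sup>2 * a1\<^sup>2"
    using square_add_le[of a1 "\<tau> * a2"] square_add_le[of a0 "\<tau> * a1"] by (simp_all add: power_mult_distrib)
  then have "state_size r (a0 + \<tau> * a1) (a1 + \<tau> * a2) a1 (m * a0) \<le>
      (2 * a1\<^sup>2 + 2 * \<tau>\<^sup>2 * a2\<^sup>2) + r * (2 * a0\<^sup>2 + 2 * \<tau>\<^sup>2 * a1\<^sup>2) + r * a1\<^sup>2 + r * (m\<^sup>2 * a0\<^sup>2)"
    unfolding state_size_def power_mult_distrib using assms by (intro add_mono mult_left_mono) auto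
  also have "\<dots> \<le> \<dots> + ((1 + 2 * \<tau>\<^sup>2 + m\<^sup>2) * a1\<^sup>2 + (3 + m\<^sup>2) * a2\<^sup>2 + r * ((1 + 2 * \<tau>\<^sup>2) * a0\<^sup>2 + (2 + m\<^sup>2) * a1\<^sup>2))"
    using assms by simp
  also have "\<dots> = (3 + 2 * \<tau>\<^sup>2 + m\<^sup>2) * (a1\<^sup>2 + a2\<^sup>2 + r * (a0\<^sup>2 + a1\<^sup>2))"
    by (simp add: algebra_simps)
  finally show ?thesis .
qed

lemma solution_le_state_size:
  assumes "r \<ge> 0"
  shows "r * (v - \<tau> * q)\<^sup>2 \<le> (2 + 2 * \<tau>\<^sup>2) * state_size r v s q p"
proof -
  have "(v - \<tau> * q)\<^sup>2 \<le> 2 * v\<^sup>2 + 2 * \<tau>\<^sup>2 * q\<^sup>2"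
    using square_add_le[of v "- (\<tau> * q)"] by (simp add: power_mult_distrib)
  then have "r * (v - \<tau> * q)\<^sup>2 \<le> r * (2 * v\<^sup>2 + 2 * \<tau>\<^sup>2 * q\<^sup>2)"
    using assms by (rule mult_left_mono)
  also have "\<dots> \<le> \<dots> + (2 * s\<^sup>2 + 2 * r * q\<^sup>2 + 2 * r * p\<^sup>2 + 2 * \<tau>\<^sup>2 * (s\<^sup>2 + r * v\<^sup>2 + r * p\<^sup>2))"
    using assms by simp
  also have "\<dots> = (2 + 2 * \<tau>\<^sup>2) * state_size r v s q p"
    by (simp add: state_size_def algebra_simps)
  finally show ?thesis .
qed

text \<open>Only \<open>r * (y t)\<^sup>2\<close> is controlled; the division by \<open>r\<close> is
  the singularity at low frequencies that causes the growth in low dimensions.\<close>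

lemma real_solution_decay:
  assumes pos: "\<tau> > 0" "m > 0" "\<delta> \<ge> 0" "m * \<tau> < 1"
  obtains C c where "C > 0" "c > 0"
    "\<And>r a0 a1 a2 y t. r \<ge> 0 \<Longrightarrow> real_solution \<tau> \<delta> m r a0 a1 a2 y \<Longrightarrow> t \<ge> 0 \<Longrightarrow>
      r * (y t)\<^sup>2 \<le> C * exp (- (c * decay_rate \<delta> r) * t) * (a1\<^sup>2 + a2\<^sup>2 + r * (a0\<^sup>2 + a1\<^sup>2))"
proof -
  obtain C c where C: "C > 0" "c > 0" and dec: "\<And>r (v :: real \<Rightarrow> real) s q p t. r \<ge> 0 \<Longrightarrow>
      memory_system \<tau> \<delta> m r v s q p \<Longrightarrow> t \<ge> 0 \<Longrightarrow> state_size r (v t) (s t) (q t) (p t) \<le>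
      C * exp (- (c * decay_rate \<delta> r) * t) * state_size r (v 0) (s 0) (q 0) (p 0)"
    using memory_system_decay[OF pos] by metis
  let ?K = "3 + 2 * \<tau>\<^sup>2 + m\<^sup>2" and ?K' = "2 + 2 * \<tau>\<^sup>2"
  have K: "?K > 0" "?K' > 0" using zero_le_power2[of \<tau>] zero_le_power2[of m] by linarith+
  show thesis
  proof (rule that[of "?K' * C * ?K" c])
    fix r a0 a1 a2 y and t :: real
    assume r: "r \<ge> 0" and sol: "real_solution \<tau> \<delta> m r a0 a1 a2 y" and t: "t \<ge> 0"
    from sol obtain v s q p where sys: "memory_system \<tau> \<delta> m r v s q p" and y: "y t = v t - \<tau> * q t"
      and i: "v 0 = a0 + \<tau> * a1" "s 0 = a1 + \<tau> * a2" "q 0 = a1" "p 0 = m * a0"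
      using t unfolding real_solution_def by blast
    have "r * (y t)\<^sup>2 \<le> ?K' * state_size r (v t) (s t) (q t) (p t)"
      unfolding y by (rule solution_le_state_size[OF r])
    also have "\<dots> \<le> ?K' * (C * exp (- (c * decay_rate \<delta> r) * t) * state_size r (v 0) (s 0) (q 0) (p 0))"
      using K by (intro mult_left_mono dec r sys t) auto
    also have "\<dots> \<le> ?K' * (C * exp (- (c * decay_rate \<delta> r) * t) * (?K * (a1\<^sup>2 + a2\<^sup>2 + r * (a0\<^sup>2 + a1\<^sup>2))))"
      unfolding i using K C by (intro mult_left_mono initial_state_size r) auto
    finally show "r * (y t)\<^sup>2 \<le> ?K' * C * ?K * exp (- (c * decay_rate \<delta> r) * t) * (a1\<^sup>2 + a2\<^sup>2 + r * (a0\<^sup>2 + a1\<^sup>2))"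
      by (simp only: mult_ac)
  qed (use K C in auto)
qed

text \<open>The following bound gains the weights \<open>1 / r\<close> and \<open>1 / r\<^sup>2\<close> on \<open>a1\<close> and \<open>a2\<close>, which
  \<open>real_solution_decay\<close> does not. With \<open>Z = y'' + r y\<close> and \<open>W = r w + m y'\<close>, where \<open>w\<close> is the
  memory integral, the equation becomes \<open>\<tau> Z' + Z = W - m y'\<close>, \<open>\<tau> W' + W = m \<tau> Z + m y'\<close>, which is
  stable uniformly in \<open>r\<close> because of \<open>m \<tau> < 1\<close>.\<close>

lemma real_solution_high_frequency:
  assumes pos: "\<tau> > 0" "m > 0" "m * \<tau> < 1"
  obtains C c where "C > 0" "c > 0"
    "\<And>r a0 a1 a2 y t. r \<ge> 1 \<Longrightarrow> real_solution \<tau> 0 m r a0 a1 a2 y \<Longrightarrow> t \<ge> 0 \<Longrightarrow>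
      r\<^sup>2 * (y t)\<^sup>2 \<le> C * exp (- (c * decay_rate 0 r) * t) * (a2\<^sup>2 + r * a1\<^sup>2 + r\<^sup>2 * a0\<^sup>2)"
proof -
  obtain C0 c0 where C0: "C0 > 0" "c0 > 0" and dec: "\<And>r (v :: real \<Rightarrow> real) s q p t. r \<ge> 0 \<Longrightarrow>
      memory_system \<tau> 0 m r v s q p \<Longrightarrow> t \<ge> 0 \<Longrightarrow> state_size r (v t) (s t) (q t) (p t) \<le>
      C0 * exp (- (c0 * decay_rate 0 r) * t) * state_size r (v 0) (s 0) (q 0) (p 0)"
    using memory_system_decay[OF pos(1,2) order_refl pos(3)] by metis
  \<comment> \<open>Without forcing, \<tau> times the matrix of the system for \<open>Z\<close> and
    \<open>W\<close> has the eigenvalues -1 plus and minus \<open>sqrt (m * \<tau>)\<close>, so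
    \<mu> is its spectral gap. The bound of \<open>c\<close> by \<open>\<mu> / (2 * \<tau>)\<close>
    is the rate condition of \<open>gronwall_forced\<close>.\<close>
  define \<mu> where "\<mu> = 1 - sqrt (m * \<tau>)"
  have mt: "m * \<tau> > 0" "sqrt (m * \<tau>) < 1" "sqrt (m * \<tau>) > 0" using pos by auto
  then have \<mu>: "\<mu> > 0" "\<mu> < 1" by (auto simp: \<mu>_def)
  define c where "c = min c0 (\<mu> / (2 * \<tau>))"
  have c: "c > 0" "c \<le> c0" "c \<le> \<mu> / (2 * \<tau>)" using C0 \<mu> pos by (auto simp: c_def)
  define K1 where "K1 = (m ^ 3 * \<tau> + m\<^sup>2) / (\<tau> * \<mu>)"
  have K1: "K1 > 0" using pos \<mu> by (auto simp: K1_def intro!: divide_pos_pos add_pos_pos mult_pos_pos)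
  define K2 where "K2 = 3 + 2 * \<tau>\<^sup>2 + m\<^sup>2"
  have K2: "K2 > 0" using zero_le_power2[of \<tau>] zero_le_power2[of m] unfolding K2_def by linarith
  define K3 where "K3 = 2 * m * \<tau> + m\<^sup>2 + 2 * (K1 * C0 * K2) / (\<mu> / \<tau>)"
  have K3: "K3 > 0" using pos \<mu> K1 C0 K2 by (auto simp: K3_def intro!: add_pos_pos divide_pos_pos mult_pos_pos)
  show thesis
  proof (rule that[of "4 * (K3 / (m * \<tau>)) + 4 / \<tau>\<^sup>2 * (4 * C0 * K2)" c])
    fix r a0 a1 a2 y and t :: real
    assume r: "r \<ge> 1" and sol: "real_solution \<tau> 0 m r a0 a1 a2 y" and t: "t \<ge> 0"
    from sol obtain v s q p where sys: "memory_system \<tau> 0 m r v s q p" and y: "y t = v t - \<tau> * q t"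
      and i: "v 0 = a0 + \<tau> * a1" "s 0 = a1 + \<tau> * a2" "q 0 = a1" "p 0 = m * a0"
      using t unfolding real_solution_def by blast
    define g where "g = c * decay_rate 0 r"
    define A where "A = a2\<^sup>2 + r * a1\<^sup>2 + r\<^sup>2 * a0\<^sup>2"
    have A: "A \<ge> 0" using r by (auto simp: A_def)
    have rate: "0 \<le> decay_rate 0 r" "decay_rate 0 r \<le> 1" using decay_rate_bounds[of r] r by auto
    have g: "g \<le> c0 * decay_rate 0 r" "g \<le> \<mu> / (2 * \<tau>)" "g \<ge> 0"
      using c rate mult_mono[of c "\<mu> / (2 * \<tau>)" "decay_rate 0 r" 1] by (auto simp: g_def intro!: mult_right_mono)
    have rr: "r \<le> r\<^sup>2" using r by (simp add: power2_eq_square)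
    have "a1\<^sup>2 + a2\<^sup>2 + r * (a0\<^sup>2 + a1\<^sup>2) \<le> r * a1\<^sup>2 + a2\<^sup>2 + (r\<^sup>2 * a0\<^sup>2 + r * a1\<^sup>2)"
      using mult_right_mono[OF r, of "a1\<^sup>2"] mult_right_mono[OF rr, of "a0\<^sup>2"] by (simp add: algebra_simps)
    also have "\<dots> \<le> 2 * A" using r by (simp add: A_def)
    finally have i0: "state_size r (v 0) (s 0) (q 0) (p 0) \<le> K2 * (2 * A)"
      unfolding i K2_def using r
      by (intro order_trans[OF initial_state_size] mult_left_mono) (auto intro: add_nonneg_nonneg)
    have S: "state_size r (v t) (s t) (q t) (p t) \<le> 2 * C0 * K2 * A * exp (- g * t)" if "t \<ge> 0" for t
    proof -
      have "state_size r (v t) (s t) (q t) (p t) \<le> C0 * exp (- (c0 * decay_rate 0 r) * t) * state_size r (v 0) (s 0) (q 0) (p 0)"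
        using dec[OF _ sys that] r by simp
      also have "\<dots> \<le> C0 * exp (- g * t) * (K2 * (2 * A))"
        using C0 g that r by (intro mult_mono i0) (auto simp: state_size_def intro!: mult_right_mono)
      finally show ?thesis by (simp add: mult_ac)
    qed
    have q2: "(q t)\<^sup>2 \<le> 2 * C0 * K2 * A * exp (- g * t)" "(s t)\<^sup>2 \<le> 2 * C0 * K2 * A * exp (- g * t)" if "t \<ge> 0" for t
    proof -
      have "(q t)\<^sup>2 \<le> r * (q t)\<^sup>2" using mult_right_mono[OF r, of "(q t)\<^sup>2"] by simp
      then show "(q t)\<^sup>2 \<le> 2 * C0 * K2 * A * exp (- g * t)" "(s t)\<^sup>2 \<le> 2 * C0 * K2 * A * exp (- g * t)"
        using S[OF that] r unfolding state_size_def
        by (smt (verit) mult_nonneg_nonneg zero_le_power2)+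
    qed
    define Z where "Z t = (s t - q t) / \<tau> + r * (v t - \<tau> * q t)" for t
    define W where "W t = r * \<tau> * (m * (v t - \<tau> * q t) - p t) + m * q t" for t
    \<comment> \<open>The weight \<open>m * \<tau>\<close> is the ratio of the two coupling
      coefficients and makes the coupling symmetric, so the spectral gap becomes visible in the sum
      of squares.\<close>
    define F where "F t = m * \<tau> * (Z t)\<^sup>2 + (W t)\<^sup>2" for t
    have F: "F t \<le> exp (- g * t) * (F 0 + 2 * (2 * K1 * C0 * K2 * A) / (\<mu> / \<tau>))"
    proof (rule gronwall_forced[OF _ _ _ _ _ _ _ t])
      show "continuous_on {0..} F"
        unfolding F_def Z_def W_def using pos by (intro continuous_intros memory_system_continuous[OF sys]) auto
      fix t :: real assume t: "t > 0"
      note der = memory_system_real_derivatives[OF sys t]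
      let ?Z' = "(W t - m * q t - Z t) / \<tau>" and ?W' = "(m * \<tau> * Z t + m * q t - W t) / \<tau>"
      have dZ: "(Z has_real_derivative ?Z') (at t)"
        unfolding Z_def[abs_def] W_def using pos
        by (auto intro!: derivative_eq_intros der simp: field_simps power2_eq_square)
      have dW: "(W has_real_derivative ?W') (at t)"
        unfolding Z_def W_def[abs_def] using pos
        by (auto intro!: derivative_eq_intros der simp: field_simps power2_eq_square)
      show "(F has_real_derivative m * \<tau> * (2 * Z t * ?Z') + 2 * W t * ?W') (at t)"
        unfolding F_def[abs_def] by (auto intro!: derivative_eq_intros dZ dW)
      \<comment> \<open>The unforced part decays with \<open>2 * \<mu>\<close>; half of this pays
        for the two products with the forcing \<open>x\<close>.\<close>
      have *: "m * \<tau> * (2 * z * (w - m * x - z)) + 2 * w * (m * \<tau> * z + m * x - w) \<le>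
          - \<mu> * (m * \<tau> * z\<^sup>2 + w\<^sup>2) + \<tau> * K1 * x\<^sup>2" for z w x
      proof -
        have "(4 * m * \<tau>) * z * w \<le> (2 * sqrt (m * \<tau>) * (m * \<tau>)) * z\<^sup>2 + (2 * sqrt (m * \<tau>)) * w\<^sup>2"
        proof (rule discriminant_bound)
          have "4 * (2 * sqrt (m * \<tau>) * (m * \<tau>)) * (2 * sqrt (m * \<tau>)) = 16 * (m * \<tau>) * (sqrt (m * \<tau>))\<^sup>2"
            by (simp add: power2_eq_square)
          also have "\<dots> = (4 * m * \<tau>)\<^sup>2" using mt by (simp add: power2_eq_square)
          finally show "(4 * m * \<tau>)\<^sup>2 \<le> 4 * (2 * sqrt (m * \<tau>) * (m * \<tau>)) * (2 * sqrt (m * \<tau>))" by simp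
        qed (use mt in auto)
        moreover have "(- 2 * m\<^sup>2 * \<tau>) * z * x \<le> (\<mu> * (m * \<tau>)) * z\<^sup>2 + (m ^ 3 * \<tau> / \<mu>) * x\<^sup>2"
          using pos \<mu> by (intro discriminant_bound) (auto simp: power2_eq_square power3_eq_cube)
        moreover have "(2 * m) * w * x \<le> \<mu> * w\<^sup>2 + (m\<^sup>2 / \<mu>) * x\<^sup>2"
          using pos \<mu> by (intro discriminant_bound) (auto simp: power2_eq_square)
        moreover have "\<tau> * K1 * x\<^sup>2 = (m ^ 3 * \<tau> / \<mu>) * x\<^sup>2 + (m\<^sup>2 / \<mu>) * x\<^sup>2"
          using pos \<mu> by (simp add: K1_def field_simps)
        ultimately show ?thesis
          by (simp add: \<mu>_def power2_eq_square algebra_simps)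
      qed
      have "m * \<tau> * (2 * Z t * ?Z') + 2 * W t * ?W' =
          (m * \<tau> * (2 * Z t * (W t - m * q t - Z t)) + 2 * W t * (m * \<tau> * Z t + m * q t - W t)) / \<tau>"
        using pos by (simp add: field_simps)
      also have "\<dots> \<le> (- \<mu> * F t + \<tau> * K1 * (q t)\<^sup>2) / \<tau>"
        unfolding F_def using pos by (intro divide_right_mono *) auto
      also have "\<dots> = - (\<mu> / \<tau>) * F t + K1 * (q t)\<^sup>2"
        using pos by (simp add: field_simps)
      also have "K1 * (q t)\<^sup>2 \<le> K1 * (2 * C0 * K2 * A * exp (- g * t))"
        using K1 t by (intro mult_left_mono q2) auto
      finally show "m * \<tau> * (2 * Z t * ?Z') + 2 * W t * ?W' \<le> - (\<mu> / \<tau>) * F t + 2 * K1 * C0 * K2 * A * exp (- g * t)"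
        by (simp add: mult_ac)
    next
      show "F t \<ge> 0" for t using mt by (auto simp: F_def)
    qed (use \<mu> pos g K1 C0 K2 A in auto)
    have Z0: "Z 0 = a2 + r * a0" and W0: "W 0 = m * a1"
      using pos by (auto simp: Z_def W_def i)
    have "F 0 \<le> m * \<tau> * (2 * A) + m\<^sup>2 * A"
      unfolding F_def
    proof (intro add_mono mult_left_mono)
      have "0 \<le> r * a1\<^sup>2" using r by simp
      then show "(Z 0)\<^sup>2 \<le> 2 * A"
        using square_add_le[of a2 "r * a0"] by (simp add: Z0 A_def power_mult_distrib)
      have "a1\<^sup>2 \<le> A" using mult_right_mono[OF r, of "a1\<^sup>2"] by (simp add: A_def add_increasing add_increasing2)
      then show "(W 0)\<^sup>2 \<le> m\<^sup>2 * A" by (simp add: W0 power_mult_distrib mult_left_mono)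
    qed (use mt in auto)
    moreover have "0 \<le> m * \<tau> * (2 * A) + m\<^sup>2 * A" using A pos by simp
    ultimately have "F 0 \<le> 2 * (m * \<tau> * (2 * A) + m\<^sup>2 * A)" by (metis add_increasing mult_2)
    then have "F 0 + 2 * (2 * K1 * C0 * K2 * A) / (\<mu> / \<tau>) \<le> 2 * K3 * A"
      using A pos K1 C0 K2 \<mu> by (simp add: K3_def algebra_simps)
    then have "F t \<le> exp (- g * t) * (2 * K3 * A)"
      by (intro order_trans[OF F] mult_left_mono) auto
    moreover have "m * \<tau> * (Z t)\<^sup>2 \<le> F t" by (simp add: F_def)
    ultimately have "m * \<tau> * (Z t)\<^sup>2 \<le> exp (- g * t) * (2 * K3 * A)" by linarith
    then have Zt: "(Z t)\<^sup>2 \<le> 2 * (K3 / (m * \<tau>)) * A * exp (- g * t)"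
      using mt by (simp add: field_simps)
    \<comment> \<open>The subtracted quotient is the second derivative of \<open>y\<close>. The
      energy already bounds it, for \<open>q\<close> because \<open>r\<close> is at least 1, so the
      bound on \<open>Z\<close> carries over to \<open>r * y\<close>. This is a full factor
      \<open>r\<close> where the energy alone gives \<open>sqrt r\<close>.\<close>
    have "r * y t = Z t + (- ((s t - q t) / \<tau>))" by (simp add: Z_def y)
    then have "r\<^sup>2 * (y t)\<^sup>2 = (Z t + (- ((s t - q t) / \<tau>)))\<^sup>2"
      by (metis power_mult_distrib)
    also have "\<dots> \<le> 2 * (Z t)\<^sup>2 + 2 * ((s t - q t) / \<tau>)\<^sup>2"
      using square_add_le[of "Z t" "- ((s t - q t) / \<tau>)"] by simp
    finally have ry: "r\<^sup>2 * (y t)\<^sup>2 \<le> 2 * (Z t)\<^sup>2 + 2 * ((s t - q t) / \<tau>)\<^sup>2" .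
    have "(s t - q t)\<^sup>2 \<le> 2 * (s t)\<^sup>2 + 2 * (q t)\<^sup>2"
      using square_add_le[of "s t" "- q t"] by simp
    then have "((s t - q t) / \<tau>)\<^sup>2 \<le> (2 * (s t)\<^sup>2 + 2 * (q t)\<^sup>2) / \<tau>\<^sup>2"
      unfolding power_divide by (rule divide_right_mono) simp
    also have "\<dots> \<le> (2 * (2 * C0 * K2 * A * exp (- g * t)) + 2 * (2 * C0 * K2 * A * exp (- g * t))) / \<tau>\<^sup>2"
      by (intro divide_right_mono add_mono mult_left_mono q2[OF t]) auto
    finally have "r\<^sup>2 * (y t)\<^sup>2 \<le> 2 * (2 * (K3 / (m * \<tau>)) * A * exp (- g * t)) +
        2 * ((2 * (2 * C0 * K2 * A * exp (- g * t)) + 2 * (2 * C0 * K2 * A * exp (- g * t))) / \<tau>\<^sup>2)"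
      using Zt ry by linarith
    also have "\<dots> = (4 * (K3 / (m * \<tau>)) + 4 / \<tau>\<^sup>2 * (4 * C0 * K2)) * exp (- (c * decay_rate 0 r) * t) * A"
      by (simp add: g_def algebra_simps)
    finally show "r\<^sup>2 * (y t)\<^sup>2 \<le> (4 * (K3 / (m * \<tau>)) + 4 / \<tau>\<^sup>2 * (4 * C0 * K2)) *
        exp (- (c * decay_rate 0 r) * t) * (a2\<^sup>2 + r * a1\<^sup>2 + r\<^sup>2 * a0\<^sup>2)"
      by (simp only: A_def)
  qed (use K3 mt C0 K2 c pos in \<open>auto intro!: add_pos_nonneg\<close>)
qed

section \<open>Low frequencies\<close>

text \<open>Variation of constants with the integrating factor \<open>exp (t / \<tau>)\<close>. Any
  \<open>\<Phi>\<close> whose derivative dominates the weighted forcing takes the place of the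
  integral.\<close>

lemma relaxation_bound:
  fixes x g \<Phi> :: "real \<Rightarrow> real"
  assumes x: "continuous_on {0..} x" "\<And>t. t > 0 \<Longrightarrow> (x has_real_derivative (g t - x t) / \<tau>) (at t)"
    and \<Phi>: "continuous_on {0..} \<Phi>" "\<And>t. t > 0 \<Longrightarrow> (\<Phi> has_real_derivative \<Phi>' t) (at t)"
    and le: "\<And>t. t > 0 \<Longrightarrow> exp (t / \<tau>) * \<bar>g t\<bar> / \<tau> \<le> \<Phi>' t" and \<tau>: "\<tau> > 0" and t: "t \<ge> 0"
  shows "\<bar>x t\<bar> \<le> exp (- t / \<tau>) * (\<bar>x 0\<bar> + (\<Phi> t - \<Phi> 0))"
proof -
  have "\<bar>exp (t / \<tau>) * x t - exp (0 / \<tau>) * x 0\<bar> \<le> \<Phi> t - \<Phi> 0"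
  proof (cases "t = 0")
    case False
    have "norm (exp (t / \<tau>) * x t - exp (0 / \<tau>) * x 0) \<le> \<Phi> t - \<Phi> 0"
    proof (rule differentiable_bound_general)
      show "0 < t" using False t by simp
      show "continuous_on {0..t} (\<lambda>t. exp (t / \<tau>) * x t)" "continuous_on {0..t} \<Phi>"
        using continuous_on_subset[OF x(1), of "{0..t}"] continuous_on_subset[OF \<Phi>(1), of "{0..t}"] \<tau>
        by (auto intro!: continuous_intros)
      fix u assume u: "0 < u" "u < t"
      show "((\<lambda>t. exp (t / \<tau>) * x t) has_vector_derivative exp (u / \<tau>) * g u / \<tau>) (at u)"
        unfolding has_real_derivative_iff_has_vector_derivative[symmetric]
        using \<tau> by (auto intro!: derivative_eq_intros x(2)[OF u(1)] simp: field_simps)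
      show "(\<Phi> has_vector_derivative \<Phi>' u) (at u)"
        unfolding has_real_derivative_iff_has_vector_derivative[symmetric] by (rule \<Phi>(2)[OF u(1)])
      show "norm (exp (u / \<tau>) * g u / \<tau>) \<le> \<Phi>' u"
        using le[OF u(1)] \<tau> by (simp add: abs_mult)
    qed
    then show ?thesis by simp
  qed simp
  then have "exp (- t / \<tau>) * (exp (t / \<tau>) * \<bar>x t\<bar>) \<le> exp (- t / \<tau>) * (\<bar>x 0\<bar> + (\<Phi> t - \<Phi> 0))"
    by (intro mult_left_mono) (auto simp: abs_le_iff abs_mult abs_if split: if_splits)
  then show ?thesis by (simp flip: exp_add mult.assoc)
qed

lemma relaxation_bound_const:
  fixes x g :: "real \<Rightarrow> real"
  assumes x: "continuous_on {0..} x" "\<And>t. t > 0 \<Longrightarrow> (x has_real_derivative (g t - x t) / \<tau>) (at t)"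
    and g: "\<And>t. t > 0 \<Longrightarrow> \<bar>g t\<bar> \<le> M" and \<tau>: "\<tau> > 0" and t: "t \<ge> 0"
  shows "\<bar>x t\<bar> \<le> exp (- t / \<tau>) * \<bar>x 0\<bar> + M"
proof -
  have M: "M \<ge> 0" using g[of 1] by linarith
  have "\<bar>x t\<bar> \<le> exp (- t / \<tau>) * (\<bar>x 0\<bar> + (M * exp (t / \<tau>) - M * exp (0 / \<tau>)))"
  proof (rule relaxation_bound[OF x _ _ _ \<tau> t])
    fix t :: real assume "t > 0"
    show "((\<lambda>t. M * exp (t / \<tau>)) has_real_derivative M * exp (t / \<tau>) / \<tau>) (at t)"
      using \<tau> by (auto intro!: derivative_eq_intros)
    show "exp (t / \<tau>) * \<bar>g t\<bar> / \<tau> \<le> M * exp (t / \<tau>) / \<tau>"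
      using g[OF \<open>t > 0\<close>] \<tau> by (auto intro!: divide_right_mono simp: mult.commute)
  qed (use \<tau> in \<open>auto intro!: continuous_intros\<close>)
  also have "\<dots> = exp (- t / \<tau>) * \<bar>x 0\<bar> + M * (exp (- t / \<tau>) * exp (t / \<tau>)) - M * exp (- t / \<tau>)"
    by (simp add: algebra_simps)
  also have "\<dots> \<le> exp (- t / \<tau>) * \<bar>x 0\<bar> + M"
    using M by (simp flip: exp_add)
  finally show ?thesis .
qed

text \<open>In the initial energy all components except \<open>s\<close> carry the weight
  \<open>r\<close>. Hence the data other than \<open>a1 + \<tau> * a2\<close> enter with the factor
  \<open>sqrt r\<close>, and it is this separation that later leaves the mean alone in the lower
  bound.\<close>

lemma memory_system_velocity_bound:
  assumes pos: "\<tau> > 0" "m > 0" "\<delta> \<ge> 0" "m * \<tau> < 1"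
  obtains K where "K > 0"
    "\<And>r v s q p a0 a1 a2 t. 0 \<le> r \<Longrightarrow> memory_system \<tau> \<delta> m r v s q p \<Longrightarrow> t \<ge> 0 \<Longrightarrow>
      v 0 = a0 + \<tau> * a1 \<Longrightarrow> s 0 = a1 + \<tau> * a2 \<Longrightarrow> q 0 = a1 \<Longrightarrow> p 0 = m * a0 \<Longrightarrow>
      \<bar>s t\<bar> \<le> K * (\<bar>a1 + \<tau> * a2\<bar> + sqrt r * (\<bar>a0\<bar> + \<bar>a1\<bar> + \<bar>a2\<bar>))"
proof -
  obtain C c where C: "C > 0" "c > 0" and dec: "\<And>r (v :: real \<Rightarrow> real) s q p t. r \<ge> 0 \<Longrightarrow>
      memory_system \<tau> \<delta> m r v s q p \<Longrightarrow> t \<ge> 0 \<Longrightarrow> state_size r (v t) (s t) (q t) (p t) \<le>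
      C * exp (- (c * decay_rate \<delta> r) * t) * state_size r (v 0) (s 0) (q 0) (p 0)"
    using memory_system_decay[OF pos] by metis
  define K where "K = sqrt C * (2 + \<tau> + m)"
  have K: "K > 0" using C pos by (auto simp: K_def)
  show thesis
  proof (rule that[OF K])
    fix r v s q p a0 a1 a2 and t :: real
    assume r: "0 \<le> r" and sys: "memory_system \<tau> \<delta> m r v s q p" and t: "t \<ge> 0"
      and i: "v 0 = a0 + \<tau> * a1" "s 0 = a1 + \<tau> * a2" "q 0 = a1" "p 0 = m * a0"
    let ?A = "\<bar>a0\<bar> + \<bar>a1\<bar> + \<bar>a2\<bar>" and ?s0 = "a1 + \<tau> * a2"
    have ex: "exp (- (c * decay_rate \<delta> r) * t) \<le> 1"
      using C decay_rate_bounds[OF r, of \<delta>] t by simp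
    have "state_size r (v 0) (s 0) (q 0) (p 0) = \<bar>?s0\<bar>\<^sup>2 + r * (\<bar>a0 + \<tau> * a1\<bar>\<^sup>2 + \<bar>a1\<bar>\<^sup>2 + \<bar>m * a0\<bar>\<^sup>2)"
      by (simp add: state_size_def i algebra_simps)
    also have "\<dots> \<le> \<bar>?s0\<bar>\<^sup>2 + r * (((1 + \<tau>) * ?A)\<^sup>2 + ?A\<^sup>2 + (m * ?A)\<^sup>2)"
    proof (intro add_mono mult_left_mono power_mono order_refl r)
      have "\<bar>a0 + \<tau> * a1\<bar> \<le> \<bar>a0\<bar> + \<tau> * \<bar>a1\<bar>"
        using abs_triangle_ineq[of a0 "\<tau> * a1"] pos by (simp add: abs_mult)
      also have "\<dots> \<le> \<dots> + (\<bar>a1\<bar> + \<bar>a2\<bar> + \<tau> * (\<bar>a0\<bar> + \<bar>a2\<bar>))" using pos by simp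
      finally show "\<bar>a0 + \<tau> * a1\<bar> \<le> (1 + \<tau>) * ?A" by (simp add: algebra_simps)
      show "\<bar>m * a0\<bar> \<le> m * ?A" using pos by (simp add: abs_mult)
    qed auto
    also have "\<dots> = \<bar>?s0\<bar>\<^sup>2 + ((1 + \<tau>)\<^sup>2 + 1 + m\<^sup>2) * (sqrt r * ?A)\<^sup>2"
    proof -
      have "S + r * (((1 + \<tau>) * A)\<^sup>2 + A\<^sup>2 + (m * A)\<^sup>2) = S + ((1 + \<tau>)\<^sup>2 + 1 + m\<^sup>2) * (sqrt r * A)\<^sup>2" for A S
        using r by (simp only: power_mult_distrib real_sqrt_pow2) (simp add: algebra_simps)
      then show ?thesis .
    qed
    also have "\<dots> \<le> (2 + \<tau> + m)\<^sup>2 * \<bar>?s0\<bar>\<^sup>2 + (2 + \<tau> + m)\<^sup>2 * (sqrt r * ?A)\<^sup>2"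
    proof (intro add_mono mult_right_mono)
      have "1 \<le> (2 + \<tau> + m)\<^sup>2" using pos by (simp add: one_le_power)
      from mult_right_mono[OF this, of "\<bar>?s0\<bar>\<^sup>2"] show "\<bar>?s0\<bar>\<^sup>2 \<le> (2 + \<tau> + m)\<^sup>2 * \<bar>?s0\<bar>\<^sup>2" by simp
      show "(1 + \<tau>)\<^sup>2 + 1 + m\<^sup>2 \<le> (2 + \<tau> + m)\<^sup>2"
        using pos by (simp add: power2_eq_square algebra_simps)
    qed auto
    also have "\<dots> \<le> ((2 + \<tau> + m) * (\<bar>?s0\<bar> + sqrt r * ?A))\<^sup>2"
    proof -
      have sq: "k\<^sup>2 * x\<^sup>2 + k\<^sup>2 * z\<^sup>2 \<le> (k * (x + z))\<^sup>2" if "0 \<le> x" "0 \<le> z" for k x z :: real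
      proof -
        have "0 \<le> k\<^sup>2 * (2 * x * z)" using that by simp
        then show ?thesis by (simp add: power2_eq_square algebra_simps)
      qed
      show ?thesis by (rule sq) (use r in auto)
    qed
    finally have S0: "state_size r (v 0) (s 0) (q 0) (p 0) \<le> ((2 + \<tau> + m) * (\<bar>?s0\<bar> + sqrt r * ?A))\<^sup>2" .
    have "(s t)\<^sup>2 \<le> state_size r (v t) (s t) (q t) (p t)"
      using r by (simp add: state_size_def)
    also have "\<dots> \<le> C * exp (- (c * decay_rate \<delta> r) * t) * state_size r (v 0) (s 0) (q 0) (p 0)"
      by (rule dec[OF r sys t])
    also have "\<dots> \<le> C * 1 * ((2 + \<tau> + m) * (\<bar>?s0\<bar> + sqrt r * ?A))\<^sup>2"
      using C ex r by (intro mult_mono S0) (auto simp: state_size_def)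
    also have "\<dots> = (K * (\<bar>?s0\<bar> + sqrt r * ?A))\<^sup>2"
      using C by (simp add: K_def power_mult_distrib)
    finally have "\<bar>s t\<bar> \<le> \<bar>K * (\<bar>?s0\<bar> + sqrt r * ?A)\<bar>"
      by (simp add: abs_le_square_iff)
    then show "\<bar>s t\<bar> \<le> K * (\<bar>?s0\<bar> + sqrt r * ?A)"
      using K r by simp
  qed
qed

text \<open>There is no division by \<open>r\<close>: \<open>v\<close> grows at most linearly since
  its derivative \<open>s\<close> is bounded, and \<open>q\<close> relaxes towards the bounded
  \<open>s\<close>.\<close>

lemma real_solution_growth:
  assumes pos: "\<tau> > 0" "m > 0" "\<delta> \<ge> 0" "m * \<tau> < 1"
  obtains K where "K > 0"
    "\<And>r a0 a1 a2 y t. 0 \<le> r \<Longrightarrow> r \<le> 1 \<Longrightarrow> real_solution \<tau> \<delta> m r a0 a1 a2 y \<Longrightarrow> t \<ge> 1 \<Longrightarrow>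
      \<bar>y t\<bar> \<le> K * t * (\<bar>a0\<bar> + \<bar>a1\<bar> + \<bar>a2\<bar>)"
proof -
  obtain K where K: "K > 0" and vel: "\<And>r v s q p a0 a1 a2 t. 0 \<le> r \<Longrightarrow> memory_system \<tau> \<delta> m r v s q p \<Longrightarrow> t \<ge> 0 \<Longrightarrow>
      v 0 = a0 + \<tau> * a1 \<Longrightarrow> s 0 = a1 + \<tau> * a2 \<Longrightarrow> q 0 = a1 \<Longrightarrow> p 0 = m * a0 \<Longrightarrow>
      \<bar>s t\<bar> \<le> K * (\<bar>a1 + \<tau> * a2\<bar> + sqrt r * (\<bar>a0\<bar> + \<bar>a1\<bar> + \<bar>a2\<bar>))"
    using memory_system_velocity_bound[OF pos] by metis
  define M where "M = K * (2 + \<tau>)"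
  have M: "M > 0" using K pos by (simp add: M_def)
  show thesis
  proof (rule that[of "2 + 2 * \<tau> + \<tau> * M + M"])
    fix r a0 a1 a2 y and t :: real
    assume r: "0 \<le> r" "r \<le> 1" and sol: "real_solution \<tau> \<delta> m r a0 a1 a2 y" and t: "t \<ge> 1"
    from sol obtain v s q p where sys: "memory_system \<tau> \<delta> m r v s q p" and y: "y t = v t - \<tau> * q t"
      and i: "v 0 = a0 + \<tau> * a1" "s 0 = a1 + \<tau> * a2" "q 0 = a1" "p 0 = m * a0"
      using t unfolding real_solution_def by fastforce
    let ?A = "\<bar>a0\<bar> + \<bar>a1\<bar> + \<bar>a2\<bar>"
    have sb: "\<bar>s t\<bar> \<le> M * ?A" if "t \<ge> 0" for t
    proof -
      have "\<bar>a1 + \<tau> * a2\<bar> \<le> \<bar>a1\<bar> + \<tau> * \<bar>a2\<bar>"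
        using abs_triangle_ineq[of a1 "\<tau> * a2"] pos by (simp add: abs_mult)
      also have "\<dots> \<le> \<dots> + (\<bar>a0\<bar> + \<bar>a2\<bar> + \<tau> * (\<bar>a0\<bar> + \<bar>a1\<bar>))" using pos by simp
      finally have 1: "\<bar>a1 + \<tau> * a2\<bar> \<le> (1 + \<tau>) * ?A" by (simp add: algebra_simps)
      have 2: "sqrt r * ?A \<le> 1 * ?A" using r by (intro mult_right_mono) auto
      have "\<bar>s t\<bar> \<le> K * (\<bar>a1 + \<tau> * a2\<bar> + sqrt r * ?A)"
        by (rule vel[OF r(1) sys that i])
      also have "\<dots> \<le> K * ((1 + \<tau>) * ?A + 1 * ?A)"
        using K by (intro mult_left_mono add_mono 1 2) auto
      finally show ?thesis by (simp add: M_def algebra_simps)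
    qed
    have "norm (v t - v 0) \<le> M * ?A * t - M * ?A * 0"
    proof (rule differentiable_bound_general[of 0 t v "\<lambda>t. M * ?A * t" s "\<lambda>_. M * ?A"])
      show "continuous_on {0..t} v"
        by (rule continuous_on_subset[OF memory_system_continuous(1)[OF sys]]) auto
      fix u assume u: "0 < u" "u < t"
      show "(v has_vector_derivative s u) (at u)"
        using sys u by (simp add: memory_system_def)
      show "((\<lambda>t. M * ?A * t) has_vector_derivative M * ?A) (at u)"
        unfolding has_real_derivative_iff_has_vector_derivative[symmetric]
        by (auto intro!: derivative_eq_intros)
      show "norm (s u) \<le> M * ?A" using sb u by simp
    qed (use t in \<open>auto intro!: continuous_intros\<close>)
    then have vt: "\<bar>v t\<bar> \<le> \<bar>v 0\<bar> + M * ?A * t" by simp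
    have "\<bar>q t\<bar> \<le> exp (- t / \<tau>) * \<bar>q 0\<bar> + M * ?A"
    proof (rule relaxation_bound_const[OF memory_system_continuous(3)[OF sys], where g = s])
      show "(q has_real_derivative (s t - q t) / \<tau>) (at t)" if "t > 0" for t
        using memory_system_real_derivatives[OF sys that] by simp
    qed (use sb t pos in auto)
    also have "exp (- t / \<tau>) * \<bar>q 0\<bar> \<le> 1 * ?A"
      unfolding i using pos t by (intro mult_mono) auto
    finally have qt: "\<bar>q t\<bar> \<le> ?A + M * ?A" by simp
    have v0: "\<bar>v 0\<bar> \<le> \<bar>a0\<bar> + \<tau> * \<bar>a1\<bar>"
      using abs_triangle_ineq[of a0 "\<tau> * a1"] pos by (simp add: abs_mult i)
    have "\<bar>y t\<bar> \<le> \<bar>v t\<bar> + \<tau> * \<bar>q t\<bar>"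
      unfolding y using abs_triangle_ineq4[of "v t" "\<tau> * q t"] pos by (simp add: abs_mult)
    also have "\<dots> \<le> (\<bar>a0\<bar> + \<tau> * \<bar>a1\<bar> + M * ?A * t) + \<tau> * (?A + M * ?A)"
      using vt v0 qt pos by (intro add_mono mult_left_mono) auto
    also have "\<bar>a0\<bar> + \<tau> * \<bar>a1\<bar> \<le> (1 + \<tau>) * ?A"
      using pos by (simp add: algebra_simps)
    finally have "\<bar>y t\<bar> \<le> (1 + 2 * \<tau> + \<tau> * M) * ?A * 1 + M * ?A * t"
      by (simp add: algebra_simps)
    also have "\<dots> \<le> (1 + 2 * \<tau> + \<tau> * M) * ?A * t + M * ?A * t + ?A * t"
      using t pos M by (intro add_mono mult_left_mono add_increasing2) auto
    finally show "\<bar>y t\<bar> \<le> (2 + 2 * \<tau> + \<tau> * M + M) * t * ?A"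
      by (simp add: algebra_simps)
  qed (use M pos in \<open>auto intro!: add_pos_pos\<close>)
qed

text \<open>Duhamel's formula for the oscillator with \<open>q\<close> and \<open>p\<close> as
  forcing. After division by \<open>sqrt r\<close> the error consists of a part with the factor
  \<open>sqrt r * t\<close> that involves \<open>a1 + \<tau> * a2\<close> only, and a part with all
  the data that stays bounded while \<open>r * t <= 1\<close>.\<close>

lemma real_solution_low_frequency_profile:
  assumes pos: "\<tau> > 0" "m > 0" "\<delta> \<ge> 0" "m * \<tau> < 1"
  obtains K where "K > 0"
    "\<And>r a0 a1 a2 y t. 0 \<le> r \<Longrightarrow> r \<le> 1 \<Longrightarrow> real_solution \<tau> \<delta> m r a0 a1 a2 y \<Longrightarrow> t \<ge> 0 \<Longrightarrow>
      \<bar>sqrt (r * (1 - m * \<tau>)) * y t - sin (sqrt (r * (1 - m * \<tau>)) * t) * (a1 + \<tau> * a2)\<bar> \<le>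
      K * (r * t * \<bar>a1 + \<tau> * a2\<bar> + sqrt r * (1 + r * t) * (\<bar>a0\<bar> + \<bar>a1\<bar> + \<bar>a2\<bar>))"
proof -
  obtain K0 where K0: "K0 > 0" and vel: "\<And>r v s q p a0 a1 a2 t. 0 \<le> r \<Longrightarrow> memory_system \<tau> \<delta> m r v s q p \<Longrightarrow> t \<ge> 0 \<Longrightarrow>
      v 0 = a0 + \<tau> * a1 \<Longrightarrow> s 0 = a1 + \<tau> * a2 \<Longrightarrow> q 0 = a1 \<Longrightarrow> p 0 = m * a0 \<Longrightarrow>
      \<bar>s t\<bar> \<le> K0 * (\<bar>a1 + \<tau> * a2\<bar> + sqrt r * (\<bar>a0\<bar> + \<bar>a1\<bar> + \<bar>a2\<bar>))"
    using memory_system_velocity_bound[OF pos] by metis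
  define \<alpha> where "\<alpha> = \<delta> + m * \<tau>\<^sup>2"
  have al: "\<alpha> \<ge> 0" using pos by (simp add: \<alpha>_def)
  define K1 where "K1 = \<alpha> + m * \<tau>\<^sup>2"
  define K2 where "K2 = \<alpha> + \<tau> * m + 2 * \<tau>\<^sup>2 * m"
  have K12: "K1 \<ge> 0" "K2 \<ge> 0" using pos al by (auto simp: K1_def K2_def)
  let ?K = "(1 + \<tau>) + \<tau> * (1 + K0 * (2 + \<tau>)) + 2 * \<tau> * K2 + K1 * K0"
  show thesis
  proof (rule that[of ?K])
    show "?K > 0" using pos K0 K12 by (intro add_pos_nonneg) auto
    fix r a0 a1 a2 y and t :: real
    assume r: "0 \<le> r" "r \<le> 1" and sol: "real_solution \<tau> \<delta> m r a0 a1 a2 y" and t: "t \<ge> 0"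
    from sol obtain v s q p where sys: "memory_system \<tau> \<delta> m r v s q p" and y: "y t = v t - \<tau> * q t"
      and i: "v 0 = a0 + \<tau> * a1" "s 0 = a1 + \<tau> * a2" "q 0 = a1" "p 0 = m * a0"
      using t unfolding real_solution_def by blast
    define A where "A = \<bar>a0\<bar> + \<bar>a1\<bar> + \<bar>a2\<bar>"
    define s0 where "s0 = a1 + \<tau> * a2"
    define \<omega> where "\<omega> = sqrt (r * (1 - m * \<tau>))"
    define M where "M = K0 * (\<bar>s0\<bar> + sqrt r * A)"
    have A: "A \<ge> 0" "\<bar>a0\<bar> \<le> A" "\<bar>a1\<bar> \<le> A" by (auto simp: A_def)
    have M: "M \<ge> 0" using K0 A r by (auto simp: M_def)
    have sb: "\<bar>s u\<bar> \<le> M" if "u \<ge> 0" for u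
      using vel[OF r(1) sys that i] by (simp add: M_def s0_def A_def)
    have qb: "\<bar>q u\<bar> \<le> exp (- u / \<tau>) * \<bar>a1\<bar> + M" if "u \<ge> 0" for u
      unfolding i(3)[symmetric]
      by (rule relaxation_bound_const[OF memory_system_continuous(3)[OF sys] memory_system_real_derivatives(3)[OF sys]])
        (use sb that pos in auto)
    \<comment> \<open>\<open>p\<close> is driven by \<open>q\<close> and relaxes at the same rate as
      \<open>q\<close>, so the transient of \<open>q\<close> is resonant and produces the factor
      \<open>u\<close>; this is the linear summand of the majorant.\<close>
    have pb: "\<bar>p u\<bar> \<le> exp (- u / \<tau>) * (m * \<bar>a0\<bar> + m * \<bar>a1\<bar> * u) + m * \<tau> * M" if u: "u \<ge> 0" for u
    proof -
      have "\<bar>p u\<bar> \<le> exp (- u / \<tau>) * (\<bar>p 0\<bar> + ((m * \<bar>a1\<bar> * u + m * \<tau> * M * exp (u / \<tau>)) - (m * \<bar>a1\<bar> * 0 + m * \<tau> * M * exp (0 / \<tau>))))"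
      proof (rule relaxation_bound[where g = "\<lambda>u. m * \<tau> * q u" and \<Phi>' = "\<lambda>u. m * \<bar>a1\<bar> + m * M * exp (u / \<tau>)"])
        show "continuous_on {0..} p" by (rule memory_system_continuous[OF sys])
        fix u :: real assume u: "u > 0"
        show "(p has_real_derivative (m * \<tau> * q u - p u) / \<tau>) (at u)"
          using memory_system_real_derivatives(4)[OF sys u] pos by (simp add: diff_divide_distrib)
        show "((\<lambda>u. m * \<bar>a1\<bar> * u + m * \<tau> * M * exp (u / \<tau>)) has_real_derivative m * \<bar>a1\<bar> + m * M * exp (u / \<tau>)) (at u)"
          using pos by (auto intro!: derivative_eq_intros)
        have "exp (u / \<tau>) * \<bar>m * \<tau> * q u\<bar> / \<tau> = m * (exp (u / \<tau>) * \<bar>q u\<bar>)"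
          using pos by (simp add: abs_mult)
        also have "\<dots> \<le> m * (exp (u / \<tau>) * (exp (- u / \<tau>) * \<bar>a1\<bar> + M))"
          using pos u by (intro mult_left_mono qb) auto
        also have "\<dots> = m * \<bar>a1\<bar> * (exp (u / \<tau>) * exp (- u / \<tau>)) + m * M * exp (u / \<tau>)"
          by (simp add: algebra_simps)
        finally show "exp (u / \<tau>) * \<bar>m * \<tau> * q u\<bar> / \<tau> \<le> m * \<bar>a1\<bar> + m * M * exp (u / \<tau>)"
          by (simp flip: exp_add)
      qed (use pos u in \<open>auto intro!: continuous_intros\<close>)
      also have "\<dots> = exp (- u / \<tau>) * (m * \<bar>a0\<bar> + m * \<bar>a1\<bar> * u) + m * \<tau> * M * (exp (- u / \<tau>) * exp (u / \<tau>))
          - exp (- u / \<tau>) * (m * \<tau> * M)"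
        using pos by (simp add: i algebra_simps abs_mult)
      also have "\<dots> \<le> exp (- u / \<tau>) * (m * \<bar>a0\<bar> + m * \<bar>a1\<bar> * u) + m * \<tau> * M"
        using pos M by (simp flip: exp_add)
      finally show ?thesis .
    qed
    \<comment> \<open>Half of the exponent pays for the resonant factor \<open>u\<close>. The
      transients are kept as a decaying exponential because their integral is then bounded in time;
      a constant bound would put a factor \<open>t\<close> on the full size of the data.\<close>
    let ?e = "\<lambda>u. exp (- u / (2 * \<tau>))"
    have fb: "r * (\<alpha> * \<bar>q u\<bar> + \<tau> * \<bar>p u\<bar>) \<le> r * (K1 * M + K2 * A * ?e u)" if u: "u \<ge> 0" for u
    proof (rule mult_left_mono[OF _ r(1)])
      have ee: "exp (- u / \<tau>) = ?e u * ?e u"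
        by (simp flip: exp_add)
      have e1: "exp (- u / \<tau>) \<le> ?e u"
        using pos u by (simp add: field_simps)
      have "u / (2 * \<tau>) \<le> exp (u / (2 * \<tau>))"
        using exp_ge_add_one_self[of "u / (2 * \<tau>)"] by linarith
      then have "?e u * (u / (2 * \<tau>)) \<le> ?e u * exp (u / (2 * \<tau>))" by (rule mult_left_mono) simp
      then have "?e u * (u / (2 * \<tau>)) \<le> 1" by (simp flip: exp_add)
      then have "?e u * u \<le> 2 * \<tau>" using pos by (simp add: field_simps)
      then have "?e u * (?e u * u) \<le> ?e u * (2 * \<tau>)" by (rule mult_left_mono) simp
      then have e2: "exp (- u / \<tau>) * u \<le> 2 * \<tau> * ?e u" by (simp only: ee mult_ac)
      have q': "\<bar>q u\<bar> \<le> ?e u * A + M"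
        by (rule order_trans[OF qb[OF u]]) (intro add_mono mult_mono e1 A order_refl; simp)
      have "\<bar>p u\<bar> \<le> m * (exp (- u / \<tau>) * \<bar>a0\<bar>) + m * (exp (- u / \<tau>) * u * \<bar>a1\<bar>) + m * \<tau> * M"
        using pb[OF u] by (simp add: algebra_simps)
      also have "\<dots> \<le> m * (?e u * A) + m * (2 * \<tau> * ?e u * A) + m * \<tau> * M"
        using pos u A by (intro add_mono mult_left_mono mult_mono e1 e2) auto
      finally have p': "\<bar>p u\<bar> \<le> m * (?e u * A) + m * (2 * \<tau> * ?e u * A) + m * \<tau> * M" .
      have "\<alpha> * \<bar>q u\<bar> + \<tau> * \<bar>p u\<bar> \<le> \<alpha> * (?e u * A + M) + \<tau> * (m * (?e u * A) + m * (2 * \<tau> * ?e u * A) + m * \<tau> * M)"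
        using al pos by (intro add_mono mult_left_mono q' p') auto
      also have "\<dots> = K1 * M + K2 * A * ?e u"
        by (simp add: K1_def K2_def algebra_simps power2_eq_square)
      finally show "\<alpha> * \<bar>q u\<bar> + \<tau> * \<bar>p u\<bar> \<le> K1 * M + K2 * A * ?e u" .
    qed
    have om2: "\<omega> * \<omega> = r * (1 - m * \<tau>)" and om: "\<omega> \<ge> 0" "\<omega> \<le> sqrt r"
      using r pos by (auto simp: \<omega>_def intro!: mult_left_le)
    \<comment> \<open>The state at time \<open>u\<close>, propagated freely up to time
      \<open>t\<close>: it is \<open>\<omega> * v t\<close> at \<open>u = t\<close>, the free
      oscillation at \<open>u = 0\<close>, and only the forcing contributes to its derivative.
      \<open>?B\<close> below is an antiderivative of the bound \<open>fb\<close>.\<close>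
    let ?\<phi> = "\<lambda>u. cos (\<omega> * (t - u)) * (\<omega> * v u) + sin (\<omega> * (t - u)) * s u"
    let ?B = "\<lambda>u. r * (K1 * M * u - 2 * \<tau> * K2 * A * ?e u)"
    have "\<bar>?\<phi> t - ?\<phi> 0\<bar> \<le> ?B t - ?B 0"
    proof (cases "t = 0")
      case False
      have "norm (?\<phi> t - ?\<phi> 0) \<le> ?B t - ?B 0"
      proof (rule differentiable_bound_general)
        show "0 < t" using t False by simp
        have "{0..t} \<subseteq> {0..}" by auto
        note cont = memory_system_continuous[OF sys, THEN continuous_on_subset, OF this]
        show "continuous_on {0..t} ?\<phi>" by (intro continuous_intros cont)
        show "continuous_on {0..t} ?B" using pos by (intro continuous_intros) auto
        fix u assume u: "0 < u" "u < t"
        note der = memory_system_real_derivatives[OF sys u(1), folded \<alpha>_def]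
        have "(?\<phi> has_real_derivative
            (sin (\<omega> * (t - u)) * \<omega> * (\<omega> * v u) + cos (\<omega> * (t - u)) * (\<omega> * s u)) +
            (- (cos (\<omega> * (t - u)) * \<omega>) * s u + sin (\<omega> * (t - u)) * (- (r * (1 - m * \<tau>) * v u + r * \<alpha> * q u + r * \<tau> * p u)))) (at u)"
          by (auto intro!: derivative_eq_intros der)
        moreover have "(sin (\<omega> * (t - u)) * \<omega> * (\<omega> * v u) + cos (\<omega> * (t - u)) * (\<omega> * s u)) +
            (- (cos (\<omega> * (t - u)) * \<omega>) * s u + sin (\<omega> * (t - u)) * (- (r * (1 - m * \<tau>) * v u + r * \<alpha> * q u + r * \<tau> * p u))) =
            - (sin (\<omega> * (t - u)) * (r * (\<alpha> * q u + \<tau> * p u)))"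
          unfolding om2[symmetric] by (simp add: algebra_simps)
        ultimately show "(?\<phi> has_vector_derivative - (sin (\<omega> * (t - u)) * (r * (\<alpha> * q u + \<tau> * p u)))) (at u)"
          by (simp add: has_real_derivative_iff_has_vector_derivative)
        show "(?B has_vector_derivative r * (K1 * M + K2 * A * ?e u)) (at u)"
          unfolding has_real_derivative_iff_has_vector_derivative[symmetric]
          using pos by (auto intro!: derivative_eq_intros)
        have "norm (- (sin (\<omega> * (t - u)) * (r * (\<alpha> * q u + \<tau> * p u)))) \<le> 1 * (r * (\<alpha> * \<bar>q u\<bar> + \<tau> * \<bar>p u\<bar>))"
        proof -
          have "\<bar>\<alpha> * q u + \<tau> * p u\<bar> \<le> \<alpha> * \<bar>q u\<bar> + \<tau> * \<bar>p u\<bar>"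
            using abs_triangle_ineq[of "\<alpha> * q u" "\<tau> * p u"] al pos by (simp add: abs_mult)
          then have "\<bar>r * (\<alpha> * q u + \<tau> * p u)\<bar> \<le> r * (\<alpha> * \<bar>q u\<bar> + \<tau> * \<bar>p u\<bar>)"
            using r by (simp add: abs_mult mult_left_mono)
          then show ?thesis
            unfolding real_norm_def abs_minus_cancel abs_mult[of "sin (\<omega> * (t - u))"] by (intro mult_mono) auto
        qed
        then show "norm (- (sin (\<omega> * (t - u)) * (r * (\<alpha> * q u + \<tau> * p u)))) \<le> r * (K1 * M + K2 * A * ?e u)"
          using fb[of u] u by simp
      qed
      then show ?thesis by simp
    qed simp
    also have "\<dots> \<le> r * (K1 * M * t + 2 * \<tau> * K2 * A)"
    proof -
      have "0 \<le> 2 * \<tau> * K2 * A * ?e t" using pos K12 A by simp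
      then have "r * (K1 * M * t - 2 * \<tau> * K2 * A * ?e t + 2 * \<tau> * K2 * A) \<le> r * (K1 * M * t + 2 * \<tau> * K2 * A)"
        by (intro mult_left_mono r) simp
      then show ?thesis by (simp add: algebra_simps)
    qed
    finally have D: "\<bar>\<omega> * v t - (cos (\<omega> * t) * (\<omega> * v 0) + sin (\<omega> * t) * s0)\<bar> \<le> r * (K1 * M * t + 2 * \<tau> * K2 * A)"
      by (simp add: i s0_def)
    have v0: "\<bar>v 0\<bar> \<le> (1 + \<tau>) * A"
    proof -
      have "\<bar>v 0\<bar> \<le> \<bar>a0\<bar> + \<tau> * \<bar>a1\<bar>"
        using abs_triangle_ineq[of a0 "\<tau> * a1"] pos by (simp add: abs_mult i)
      also have "\<dots> \<le> A + \<tau> * A" using A pos by (intro add_mono mult_left_mono) auto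
      finally show ?thesis by (simp add: algebra_simps)
    qed
    have s0: "\<bar>s0\<bar> \<le> (1 + \<tau>) * A"
    proof -
      have "\<bar>s0\<bar> \<le> \<bar>a1\<bar> + \<tau> * \<bar>a2\<bar>"
        using abs_triangle_ineq[of a1 "\<tau> * a2"] pos by (simp add: abs_mult s0_def)
      also have "\<dots> \<le> A + \<tau> * A" using pos by (intro add_mono mult_left_mono) (auto simp: A_def)
      finally show ?thesis by (simp add: algebra_simps)
    qed
    have qt: "\<bar>q t\<bar> \<le> (1 + K0 * (2 + \<tau>)) * A"
    proof -
      have "\<bar>q t\<bar> \<le> 1 * A + M"
        using pos t by (intro order_trans[OF qb[OF t]] add_mono mult_mono A) auto
      also have "M \<le> K0 * ((1 + \<tau>) * A + 1 * A)"
        unfolding M_def using K0 r A by (intro mult_left_mono add_mono s0 mult_right_mono) auto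
      finally show ?thesis by (simp add: algebra_simps)
    qed
    have rs: "r \<le> sqrt r" using r by (simp add: real_le_rsqrt power2_eq_square mult_left_le)
    have "\<bar>\<omega> * y t - sin (\<omega> * t) * s0\<bar> \<le>
        \<bar>\<omega> * v t - (cos (\<omega> * t) * (\<omega> * v 0) + sin (\<omega> * t) * s0)\<bar> + \<bar>cos (\<omega> * t) * (\<omega> * v 0)\<bar> + \<bar>\<omega> * (\<tau> * q t)\<bar>"
      unfolding y by (simp add: right_diff_distrib)
    also have "\<bar>cos (\<omega> * t) * (\<omega> * v 0)\<bar> \<le> 1 * (sqrt r * ((1 + \<tau>) * A))"
      unfolding abs_mult using om r by (intro mult_mono v0) auto
    also have "\<bar>\<omega> * (\<tau> * q t)\<bar> \<le> sqrt r * (\<tau> * ((1 + K0 * (2 + \<tau>)) * A))"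
      unfolding abs_mult using om r pos by (intro mult_mono qt) auto
    also note D
    also have "r * (K1 * M * t + 2 * \<tau> * K2 * A) \<le> K1 * K0 * (r * t * \<bar>s0\<bar> + r * t * (sqrt r * A)) + sqrt r * (2 * \<tau> * K2 * A)"
    proof -
      have "r * (2 * \<tau> * K2 * A) \<le> sqrt r * (2 * \<tau> * K2 * A)"
        using rs pos K12 A by (intro mult_right_mono) auto
      then show ?thesis by (simp add: M_def algebra_simps)
    qed
    finally have "\<bar>\<omega> * y t - sin (\<omega> * t) * s0\<bar> \<le> K1 * K0 * (r * t * \<bar>s0\<bar>) +
        ((1 + \<tau>) + \<tau> * (1 + K0 * (2 + \<tau>)) + 2 * \<tau> * K2) * (sqrt r * A) + K1 * K0 * (sqrt r * (r * t) * A)"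
      by (simp add: algebra_simps)
    also have "\<dots> \<le> ?K * (r * t * \<bar>s0\<bar>) + ?K * (sqrt r * A) + ?K * (sqrt r * (r * t) * A)"
    proof -
      have k: "K1 * K0 \<le> ?K" "(1 + \<tau>) + \<tau> * (1 + K0 * (2 + \<tau>)) + 2 * \<tau> * K2 \<le> ?K"
        using pos K0 K12 by auto
      show ?thesis
        by (rule add_mono[OF add_mono[OF mult_right_mono[OF k(1)] mult_right_mono[OF k(2)]] mult_right_mono[OF k(1)]])
          (use r A t in auto)
    qed
    also have "\<dots> = ?K * (r * t * \<bar>s0\<bar> + sqrt r * (1 + r * t) * A)"
      by (simp add: distrib_left distrib_right)
    finally show "\<bar>sqrt (r * (1 - m * \<tau>)) * y t - sin (sqrt (r * (1 - m * \<tau>)) * t) * (a1 + \<tau> * a2)\<bar> \<le>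
        ?K * (r * t * \<bar>a1 + \<tau> * a2\<bar> + sqrt r * (1 + r * t) * (\<bar>a0\<bar> + \<bar>a1\<bar> + \<bar>a2\<bar>))"
      by (simp only: \<omega>_def s0_def A_def)
  qed
qed

section \<open>Continuous dependence on the frequency\<close>

lemma square_add3_le: "(x + y + z)\<^sup>2 \<le> 3 * (x\<^sup>2 + y\<^sup>2 + z\<^sup>2)" for x y z :: real
  using zero_le_power2[of "x - y"] zero_le_power2[of "x - z"] zero_le_power2[of "y - z"]
  by (simp add: power2_eq_square algebra_simps)

text \<open>For the unweighted sum of squares, which does not degenerate at \<open>r = 0\<close>.
  The product \<open>e * f\<close> is what remains when systems whose parameters differ by
  \<open>e\<close> are subtracted; \<open>e = 0\<close> gives the growth of a single
  solution.\<close>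

lemma memory_system_energy_growth:
  fixes v s q p e f :: real
  assumes pos: "\<tau> > 0" "m > 0" "\<alpha> \<ge> 0" "\<beta> \<ge> 0" and r: "0 \<le> r" "r \<le> R"
  shows "2 * v * s + 2 * s * (- (r * \<beta> * v + r * \<alpha> * q + r * \<tau> * p) - e * f) + 2 * q * ((s - q) / \<tau>) + 2 * p * (m * q - p / \<tau>)
    \<le> (2 + R * (\<beta> + \<alpha> + \<tau>) + 1 / \<tau> + m) * (v\<^sup>2 + s\<^sup>2 + q\<^sup>2 + p\<^sup>2) + e\<^sup>2 * f\<^sup>2"
proof -
  let ?G = "v\<^sup>2 + s\<^sup>2 + q\<^sup>2 + p\<^sup>2"
  have cross: "2 * k * x * y \<le> K * (x\<^sup>2 + y\<^sup>2)" if "\<bar>k\<bar> \<le> K" for k K x y :: real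
  proof -
    have "k\<^sup>2 \<le> K\<^sup>2" using that by (simp add: abs_le_square_iff[symmetric])
    then have "(2 * k) * x * y \<le> K * x\<^sup>2 + K * y\<^sup>2"
      using that by (intro discriminant_bound) (auto simp: power2_eq_square)
    then show ?thesis by (simp add: distrib_left)
  qed
  have crossG: "2 * k * x * y \<le> K * ?G" if "\<bar>k\<bar> \<le> K" "x\<^sup>2 + y\<^sup>2 \<le> ?G" for k K x y :: real
    using cross[OF that(1), of x y] mult_left_mono[OF that(2), of K] that(1) by linarith
  have R: "r * \<beta> \<le> R * \<beta>" "r * \<alpha> \<le> R * \<alpha>" "r * \<tau> \<le> R * \<tau>" "0 \<le> r * \<beta>" "0 \<le> r * \<alpha>" "0 \<le> r * \<tau>"
    using r pos by (auto intro!: mult_right_mono)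
  have "2 * 1 * v * s \<le> 1 * ?G" "2 * (- (r * \<beta>)) * s * v \<le> (R * \<beta>) * ?G"
    "2 * (- (r * \<alpha>)) * s * q \<le> (R * \<alpha>) * ?G" "2 * (- (r * \<tau>)) * s * p \<le> (R * \<tau>) * ?G"
    "2 * (1 / \<tau>) * q * s \<le> (1 / \<tau>) * ?G" "2 * m * p * q \<le> m * ?G"
    by (rule crossG; use R pos in simp)+
  moreover have "2 * (- 1) * s * (e * f) \<le> 1 * (s\<^sup>2 + (e * f)\<^sup>2)"
    by (rule cross) simp
  moreover have "0 \<le> 2 / \<tau> * q\<^sup>2" "0 \<le> 2 / \<tau> * p\<^sup>2" using pos by auto
  moreover have "2 * v * s + 2 * s * (- (r * \<beta> * v + r * \<alpha> * q + r * \<tau> * p) - e * f) + 2 * q * ((s - q) / \<tau>) + 2 * p * (m * q - p / \<tau>)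
     = 2 * 1 * v * s + 2 * (- (r * \<beta>)) * s * v + 2 * (- (r * \<alpha>)) * s * q + 2 * (- (r * \<tau>)) * s * p
       + 2 * (1 / \<tau>) * q * s + 2 * m * p * q + 2 * (- 1) * s * (e * f) - 2 / \<tau> * q\<^sup>2 - 2 / \<tau> * p\<^sup>2"
    by (simp add: algebra_simps power2_eq_square diff_divide_distrib)
  moreover have "(2 + R * (\<beta> + \<alpha> + \<tau>) + 1 / \<tau> + m) * ?G + e\<^sup>2 * f\<^sup>2 =
      2 * ?G + (R * \<beta>) * ?G + (R * \<alpha>) * ?G + (R * \<tau>) * ?G + (1 / \<tau>) * ?G + m * ?G + (e * f)\<^sup>2"
    by (simp only: distrib_left distrib_right power_mult_distrib mult.assoc add.assoc)
  moreover have "s\<^sup>2 \<le> ?G" by simp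
  ultimately show ?thesis by (smt (verit))
qed

text \<open>The difference is driven by the second solution with the factor \<open>r - r'\<close>.
  Adding \<open>(r - r')\<^sup>2\<close> times the size of that solution to the size of the
  difference gives a quantity that obeys a closed Gronwall inequality.\<close>

lemma memory_system_continuous_dependence:
  fixes v s q p v' s' q' p' :: "real \<Rightarrow> real"
  assumes pos: "\<tau> > 0" "m > 0" "\<delta> \<ge> 0" "m * \<tau> < 1" and r: "0 \<le> r" "r \<le> R" "0 \<le> r'" "r' \<le> R"
    and sys: "memory_system \<tau> \<delta> m r v s q p" and sys': "memory_system \<tau> \<delta> m r' v' s' q' p'" and t: "t \<ge> 0"
  defines "\<alpha> \<equiv> \<delta> + m * \<tau>\<^sup>2" and "\<beta> \<equiv> 1 - m * \<tau>"
  defines "\<kappa> \<equiv> 2 + R * (\<beta> + \<alpha> + \<tau>) + 1 / \<tau> + m + 3 * (\<beta>\<^sup>2 + \<alpha>\<^sup>2 + \<tau>\<^sup>2)"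
  shows "(v t - v' t)\<^sup>2 + (s t - s' t)\<^sup>2 + (q t - q' t)\<^sup>2 + (p t - p' t)\<^sup>2 \<le>
    exp (\<kappa> * t) * ((v 0 - v' 0)\<^sup>2 + (s 0 - s' 0)\<^sup>2 + (q 0 - q' 0)\<^sup>2 + (p 0 - p' 0)\<^sup>2 +
      (r - r')\<^sup>2 * ((v' 0)\<^sup>2 + (s' 0)\<^sup>2 + (q' 0)\<^sup>2 + (p' 0)\<^sup>2))"
proof -
  have ab: "\<alpha> \<ge> 0" "\<beta> \<ge> 0" using pos by (auto simp: \<alpha>_def \<beta>_def)
  let ?G' = "\<lambda>t. (v' t)\<^sup>2 + (s' t)\<^sup>2 + (q' t)\<^sup>2 + (p' t)\<^sup>2"
  let ?G = "\<lambda>t. (v t - v' t)\<^sup>2 + (s t - s' t)\<^sup>2 + (q t - q' t)\<^sup>2 + (p t - p' t)\<^sup>2"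
  let ?H = "\<lambda>t. ?G t + (r - r')\<^sup>2 * ?G' t"
  let ?k = "2 + R * (\<beta> + \<alpha> + \<tau>) + 1 / \<tau> + m"
  let ?dG = "\<lambda>v s q p e f r. 2 * v * s + 2 * s * (- (r * \<beta> * v + r * \<alpha> * q + r * \<tau> * p) - e * f) +
      2 * q * ((s - q) / \<tau>) + 2 * p * (m * q - p / \<tau>)"
  have "?H t \<le> exp (\<kappa> * t) * ?H 0"
  proof (rule gronwall[OF _ _ _ t])
    show "continuous_on {0..} ?H"
      by (intro continuous_intros memory_system_continuous[OF sys] memory_system_continuous[OF sys'])
    fix t :: real assume t: "t > 0"
    note der = memory_system_real_derivatives[OF sys t, folded \<alpha>_def \<beta>_def]
      memory_system_real_derivatives[OF sys' t, folded \<alpha>_def \<beta>_def]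
    let ?f = "\<beta> * v' t + \<alpha> * q' t + \<tau> * p' t"
    show "(?H has_real_derivative
        ?dG (v t - v' t) (s t - s' t) (q t - q' t) (p t - p' t) (r - r') ?f r +
        (r - r')\<^sup>2 * ?dG (v' t) (s' t) (q' t) (p' t) 0 0 r') (at t)"
      by (auto intro!: derivative_eq_intros der) (simp add: algebra_simps diff_divide_distrib add_divide_distrib)
    have f: "?f\<^sup>2 \<le> 3 * (\<beta>\<^sup>2 + \<alpha>\<^sup>2 + \<tau>\<^sup>2) * ?G' t"
    proof -
      from square_add3_le[of "\<beta> * v' t" "\<alpha> * q' t" "\<tau> * p' t"]
      have "?f\<^sup>2 \<le> 3 * (\<beta>\<^sup>2 * (v' t)\<^sup>2 + \<alpha>\<^sup>2 * (q' t)\<^sup>2 + \<tau>\<^sup>2 * (p' t)\<^sup>2)"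
        by (simp add: power_mult_distrib)
      also have "\<dots> \<le> 3 * (\<beta>\<^sup>2 * ?G' t + \<alpha>\<^sup>2 * ?G' t + \<tau>\<^sup>2 * ?G' t)"
        by (intro mult_left_mono add_mono) auto
      finally show ?thesis by (simp only: distrib_left distrib_right mult.assoc)
    qed
    have "?dG (v t - v' t) (s t - s' t) (q t - q' t) (p t - p' t) (r - r') ?f r \<le> ?k * ?G t + (r - r')\<^sup>2 * ?f\<^sup>2"
      by (rule memory_system_energy_growth[OF pos(1,2) ab r(1,2)])
    also have "\<dots> \<le> ?k * ?G t + (r - r')\<^sup>2 * (3 * (\<beta>\<^sup>2 + \<alpha>\<^sup>2 + \<tau>\<^sup>2) * ?G' t)"
      by (intro add_left_mono mult_left_mono f) simp
    finally have 1: "?dG (v t - v' t) (s t - s' t) (q t - q' t) (p t - p' t) (r - r') ?f r \<le>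
        ?k * ?G t + 3 * (\<beta>\<^sup>2 + \<alpha>\<^sup>2 + \<tau>\<^sup>2) * ((r - r')\<^sup>2 * ?G' t)" by (simp only: mult_ac)
    have "(r - r')\<^sup>2 * ?dG (v' t) (s' t) (q' t) (p' t) 0 0 r' \<le> (r - r')\<^sup>2 * (?k * ?G' t + 0\<^sup>2 * 0\<^sup>2)"
      by (intro mult_left_mono memory_system_energy_growth[OF pos(1,2) ab r(3,4)]) simp
    then have 2: "(r - r')\<^sup>2 * ?dG (v' t) (s' t) (q' t) (p' t) 0 0 r' \<le> ?k * ((r - r')\<^sup>2 * ?G' t)"
      by (simp add: mult_ac)
    have "0 \<le> 3 * (\<beta>\<^sup>2 + \<alpha>\<^sup>2 + \<tau>\<^sup>2) * ?G t" by simp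
    moreover have "\<kappa> * ?H t = ?k * ?G t + 3 * (\<beta>\<^sup>2 + \<alpha>\<^sup>2 + \<tau>\<^sup>2) * ?G t +
        (?k * ((r - r')\<^sup>2 * ?G' t) + 3 * (\<beta>\<^sup>2 + \<alpha>\<^sup>2 + \<tau>\<^sup>2) * ((r - r')\<^sup>2 * ?G' t))"
      unfolding \<kappa>_def by (simp only: distrib_right distrib_left mult.assoc add.assoc add.left_commute add.commute)
    ultimately show "?dG (v t - v' t) (s t - s' t) (q t - q' t) (p t - p' t) (r - r') ?f r +
        (r - r')\<^sup>2 * ?dG (v' t) (s' t) (q' t) (p' t) 0 0 r' \<le> \<kappa> * ?H t"
      using 1 2 by (smt (verit))
  qed
  moreover have "0 \<le> (r - r')\<^sup>2 * ?G' t" by simp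
  ultimately show ?thesis by linarith
qed

text \<open>Needed for measurability, since the solutions at different frequencies are given
  independently of each other and only the data are known to depend continuously on \<xi>.\<close>

lemma continuous_on_real_solution:
  fixes a0 a1 a2 :: "'a::euclidean_space \<Rightarrow> real"
  assumes pos: "\<tau> > 0" "m > 0" "\<delta> \<ge> 0" "m * \<tau> < 1"
    and a: "continuous_on UNIV a0" "continuous_on UNIV a1" "continuous_on UNIV a2"
    and sol: "\<And>\<xi>. real_solution \<tau> \<delta> m ((norm \<xi>)\<^sup>2) (a0 \<xi>) (a1 \<xi>) (a2 \<xi>) (y \<xi>)" and t: "t \<ge> 0"
  shows "continuous_on UNIV (\<lambda>\<xi>. y \<xi> t)"
proof (rule continuous_at_imp_continuous_on, rule ballI)
  fix \<xi>0 :: 'a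
  \<comment> \<open>A bound for \<open>r\<close> on the unit ball around \<open>\<xi>0\<close>,
    which makes the Gronwall exponent \<kappa> locally uniform.\<close>
  define R where "R = (norm \<xi>0 + 1)\<^sup>2"
  define \<kappa> where "\<kappa> = 2 + R * (1 - m * \<tau> + (\<delta> + m * \<tau>\<^sup>2) + \<tau>) + 1 / \<tau> + m +
      3 * ((1 - m * \<tau>)\<^sup>2 + (\<delta> + m * \<tau>\<^sup>2)\<^sup>2 + \<tau>\<^sup>2)"
  let ?N = "\<lambda>b0 b1 b2. (b0 + \<tau> * b1)\<^sup>2 + (b1 + \<tau> * b2)\<^sup>2 + b1\<^sup>2 + (m * b0)\<^sup>2"
  let ?b = "\<lambda>\<xi>. (2 + 2 * \<tau>\<^sup>2) * (exp (\<kappa> * t) * (?N (a0 \<xi> - a0 \<xi>0) (a1 \<xi> - a1 \<xi>0) (a2 \<xi> - a2 \<xi>0) +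
      ((norm \<xi>)\<^sup>2 - (norm \<xi>0)\<^sup>2)\<^sup>2 * ?N (a0 \<xi>0) (a1 \<xi>0) (a2 \<xi>0)))"
  have bound: "(y \<xi> t - y \<xi>0 t)\<^sup>2 \<le> ?b \<xi>" if "norm \<xi> < norm \<xi>0 + 1" for \<xi>
  proof -
    from sol[of \<xi>] t obtain v s q p where sys: "memory_system \<tau> \<delta> m ((norm \<xi>)\<^sup>2) v s q p" and y: "y \<xi> t = v t - \<tau> * q t"
      and i: "v 0 = a0 \<xi> + \<tau> * a1 \<xi>" "s 0 = a1 \<xi> + \<tau> * a2 \<xi>" "q 0 = a1 \<xi>" "p 0 = m * a0 \<xi>"
      unfolding real_solution_def by blast
    from sol[of \<xi>0] t obtain v' s' q' p' where sys': "memory_system \<tau> \<delta> m ((norm \<xi>0)\<^sup>2) v' s' q' p'"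
      and y': "y \<xi>0 t = v' t - \<tau> * q' t"
      and i': "v' 0 = a0 \<xi>0 + \<tau> * a1 \<xi>0" "s' 0 = a1 \<xi>0 + \<tau> * a2 \<xi>0" "q' 0 = a1 \<xi>0" "p' 0 = m * a0 \<xi>0"
      unfolding real_solution_def by blast
    have R: "(norm \<xi>)\<^sup>2 \<le> R" "(norm \<xi>0)\<^sup>2 \<le> R"
      using that unfolding R_def by (intro power_mono; simp)+
    have "y \<xi> t - y \<xi>0 t = (v t - v' t) + - (\<tau> * (q t - q' t))"
      by (simp add: y y' algebra_simps)
    then have "(y \<xi> t - y \<xi>0 t)\<^sup>2 \<le> 2 * (v t - v' t)\<^sup>2 + 2 * (\<tau> * (q t - q' t))\<^sup>2"
      using square_add_le[of "v t - v' t" "- (\<tau> * (q t - q' t))"] by (simp only: power2_minus)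
    also have "\<dots> \<le> \<dots> + (2 * \<tau>\<^sup>2 * (v t - v' t)\<^sup>2 + 2 * (q t - q' t)\<^sup>2 + (2 + 2 * \<tau>\<^sup>2) * ((s t - s' t)\<^sup>2 + (p t - p' t)\<^sup>2))"
      by simp
    also have "\<dots> = (2 + 2 * \<tau>\<^sup>2) * ((v t - v' t)\<^sup>2 + (s t - s' t)\<^sup>2 + (q t - q' t)\<^sup>2 + (p t - p' t)\<^sup>2)"
      unfolding power_mult_distrib by algebra
    also have "\<dots> \<le> (2 + 2 * \<tau>\<^sup>2) * (exp (\<kappa> * t) * ((v 0 - v' 0)\<^sup>2 + (s 0 - s' 0)\<^sup>2 + (q 0 - q' 0)\<^sup>2 + (p 0 - p' 0)\<^sup>2 +
      ((norm \<xi>)\<^sup>2 - (norm \<xi>0)\<^sup>2)\<^sup>2 * ((v' 0)\<^sup>2 + (s' 0)\<^sup>2 + (q' 0)\<^sup>2 + (p' 0)\<^sup>2)))"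
      unfolding \<kappa>_def
      by (intro mult_left_mono memory_system_continuous_dependence[OF pos zero_le_power2 R(1) zero_le_power2 R(2) sys sys' t])
        (simp add: add_nonneg_nonneg)
    also have "\<dots> = ?b \<xi>"
      unfolding i i' by (simp add: algebra_simps)
    finally show ?thesis .
  qed
  have c: "isCont a0 \<xi>0" "isCont a1 \<xi>0" "isCont a2 \<xi>0"
    using a by (auto simp: continuous_on_eq_continuous_at)
  have "(?b \<longlongrightarrow> ?b \<xi>0) (at \<xi>0)"
    by (intro tendsto_intros isContD c)
  then have lim: "(?b \<longlongrightarrow> 0) (at \<xi>0)" by simp
  have ev: "\<forall>\<^sub>F \<xi> in at \<xi>0. norm \<xi> < norm \<xi>0 + 1"
    using order_tendstoD(2)[OF tendsto_norm[OF tendsto_ident_at[of \<xi>0 UNIV]], of "norm \<xi>0 + 1"] by simp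
  have "((\<lambda>\<xi>. (y \<xi> t - y \<xi>0 t)\<^sup>2) \<longlongrightarrow> 0) (at \<xi>0)"
    by (rule Lim_null_comparison[OF _ lim]) (use bound in \<open>auto intro: eventually_mono[OF ev]\<close>)
  then have "((\<lambda>\<xi>. sqrt ((y \<xi> t - y \<xi>0 t)\<^sup>2)) \<longlongrightarrow> sqrt 0) (at \<xi>0)"
    by (rule tendsto_real_sqrt)
  then have "((\<lambda>\<xi>. y \<xi> t - y \<xi>0 t) \<longlongrightarrow> 0) (at \<xi>0)"
    by (simp add: tendsto_rabs_zero_iff)
  then show "isCont (\<lambda>\<xi>. y \<xi> t) \<xi>0"
    by (simp add: isCont_def LIM_zero_iff)
qed

section \<open>Integration over low frequencies\<close>

text \<open>The size of the squared solution at low frequencies with the data removed. At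
  \<open>\<rho> * t = 1\<close> the two bounds agree up to the exponential; beyond 1 the control is
  left to \<open>data_weight\<close>.\<close>

definition low_kernel :: "real \<Rightarrow> real \<Rightarrow> real \<Rightarrow> real" where
  "low_kernel c t \<rho> = (if \<rho> * t \<le> 1 then t\<^sup>2 else if \<rho> \<le> 1 then exp (- c * \<rho>\<^sup>2 * t) / \<rho>\<^sup>2 else 0)"

lemma borel_measurable_low_kernel [measurable]: "low_kernel c t \<in> borel_measurable borel"
  unfolding low_kernel_def[abs_def] by measurable

lemma growth_rate_power2:
  assumes "t \<ge> 1"
  shows "(growth_rate n t)\<^sup>2 = (if n = 1 then t else if n = 2 then ln t else t powr (1 - real n / 2))"
proof -
  have "(t powr (1 / 2 - real n / 4))\<^sup>2 = t powr (1 - real n / 2)"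
    using assms by (simp add: power2_eq_square flip: powr_add)
  then show ?thesis using assms by (simp add: growth_rate_def)
qed

lemma inverse_sqrt_power:
  assumes "t > 0"
  shows "(1 / sqrt t) ^ j = t powr (- (real j / 2))"
proof -
  have "1 / sqrt t = t powr (- (1 / 2))"
    using assms by (simp add: powr_minus_divide powr_half_sqrt)
  then show ?thesis
    using assms by (simp add: powr_powr flip: powr_realpow)
qed

lemma nn_integral_power_Icc:
  fixes a b :: real
  assumes "0 \<le> a" "a \<le> b"
  shows "(\<integral>\<^sup>+\<rho>. ennreal (\<rho> ^ k) * indicator {a..b} \<rho> \<partial>lborel) = ennreal ((b ^ Suc k - a ^ Suc k) / real (Suc k))"
proof -
  have "(\<integral>\<^sup>+\<rho>. ennreal (\<rho> ^ k) * indicator {a..b} \<rho> \<partial>lborel) = ennreal (b ^ Suc k / real (Suc k) - a ^ Suc k / real (Suc k))"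
    using assms by (intro nn_integral_FTC_Icc) (auto intro!: derivative_eq_intros simp del: power_Suc of_nat_Suc)
  then show ?thesis by (simp add: diff_divide_distrib)
qed

lemma nn_integral_inverse_power_atLeast:
  fixes a :: real
  assumes "0 < a"
  shows "(\<integral>\<^sup>+\<rho>. ennreal (1 / \<rho> ^ Suc (Suc k)) * indicator {a..} \<rho> \<partial>lborel) = ennreal (1 / (real (Suc k) * a ^ Suc k))"
proof -
  have "(\<integral>\<^sup>+\<rho>. ennreal (1 / \<rho> ^ Suc (Suc k)) * indicator {a..} \<rho> \<partial>lborel) = ennreal (0 - (- (1 / (real (Suc k) * a ^ Suc k))))"
  proof (rule nn_integral_FTC_atLeast)
    fix x assume "a \<le> x"
    then have "x \<noteq> 0" using assms by auto
    then have "((\<lambda>x. 1 / x) has_real_derivative - (1 / x\<^sup>2)) (at x)"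
      by (auto intro!: derivative_eq_intros simp: power2_eq_square)
    from DERIV_cmult[OF DERIV_power_Suc[OF this, of k], of "- (1 / real (Suc k))"]
    have "((\<lambda>x. - (1 / real (Suc k)) * (1 / x) ^ Suc k) has_real_derivative
        - (1 / real (Suc k)) * ((1 + real k) * (- (1 / x\<^sup>2) * (1 / x) ^ k))) (at x)" .
    moreover have "- (1 / real (Suc k)) * ((1 + real k) * (- (1 / x\<^sup>2) * (1 / x) ^ k)) = 1 / x ^ Suc (Suc k)"
      using \<open>x \<noteq> 0\<close> by (simp add: power_one_over power2_eq_square)
    ultimately show "((\<lambda>x. - (1 / (real (Suc k) * x ^ Suc k))) has_real_derivative 1 / x ^ Suc (Suc k)) (at x)"
      by (simp add: power_one_over del: of_nat_Suc)
    show "0 \<le> 1 / x ^ Suc (Suc k)" using assms \<open>a \<le> x\<close> by simp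
  next
    have "((\<lambda>x. - (1 / real (Suc k) * inverse (x ^ Suc k))) \<longlongrightarrow> - (1 / real (Suc k) * 0)) at_top"
      by (intro tendsto_intros tendsto_inverse_0_at_top filterlim_pow_at_top filterlim_ident) simp
    then show "((\<lambda>x. - (1 / (real (Suc k) * x ^ Suc k))) \<longlongrightarrow> 0) at_top"
      by (simp add: field_simps)
  qed simp
  then show ?thesis by simp
qed

text \<open>A single term of the exponential series is at most its sum.\<close>

lemma exp_minus_le_inverse_power:
  fixes x :: real
  assumes "x > 0"
  shows "exp (- x) \<le> fact n / x ^ n"
proof -
  have "(\<Sum>k\<in>{n}. x ^ k /\<^sub>R fact k) \<le> exp x"
    unfolding exp_def by (rule sum_le_suminf) (use summable_exp_generic[of x] assms in auto)
  then have "x ^ n / fact n \<le> exp x" by (simp add: divide_inverse mult.commute)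
  then show ?thesis using assms by (simp add: exp_minus field_simps)
qed

text \<open>In dimension one both branches contribute order \<open>t\<close>, from frequencies near
  1 / t; in dimension two the integral of \<open>1 / \<rho>\<close> gives the logarithm; from
  dimension three on the integrand is concentrated near \<open>1 / sqrt t\<close>, where the
  exponential takes over. Starting at 3 ensures \<open>ln t >= 1\<close>.\<close>

lemma low_kernel_integral:
  fixes c :: real
  assumes c: "c > 0"
  obtains C where "C > 0" "\<And>t. t \<ge> 3 \<Longrightarrow>
    (\<integral>\<^sup>+\<xi>. ennreal (low_kernel c t (norm (\<xi>::'a::euclidean_space))) \<partial>lborel) \<le> ennreal (C * (growth_rate DIM('a) t)\<^sup>2)"
proof -
  define n where "n = DIM('a)"
  have n: "n \<ge> 1" by (simp add: n_def Suc_leI)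
  let ?S = "sphere_area DIM('a)"
  have S: "?S > 0" by (simp add: sphere_area_pos)
  have radial: "(\<integral>\<^sup>+\<xi>. ennreal (low_kernel c t (norm (\<xi>::'a))) \<partial>lborel) =
      ennreal ?S * (\<integral>\<^sup>+\<rho>. ennreal (\<rho> ^ (n - 1) * low_kernel c t \<rho>) * indicator {0..} \<rho> \<partial>lborel)" if t: "t \<ge> 3" for t
  proof -
    have "(\<integral>\<^sup>+\<xi>. ennreal (low_kernel c t (norm (\<xi>::'a))) \<partial>lborel) =
        (\<integral>\<^sup>+\<rho>. ennreal (indicator {0..} \<rho> * (?S * \<rho> ^ (DIM('a) - 1))) * ennreal (low_kernel c t \<rho>) \<partial>lborel)"
      by (rule nn_integral_radial) measurable
    also have "\<dots> = (\<integral>\<^sup>+\<rho>. ennreal ?S * (ennreal (\<rho> ^ (n - 1) * low_kernel c t \<rho>) * indicator {0..} \<rho>) \<partial>lborel)"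
      using S by (intro nn_integral_cong) (auto simp: n_def mult_ac low_kernel_def simp flip: ennreal_mult split: split_indicator)
    also have "\<dots> = ennreal ?S * (\<integral>\<^sup>+\<rho>. ennreal (\<rho> ^ (n - 1) * low_kernel c t \<rho>) * indicator {0..} \<rho> \<partial>lborel)"
      by (rule nn_integral_cmult) measurable
    finally show ?thesis .
  qed
  have inner: "(\<integral>\<^sup>+\<rho>. ennreal (\<rho> ^ (n - 1) * low_kernel c t \<rho>) * indicator {0..} \<rho> \<partial>lborel) =
      (\<integral>\<^sup>+\<rho>. ennreal (t\<^sup>2) * (ennreal (\<rho> ^ (n - 1)) * indicator {0..1 / t} \<rho>) \<partial>lborel) +
      (\<integral>\<^sup>+\<rho>. ennreal (\<rho> ^ (n - 1) * (exp (- c * \<rho>\<^sup>2 * t) / \<rho>\<^sup>2)) * indicator {1 / t<..1} \<rho> \<partial>lborel)" if t: "t \<ge> 3" for t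
  proof -
    have "ennreal (\<rho> ^ (n - 1) * low_kernel c t \<rho>) * indicator {0..} \<rho> =
        ennreal (t\<^sup>2) * (ennreal (\<rho> ^ (n - 1)) * indicator {0..1 / t} \<rho>) +
        ennreal (\<rho> ^ (n - 1) * (exp (- c * \<rho>\<^sup>2 * t) / \<rho>\<^sup>2)) * indicator {1 / t<..1} \<rho>" for \<rho>
    proof (cases "\<rho> \<ge> 0")
      case True
      then show ?thesis
        using t by (auto simp: low_kernel_def field_simps simp flip: ennreal_mult split: split_indicator)
    next
      case False
      moreover have "\<not> 1 / t < \<rho>" using t False by (smt (verit) divide_pos_pos)
      ultimately show ?thesis by (auto split: split_indicator)
    qed
    then show ?thesis by (subst nn_integral_add[symmetric]) auto
  qed
  have first: "(\<integral>\<^sup>+\<rho>. ennreal (t\<^sup>2) * (ennreal (\<rho> ^ (n - 1)) * indicator {0..1 / t} \<rho>) \<partial>lborel) = ennreal (t\<^sup>2 * (1 / t) ^ n / n)"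
    if t: "t \<ge> 3" for t
    using nn_integral_power_Icc[of 0 "1 / t" "n - 1"] t n
    by (simp add: nn_integral_cmult power_0_left del: power_Suc of_nat_Suc flip: ennreal_mult)
  have "\<exists>C>0. \<forall>t\<ge>3. t\<^sup>2 * (1 / t) ^ n / n \<le> C * (growth_rate n t)\<^sup>2 \<and>
     (\<integral>\<^sup>+\<rho>. ennreal (\<rho> ^ (n - 1) * (exp (- c * \<rho>\<^sup>2 * t) / \<rho>\<^sup>2)) * indicator {1 / t<..1} \<rho> \<partial>lborel) \<le> ennreal (C * (growth_rate n t)\<^sup>2)"
  proof -
    consider "n = 1" | "n = 2" | k where "n = k + 3"
      using n by (metis One_nat_def Suc_1 add.commute le_Suc_ex le_antisym not_less_eq_eq numeral_3_eq_3)
    then show ?thesis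
    proof cases
      case 1
      show ?thesis
      proof (intro exI[of _ 1] conjI allI impI)
        fix t :: real assume t: "t \<ge> 3"
        then show "t\<^sup>2 * (1 / t) ^ n / n \<le> 1 * (growth_rate n t)\<^sup>2"
          by (subst growth_rate_power2) (auto simp: 1 power2_eq_square)
        have "(\<integral>\<^sup>+\<rho>. ennreal (\<rho> ^ (n - 1) * (exp (- c * \<rho>\<^sup>2 * t) / \<rho>\<^sup>2)) * indicator {1 / t<..1} \<rho> \<partial>lborel) \<le>
            (\<integral>\<^sup>+\<rho>. ennreal (1 / \<rho> ^ Suc (Suc 0)) * indicator {1 / t..} \<rho> \<partial>lborel)"
          using t c by (intro nn_integral_mono) (auto simp: 1 power2_eq_square divide_right_mono intro!: ennreal_leI split: split_indicator)
        also have "\<dots> = ennreal t"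
          using t by (subst nn_integral_inverse_power_atLeast) auto
        finally show "(\<integral>\<^sup>+\<rho>. ennreal (\<rho> ^ (n - 1) * (exp (- c * \<rho>\<^sup>2 * t) / \<rho>\<^sup>2)) * indicator {1 / t<..1} \<rho> \<partial>lborel) \<le>
            ennreal (1 * (growth_rate n t)\<^sup>2)"
          using t by (simp add: growth_rate_power2 1)
      qed simp
    next
      case 2
      show ?thesis
      proof (intro exI[of _ 1] conjI allI impI)
        fix t :: real assume t: "t \<ge> 3"
        have "exp 1 \<le> t" using exp_le t by simp
        then have "1 \<le> ln t" using t by (simp add: ln_ge_iff)
        then show "t\<^sup>2 * (1 / t) ^ n / n \<le> 1 * (growth_rate n t)\<^sup>2"
          using t by (subst growth_rate_power2) (auto simp: 2 power2_eq_square)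
        have "(\<integral>\<^sup>+\<rho>. ennreal (\<rho> ^ (n - 1) * (exp (- c * \<rho>\<^sup>2 * t) / \<rho>\<^sup>2)) * indicator {1 / t<..1} \<rho> \<partial>lborel) \<le>
            (\<integral>\<^sup>+\<rho>. ennreal (1 / \<rho>) * indicator {1 / t..1} \<rho> \<partial>lborel)"
        proof (rule nn_integral_mono)
          fix \<rho> :: real
          have "\<rho> * (exp (- c * \<rho>\<^sup>2 * t) / \<rho>\<^sup>2) \<le> 1 / \<rho>" if "\<rho> > 0"
            using that t c by (simp add: power2_eq_square divide_right_mono)
          moreover have "\<rho> > 0" if "1 / t < \<rho>" using that t by (smt (verit) divide_pos_pos)
          ultimately show "ennreal (\<rho> ^ (n - 1) * (exp (- c * \<rho>\<^sup>2 * t) / \<rho>\<^sup>2)) * indicator {1 / t<..1} \<rho> \<le>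
              ennreal (1 / \<rho>) * indicator {1 / t..1} \<rho>"
            by (auto simp: 2 intro!: ennreal_leI split: split_indicator)
        qed
        also have "\<dots> = ennreal (ln 1 - ln (1 / t))"
        proof (rule nn_integral_FTC_Icc)
          fix x assume "x \<in> {1 / t..1}"
          then have x: "x > 0" using t by (smt (verit) atLeastAtMost_iff divide_pos_pos)
          then show "(ln has_real_derivative 1 / x) (at x)"
            by (auto intro!: derivative_eq_intros)
          show "0 \<le> 1 / x" using x by simp
        qed (use t in auto)
        also have "\<dots> = ennreal (ln t)" using t by (simp add: ln_div)
        finally show "(\<integral>\<^sup>+\<rho>. ennreal (\<rho> ^ (n - 1) * (exp (- c * \<rho>\<^sup>2 * t) / \<rho>\<^sup>2)) * indicator {1 / t<..1} \<rho> \<partial>lborel) \<le>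
            ennreal (1 * (growth_rate n t)\<^sup>2)"
          using t by (simp add: growth_rate_power2 2)
      qed simp
    next
      case 3
      \<comment> \<open>The integral is split at \<open>1 / sqrt t\<close>. Below, the exponential
        is dropped. Above, it is bounded by the inverse \<open>n\<close>-th power of its argument,
        which makes the integrand integrable at infinity. Both parts have order
        \<open>d ^ (k + 1)\<close>.\<close>
      let ?K = "fact n / c ^ n"
      have K: "?K > 0" using c by simp
      show ?thesis
      proof (intro exI[of _ "1 + ?K"] conjI allI impI)
        show "0 < 1 + ?K" using K by simp
        fix t :: real assume t: "t \<ge> 3"
        define d where "d = 1 / sqrt t"
        have d: "d > 0" "d\<^sup>2 = 1 / t" using t by (auto simp: d_def power_divide)
        have "d ^ (k + 1) = t powr (- (real (k + 1) / 2))"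
          unfolding d_def using t by (intro inverse_sqrt_power) simp
        also have "- (real (k + 1) / 2) = 1 - real n / 2" by (simp add: 3 field_simps)
        finally have D: "(growth_rate n t)\<^sup>2 = d ^ (k + 1)" using t by (simp add: growth_rate_power2 3)
        have "t\<^sup>2 * (1 / t) ^ n / n \<le> t\<^sup>2 * (1 / t) ^ n / 1"
          using t by (intro divide_left_mono) (auto simp: 3)
        also have "\<dots> = (d\<^sup>2) ^ (k + 1)"
          unfolding d(2) 3 using t by (simp add: power2_eq_square power_add power3_eq_cube power_divide)
        also have "\<dots> = d ^ (k + 1) * d ^ (k + 1)" by (simp add: power2_eq_square power_mult_distrib)
        also have "\<dots> \<le> d ^ (k + 1) * 1"
          using t by (intro mult_left_mono power_le_one) (auto simp: d_def)
        also have "\<dots> \<le> (1 + ?K) * d ^ (k + 1)" using K d c by (simp add: distrib_right)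
        finally show "t\<^sup>2 * (1 / t) ^ n / n \<le> (1 + ?K) * (growth_rate n t)\<^sup>2" by (simp add: D)
        have "(\<integral>\<^sup>+\<rho>. ennreal (\<rho> ^ (n - 1) * (exp (- c * \<rho>\<^sup>2 * t) / \<rho>\<^sup>2)) * indicator {1 / t<..1} \<rho> \<partial>lborel) \<le>
            (\<integral>\<^sup>+\<rho>. ennreal (\<rho> ^ k) * indicator {0..d} \<rho> + ennreal (?K / t ^ n) * (ennreal (1 / \<rho> ^ Suc (Suc (n + 1))) * indicator {d..} \<rho>) \<partial>lborel)"
        proof (rule nn_integral_mono)
          fix \<rho> :: real
          have pos: "\<rho> > 0" if "1 / t < \<rho>" using that t by (smt (verit) divide_pos_pos)
          have e: "\<rho> ^ (n - 1) * (exp (- c * \<rho>\<^sup>2 * t) / \<rho>\<^sup>2) = \<rho> ^ k * exp (- c * \<rho>\<^sup>2 * t)" if "\<rho> > 0"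
            using that by (simp add: 3 power2_eq_square power_add)
          have 1: "\<rho> ^ k * exp (- c * \<rho>\<^sup>2 * t) \<le> \<rho> ^ k" if "\<rho> > 0"
            using that c t by (simp add: mult_left_le)
          have 2: "\<rho> ^ k * exp (- c * \<rho>\<^sup>2 * t) \<le> ?K / t ^ n * (1 / \<rho> ^ Suc (Suc (n + 1)))" if "\<rho> > 0"
          proof -
            have "exp (- (c * \<rho>\<^sup>2 * t)) \<le> fact n / (c * \<rho>\<^sup>2 * t) ^ n"
              using that c t by (intro exp_minus_le_inverse_power) auto
            then have "\<rho> ^ k * exp (- c * \<rho>\<^sup>2 * t) \<le> \<rho> ^ k * (fact n / (c * \<rho>\<^sup>2 * t) ^ n)"
              using that by (intro mult_left_mono) auto
            also have "\<dots> = ?K / t ^ n * (\<rho> ^ k / (\<rho>\<^sup>2) ^ n)" by (simp add: power_mult_distrib mult_ac)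
            also have "\<rho> ^ k / (\<rho>\<^sup>2) ^ n = 1 / \<rho> ^ Suc (Suc (n + 1))"
            proof -
              have "(\<rho>\<^sup>2) ^ n = \<rho> ^ k * \<rho> ^ Suc (Suc (n + 1))"
                unfolding power_mult[symmetric] power_add[symmetric] by (rule arg_cong[of _ _ "(^) \<rho>"]) (simp add: 3)
              then show ?thesis using that by simp
            qed
            finally show ?thesis .
          qed
          show "ennreal (\<rho> ^ (n - 1) * (exp (- c * \<rho>\<^sup>2 * t) / \<rho>\<^sup>2)) * indicator {1 / t<..1} \<rho> \<le>
            ennreal (\<rho> ^ k) * indicator {0..d} \<rho> + ennreal (?K / t ^ n) * (ennreal (1 / \<rho> ^ Suc (Suc (n + 1))) * indicator {d..} \<rho>)"
          proof (cases "\<rho> \<in> {1 / t<..1}")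
            case True
            then have p: "\<rho> > 0" using pos by simp
            show ?thesis
            proof (cases "\<rho> \<le> d")
              case True
              then show ?thesis using 1[OF p] p e[OF p]
                by (intro add_increasing2) (auto intro!: ennreal_leI split: split_indicator)
            next
              case False
              then have "ennreal (\<rho> ^ (n - 1) * (exp (- c * \<rho>\<^sup>2 * t) / \<rho>\<^sup>2)) * indicator {1 / t<..1} \<rho> \<le>
                  ennreal (?K / t ^ n * (1 / \<rho> ^ Suc (Suc (n + 1))))"
                using 2[OF p] e[OF p] by (auto intro!: ennreal_leI split: split_indicator simp del: power_Suc)
              also have "\<dots> = ennreal (?K / t ^ n) * (ennreal (1 / \<rho> ^ Suc (Suc (n + 1))) * indicator {d..} \<rho>)"
                using False K t p c by (subst ennreal_mult) (auto simp del: power_Suc)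
              finally show ?thesis by (rule add_increasing[rotated]) simp
            qed
          qed simp
        qed
        also have "\<dots> = ennreal (d ^ (k + 1) / real (k + 1)) + ennreal (?K / t ^ n) * ennreal (1 / (real (n + 2) * d ^ (n + 2)))"
          using d nn_integral_power_Icc[of 0 d k] nn_integral_inverse_power_atLeast[of d "n + 1"]
          by (subst nn_integral_add) (simp_all add: nn_integral_cmult del: power_Suc of_nat_Suc)
        also have "\<dots> = ennreal (d ^ (k + 1) / real (k + 1) + ?K / t ^ n * (1 / (real (n + 2) * d ^ (n + 2))))"
        proof -
          have "ennreal x + ennreal y * ennreal z = ennreal (x + y * z)" if "x \<ge> 0" "y \<ge> 0" "z \<ge> 0" for x y z
            using that by (simp add: ennreal_mult)
          then show ?thesis by this (use d c t in auto)
        qed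
        also have "\<dots> \<le> ennreal (d ^ (k + 1) + ?K * d ^ (k + 1))"
        proof (intro ennreal_leI add_mono)
          have "d ^ (k + 1) / real (k + 1) \<le> d ^ (k + 1) / 1" using d by (intro divide_left_mono) auto
          then show "d ^ (k + 1) / real (k + 1) \<le> d ^ (k + 1)" by simp
          have tn: "1 / t ^ n = d ^ (k + 1) * d ^ (n + 2)"
          proof -
            have "1 / t ^ n = (d\<^sup>2) ^ n" by (simp add: d power_divide)
            also have "\<dots> = d ^ (k + 1) * d ^ (n + 2)"
              unfolding power_mult[symmetric] power_add[symmetric] by (rule arg_cong[of _ _ "(^) d"]) (simp add: 3)
            finally show ?thesis .
          qed
          have "?K / t ^ n * (1 / (real (n + 2) * d ^ (n + 2))) = ?K * (1 / t ^ n) * (1 / (real (n + 2) * d ^ (n + 2)))" by simp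
          also have "\<dots> = ?K * d ^ (k + 1) / real (n + 2)"
          proof -
            have "K * (x * e) * (1 / (N * e)) = K * x / N" if "e \<noteq> 0" for K x N e :: real
              using that by simp
            then show ?thesis unfolding tn by this (use d in simp)
          qed
          also have "\<dots> \<le> ?K * d ^ (k + 1) / 1" using d c by (intro divide_left_mono) auto
          finally show "?K / t ^ n * (1 / (real (n + 2) * d ^ (n + 2))) \<le> ?K * d ^ (k + 1)" by simp
        qed
        also have "d ^ (k + 1) + ?K * d ^ (k + 1) = (1 + ?K) * (growth_rate n t)\<^sup>2"
          by (simp add: D algebra_simps)
        finally show "(\<integral>\<^sup>+\<rho>. ennreal (\<rho> ^ (n - 1) * (exp (- c * \<rho>\<^sup>2 * t) / \<rho>\<^sup>2)) * indicator {1 / t<..1} \<rho> \<partial>lborel) \<le>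
          ennreal ((1 + ?K) * (growth_rate n t)\<^sup>2)" .
      qed
    qed
  qed
  then obtain C where C: "C > 0" and b: "\<And>t. t \<ge> 3 \<Longrightarrow> t\<^sup>2 * (1 / t) ^ n / n \<le> C * (growth_rate n t)\<^sup>2"
     "\<And>t. t \<ge> 3 \<Longrightarrow> (\<integral>\<^sup>+\<rho>. ennreal (\<rho> ^ (n - 1) * (exp (- c * \<rho>\<^sup>2 * t) / \<rho>\<^sup>2)) * indicator {1 / t<..1} \<rho> \<partial>lborel) \<le> ennreal (C * (growth_rate n t)\<^sup>2)"
    by blast
  show thesis
  proof (rule that[of "?S * (C + C)"])
    show "0 < ?S * (C + C)" using S C by simp
    fix t :: real assume t: "t \<ge> 3"
    have "(\<integral>\<^sup>+\<xi>. ennreal (low_kernel c t (norm (\<xi>::'a))) \<partial>lborel) \<le>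
        ennreal ?S * (ennreal (C * (growth_rate n t)\<^sup>2) + ennreal (C * (growth_rate n t)\<^sup>2))"
      unfolding radial[OF t] inner[OF t] first[OF t]
      by (intro mult_left_mono add_mono b(2)[OF t] ennreal_leI b(1)[OF t]) simp
    also have "\<dots> = ennreal (?S * (C + C) * (growth_rate DIM('a) t)\<^sup>2)"
      using S C by (simp add: n_def algebra_simps flip: ennreal_mult ennreal_plus)
    finally show "(\<integral>\<^sup>+\<xi>. ennreal (low_kernel c t (norm (\<xi>::'a))) \<partial>lborel) \<le> ennreal (?S * (C + C) * (growth_rate DIM('a) t)\<^sup>2)" .
  qed
qed

section \<open>Lower bounds on frequency shells\<close>

text \<open>In polar coordinates it suffices to know an antiderivative of a minorant, so oscillating
  integrals need not be evaluated exactly.\<close>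

lemma shell_integral_ge:
  fixes g F F' :: "real \<Rightarrow> real"
  assumes ab: "0 < a" "a \<le> b" and g: "continuous_on {a..b} g"
    and F: "\<And>x. x \<in> {a..b} \<Longrightarrow> (F has_real_derivative F' x) (at x)"
    and le: "\<And>x. x \<in> {a..b} \<Longrightarrow> F' x \<le> x ^ (DIM('a) - 1) * g x"
  shows "sphere_area DIM('a::euclidean_space) * (F b - F a) \<le>
    (LINT \<xi>|lborel. indicator {a..b} (norm (\<xi>::'a)) * g (norm \<xi>))"
proof -
  let ?h = "\<lambda>\<rho>. indicator {a..b} \<rho> * g \<rho>" and ?n = "DIM('a) - 1"
  have [measurable]: "?h \<in> borel_measurable borel"
    using borel_measurable_continuous_on_indicator[OF _ g] by simp
  have c: "continuous_on {a..b} (\<lambda>x. x ^ ?n * g x)"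
    by (intro continuous_intros g)
  have si: "set_integrable lborel {a..b} (\<lambda>x. x ^ ?n * g x)"
    by (rule borel_integrable_atLeastAtMost'[OF c])
  have eq: "indicator {0..} x *\<^sub>R (x ^ ?n * ?h x) = indicator {a..b} x *\<^sub>R (x ^ ?n * g x)" for x
    using ab by (auto split: split_indicator)
  have "(LINT \<xi>|lborel. ?h (norm (\<xi>::'a))) = sphere_area DIM('a) * (LINT \<rho>:{0..}|lborel. \<rho> ^ ?n * ?h \<rho>)"
    by (rule integral_radial) measurable
  also have "(LINT \<rho>:{0..}|lborel. \<rho> ^ ?n * ?h \<rho>) = (LINT \<rho>:{a..b}|lborel. \<rho> ^ ?n * g \<rho>)"
    unfolding set_lebesgue_integral_def eq ..
  also have "\<dots> = integral {a..b} (\<lambda>x. x ^ ?n * g x)"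
    by (rule set_borel_integral_eq_integral(2)[OF si])
  finally have "(LINT \<xi>|lborel. ?h (norm (\<xi>::'a))) = sphere_area DIM('a) * integral {a..b} (\<lambda>x. x ^ ?n * g x)" .
  moreover have "F b - F a \<le> integral {a..b} (\<lambda>x. x ^ ?n * g x)"
  proof (rule has_integral_le)
    show "(F' has_integral F b - F a) {a..b}"
      using ab F by (intro fundamental_theorem_of_calculus)
        (auto simp flip: has_real_derivative_iff_has_vector_derivative intro: has_field_derivative_at_within)
    show "((\<lambda>x. x ^ ?n * g x) has_integral integral {a..b} (\<lambda>x. x ^ ?n * g x)) {a..b}"
      using c by (intro integrable_integral integrable_continuous_interval)
  qed (rule le)
  ultimately show "sphere_area DIM('a) * (F b - F a) \<le> (LINT \<xi>|lborel. ?h (norm (\<xi>::'a)))"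
    by (simp add: sphere_area_pos mult_left_mono less_imp_le)
qed

text \<open>What remains of the squared solution relative to the square of
  \<open>a1 + \<tau> * a2\<close>: the free wave minus the square of the time-dependent error of
  \<open>solution_profile\<close>, after division by the squared frequency.\<close>

definition wave_profile :: "real \<Rightarrow> real \<Rightarrow> real \<Rightarrow> real \<Rightarrow> real \<Rightarrow> real" where
  "wave_profile b k1 k2 t \<rho> = k1 * (sin (b * \<rho> * t))\<^sup>2 / \<rho>\<^sup>2 - k2 * \<rho>\<^sup>2 * t\<^sup>2"

lemma continuous_on_wave_profile: "0 < x \<Longrightarrow> continuous_on {x..z} (wave_profile b k1 k2 t)"
  unfolding wave_profile_def[abs_def] by (intro continuous_intros) auto

lemma sin_square_double: "(sin x)\<^sup>2 = 1 / 2 - cos (2 * x) / 2" for x :: real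
  using cos_double_sin[of x] by (simp add: field_simps)

text \<open>The power weight is replaced by a lower bound \<open>w\<close>. The mean value 1 / 2 of
  the squared sine contributes \<open>R / 2\<close>, and \<open>b * R * t >= 2\<close> limits the
  oscillating remainder to \<open>R / 4\<close>.\<close>

lemma dyadic_shell_integral_ge:
  assumes pos: "b > 0" "k1 > 0" "k2 \<ge> 0" "R > 0" "t > 0" "b * R * t \<ge> 2" and w: "w \<ge> 0"
    and le: "\<And>x. x \<in> {R..2 * R} \<Longrightarrow> w \<le> x ^ (DIM('a::euclidean_space) - 1) / x\<^sup>2"
  shows "sphere_area DIM('a) * (k1 * w * R / 4 - k2 * t\<^sup>2 * (2 * R) ^ (DIM('a) + 2)) \<le>
    (LINT \<xi>|lborel. indicator {R..2 * R} (norm (\<xi>::'a)) * wave_profile b k1 k2 t (norm \<xi>))"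
proof -
  define n where "n = DIM('a)"
  have n: "n \<ge> 1" by (simp add: n_def Suc_leI)
  let ?F = "\<lambda>x. k1 * w * (x / 2 - sin (2 * (b * x * t)) / (4 * (b * t))) - k2 * t\<^sup>2 * (x ^ Suc (n + 1) / real (Suc (n + 1)))"
  let ?F' = "\<lambda>x. k1 * w * (sin (b * x * t))\<^sup>2 - k2 * t\<^sup>2 * x ^ (n + 1)"
  have "sphere_area DIM('a) * (?F (2 * R) - ?F R) \<le>
      (LINT \<xi>|lborel. indicator {R..2 * R} (norm (\<xi>::'a)) * wave_profile b k1 k2 t (norm \<xi>))"
  proof (rule shell_integral_ge)
    show "0 < R" "R \<le> 2 * R" using pos by auto
    show "continuous_on {R..2 * R} (wave_profile b k1 k2 t)"
      using pos by (intro continuous_on_wave_profile)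
    fix x assume x: "x \<in> {R..2 * R}"
    have p: "((\<lambda>x. x ^ Suc (n + 1) / real (Suc (n + 1))) has_real_derivative x ^ (n + 1)) (at x)"
      by (auto intro!: derivative_eq_intros simp del: power_Suc of_nat_Suc)
    show "(?F has_real_derivative ?F' x) (at x)"
      unfolding sin_square_double using pos
      by (auto intro!: derivative_eq_intros p simp: field_simps simp del: power_Suc of_nat_Suc)
    have x0: "x > 0" using x pos by auto
    have "k1 * (sin (b * x * t))\<^sup>2 * w \<le> k1 * (sin (b * x * t))\<^sup>2 * (x ^ (n - 1) / x\<^sup>2)"
      using pos le[OF x] by (intro mult_left_mono) (auto simp: n_def)
    then have A: "k1 * w * (sin (b * x * t))\<^sup>2 \<le> x ^ (n - 1) * (k1 * (sin (b * x * t))\<^sup>2 / x\<^sup>2)"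
      by (simp add: mult_ac)
    have B: "x ^ (n - 1) * (k2 * x\<^sup>2 * t\<^sup>2) = k2 * t\<^sup>2 * x ^ (n + 1)"
    proof -
      have "x ^ (n + 1) = x ^ (n - 1) * x\<^sup>2"
        unfolding power_add[symmetric] using n by (intro arg_cong[of _ _ "(^) x"]) simp
      then show ?thesis by simp
    qed
    have "k1 * w * (sin (b * x * t))\<^sup>2 - k2 * t\<^sup>2 * x ^ (n + 1) \<le>
        x ^ (n - 1) * (k1 * (sin (b * x * t))\<^sup>2 / x\<^sup>2) - x ^ (n - 1) * (k2 * x\<^sup>2 * t\<^sup>2)"
      unfolding B by (rule diff_right_mono[OF A])
    then show "?F' x \<le> x ^ (DIM('a) - 1) * wave_profile b k1 k2 t x"
      by (simp add: wave_profile_def n_def right_diff_distrib)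
  qed
  moreover have "k1 * w * R / 4 - k2 * t\<^sup>2 * (2 * R) ^ (n + 2) \<le> ?F (2 * R) - ?F R"
  proof -
    have "1 / (2 * (b * t)) \<le> R / 4" using pos by (simp add: field_simps)
    moreover have "- (1 / (4 * (b * t))) \<le> - (sin (2 * (b * (2 * R) * t)) / (4 * (b * t)))"
      "- (1 / (4 * (b * t))) \<le> sin (2 * (b * R * t)) / (4 * (b * t))"
      using pos sin_le_one[of "2 * (b * (2 * R) * t)"] sin_ge_minus_one[of "2 * (b * R * t)"] by (auto simp: field_simps)
    moreover have "1 / (2 * (b * t)) = 1 / (4 * (b * t)) + 1 / (4 * (b * t))" by simp
    ultimately have "R / 4 \<le> (2 * R / 2 - sin (2 * (b * (2 * R) * t)) / (4 * (b * t))) - (R / 2 - sin (2 * (b * R * t)) / (4 * (b * t)))"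
      by linarith
    then have fA: "k1 * w * R / 4 \<le> k1 * w * ((2 * R / 2 - sin (2 * (b * (2 * R) * t)) / (4 * (b * t))) - (R / 2 - sin (2 * (b * R * t)) / (4 * (b * t))))"
      unfolding times_divide_eq_right[symmetric, of "k1 * w" R 4] using pos w by (intro mult_left_mono) auto
    have fB: "k2 * t\<^sup>2 * ((2 * R) ^ Suc (n + 1) / real (Suc (n + 1)) - R ^ Suc (n + 1) / real (Suc (n + 1))) \<le> k2 * t\<^sup>2 * (2 * R) ^ (n + 2)"
    proof (rule mult_left_mono)
      have "(2 * R) ^ Suc (n + 1) / real (Suc (n + 1)) \<le> (2 * R) ^ Suc (n + 1) / 1"
        using pos by (intro divide_left_mono) auto
      moreover have "0 \<le> R ^ Suc (n + 1) / real (Suc (n + 1))" using pos by simp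
      ultimately show "(2 * R) ^ Suc (n + 1) / real (Suc (n + 1)) - R ^ Suc (n + 1) / real (Suc (n + 1)) \<le> (2 * R) ^ (n + 2)"
        by simp
    qed (use pos in auto)
    have gen: "A - B \<le> (a * X2 - c * Y2) - (a * X1 - c * Y1)"
      if "A \<le> a * (X2 - X1)" "c * (Y2 - Y1) \<le> B" for A B a c X1 X2 Y1 Y2 :: real
      using that by (simp add: right_diff_distrib)
    show ?thesis by (rule gen[OF fA fB])
  qed
  ultimately show ?thesis
    using sphere_area_pos[of n] n by (simp add: n_def) (smt (verit) mult_left_mono)
qed

text \<open>The side conditions prepare \<open>solution_L2_lower\<close>. \<open>B\<close> tending
  to 0 keeps the transformed data close to their value at frequency 0,
  \<open>(B t)\<^sup>2 * t <= 1\<close> bounds the factor \<open>1 + r * t\<close>, and the limit of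
  the quotient makes a bounded error on the shell negligible.\<close>

lemma wave_profile_integral_ge:
  assumes pos: "b > 0" "k1 > 0" "k2 \<ge> 0"
  obtains c A B where "c > 0" "(B \<longlongrightarrow> 0) at_top" "((\<lambda>t. B t ^ DIM('a) / (growth_rate DIM('a) t)\<^sup>2) \<longlongrightarrow> 0) at_top"
    "\<forall>\<^sub>F t in at_top. 0 < A t \<and> A t \<le> B t \<and> (B t)\<^sup>2 * t \<le> 1 \<and> c * (growth_rate DIM('a) t)\<^sup>2 \<le>
      (LINT \<xi>|lborel. indicator {A t..B t} (norm (\<xi>::'a::euclidean_space)) * wave_profile b k1 k2 t (norm \<xi>))"
proof -
  define n where "n = DIM('a)"
  have n: "n \<ge> 1" by (simp add: n_def Suc_leI)
  let ?S = "sphere_area DIM('a)"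
  have S: "?S > 0" by (simp add: sphere_area_pos)
  consider "n = 1" | "n = 2" | k where "n = k + 3"
    using n by (metis One_nat_def Suc_1 add.commute le_Suc_ex le_antisym not_less_eq_eq numeral_3_eq_3)
  then show thesis
  proof cases
    case 1
    \<comment> \<open>One shell at frequency of order 1 / t, the smallest with
      \<open>b * R * t >= 2\<close>. The summands of \<open>T\<close> make the subtracted term at
      most half of the main one and ensure \<open>(2 * R)\<^sup>2 * t <= 1\<close>.\<close>
    let ?R = "\<lambda>t. 2 / b / t"
    define T where "T = 1 + 64 * 64 * k2 / (k1 * b ^ 4) + 16 / b\<^sup>2"
    show thesis
    proof (rule that[of "?S * (k1 * b / 64)" "\<lambda>t. 2 * ?R t" ?R])
      show "0 < ?S * (k1 * b / 64)" using S pos by simp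
      have "((\<lambda>t. 4 / b * inverse t) \<longlongrightarrow> 4 / b * 0) at_top"
        by (intro tendsto_intros tendsto_inverse_0_at_top filterlim_ident)
      then show lim: "((\<lambda>t. 2 * ?R t) \<longlongrightarrow> 0) at_top" by (simp add: field_simps)
      have "((\<lambda>t. 4 / b * inverse t * inverse t) \<longlongrightarrow> 4 / b * 0 * 0) at_top"
        by (intro tendsto_intros tendsto_inverse_0_at_top filterlim_ident)
      then have "((\<lambda>t. 4 / b * inverse t * inverse t) \<longlongrightarrow> 0) at_top" by simp
      moreover have "\<forall>\<^sub>F t in at_top. 4 / b * inverse t * inverse t = (2 * ?R t) ^ DIM('a) / (growth_rate DIM('a) t)\<^sup>2"
        using eventually_ge_at_top[of 1]
        by eventually_elim (use 1 in \<open>simp add: growth_rate_power2 n_def field_simps\<close>)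
      ultimately show "((\<lambda>t. (2 * ?R t) ^ DIM('a) / (growth_rate DIM('a) t)\<^sup>2) \<longlongrightarrow> 0) at_top"
        by (rule Lim_transform_eventually)
      show "\<forall>\<^sub>F t in at_top. 0 < ?R t \<and> ?R t \<le> 2 * ?R t \<and> (2 * ?R t)\<^sup>2 * t \<le> 1 \<and> ?S * (k1 * b / 64) * (growth_rate DIM('a) t)\<^sup>2 \<le>
          (LINT \<xi>|lborel. indicator {?R t..2 * ?R t} (norm (\<xi>::'a)) * wave_profile b k1 k2 t (norm \<xi>))"
        using eventually_ge_at_top[of T]
      proof eventually_elim
        case (elim t)
        have "T \<ge> 1" "T \<ge> 64 * 64 * k2 / (k1 * b ^ 4)" "T \<ge> 16 / b\<^sup>2" using pos by (auto simp: T_def)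
        then have t: "t \<ge> 1" "t \<ge> 64 * 64 * k2 / (k1 * b ^ 4)" "t \<ge> 16 / b\<^sup>2" using elim by auto
        have R: "?R t > 0" using t pos by simp
        have i1: "?S * (k1 * (1 / (2 * ?R t)\<^sup>2) * ?R t / 4 - k2 * t\<^sup>2 * (2 * ?R t) ^ (DIM('a) + 2)) \<le>
           (LINT \<xi>|lborel. indicator {?R t..2 * ?R t} (norm (\<xi>::'a)) * wave_profile b k1 k2 t (norm \<xi>))"
        proof (rule dyadic_shell_integral_ge[OF pos R])
          fix x assume x: "x \<in> {?R t..2 * ?R t}"
          then have "x > 0" using R by (meson atLeastAtMost_iff less_le_trans)
          moreover have "x\<^sup>2 \<le> (2 * ?R t)\<^sup>2" using x R by (intro power_mono) auto
          ultimately have "1 / (2 * ?R t)\<^sup>2 \<le> 1 / x\<^sup>2"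
            by (intro divide_left_mono) (auto intro!: mult_pos_pos simp: R)
          then show "1 / (2 * ?R t)\<^sup>2 \<le> x ^ (DIM('a) - 1) / x\<^sup>2" using 1 by (simp add: n_def)
        qed (use t pos in auto)
        have "k1 * b / 64 * t \<le> k1 * (1 / (2 * ?R t)\<^sup>2) * ?R t / 4 - k2 * t\<^sup>2 * (2 * ?R t) ^ (DIM('a) + 2)"
        proof -
          have e1: "k1 * (1 / (2 * ?R t)\<^sup>2) * ?R t / 4 = k1 * b / 64 * t + k1 * b / 64 * t"
            using t pos by (simp add: field_simps power2_eq_square)
          have e2: "k2 * t\<^sup>2 * (2 * ?R t) ^ (DIM('a) + 2) = 64 * k2 / (b ^ 3 * t)"
            using t pos 1 by (simp add: n_def field_simps power2_eq_square power3_eq_cube)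
          have e3: "64 * k2 / (b ^ 3 * t) \<le> k1 * b / 64 * t"
          proof -
            have "64 * k2 / b ^ 3 = k1 * b / 64 * (64 * 64 * k2 / (k1 * b ^ 4))"
              using pos by (simp add: field_simps power3_eq_cube power4_eq_xxxx)
            also have "\<dots> \<le> k1 * b / 64 * t" using t pos by (intro mult_left_mono) auto
            also have "\<dots> \<le> k1 * b / 64 * t * t" using mult_left_mono[OF t(1), of "k1 * b / 64 * t"] t pos by simp
            finally have "64 * k2 / b ^ 3 / t \<le> k1 * b / 64 * t * t / t" using t by (intro divide_right_mono) auto
            then show ?thesis using t by simp
          qed
          have "Q \<le> Q + Q - Y" if "Y \<le> Q" for Q Y :: real using that by simp
          then show ?thesis unfolding e1 e2 using e3 .
        qed
        then have i2: "?S * (k1 * b / 64 * t) \<le> ?S * (k1 * (1 / (2 * ?R t)\<^sup>2) * ?R t / 4 - k2 * t\<^sup>2 * (2 * ?R t) ^ (DIM('a) + 2))"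
          using S by (intro mult_left_mono) auto
        have D: "(growth_rate DIM('a) t)\<^sup>2 = t" using t 1 by (simp add: growth_rate_power2 n_def)
        show ?case
        proof (intro conjI)
          show "(2 * ?R t)\<^sup>2 * t \<le> 1" using t pos by (simp add: field_simps power2_eq_square)
          show "?S * (k1 * b / 64) * (growth_rate DIM('a) t)\<^sup>2 \<le>
            (LINT \<xi>|lborel. indicator {?R t..2 * ?R t} (norm (\<xi>::'a)) * wave_profile b k1 k2 t (norm \<xi>))"
            unfolding D mult.assoc[of ?S] by (rule order_trans[OF i2 i1])
        qed (use R in linarith)+
      qed
    qed
  next
    case 2
    \<comment> \<open>Here all dyadic shells between 1 / t and \<open>1 / sqrt t\<close> contribute
      alike, so the whole range is integrated to obtain the logarithm. \<open>T\<close> makes the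
      constant terms at most half of the main term \<open>k1 / 4 * ln t\<close>.\<close>
    define T where "T = exp (1 + 8 * (1 / (2 * b) + k2 / (4 * k1)))"
    show thesis
    proof (rule that[of "?S * (k1 / 8)" "\<lambda>t. 1 / sqrt t" "\<lambda>t. 1 / t"])
      show "0 < ?S * (k1 / 8)" using S pos by simp
      have "((\<lambda>t. inverse (sqrt t)) \<longlongrightarrow> 0) at_top"
        by (intro tendsto_inverse_0_at_top sqrt_at_top)
      then show "((\<lambda>t. 1 / sqrt t) \<longlongrightarrow> 0) at_top" by (simp add: field_simps)
      have "((\<lambda>t::real. inverse t * inverse (ln t)) \<longlongrightarrow> 0 * 0) at_top"
        by (intro tendsto_intros tendsto_inverse_0_at_top filterlim_ident ln_at_top)
      then have "((\<lambda>t::real. inverse t * inverse (ln t)) \<longlongrightarrow> 0) at_top" by simp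
      moreover have "\<forall>\<^sub>F t in at_top. inverse t * inverse (ln t) = (1 / sqrt t) ^ DIM('a) / (growth_rate DIM('a) t)\<^sup>2"
        using eventually_ge_at_top[of 1]
        by eventually_elim (use 2 in \<open>simp add: growth_rate_power2 n_def field_simps\<close>)
      ultimately show "((\<lambda>t. (1 / sqrt t) ^ DIM('a) / (growth_rate DIM('a) t)\<^sup>2) \<longlongrightarrow> 0) at_top"
        by (rule Lim_transform_eventually)
      show "\<forall>\<^sub>F t in at_top. 0 < 1 / t \<and> 1 / t \<le> 1 / sqrt t \<and> (1 / sqrt t)\<^sup>2 * t \<le> 1 \<and> ?S * (k1 / 8) * (growth_rate DIM('a) t)\<^sup>2 \<le>
          (LINT \<xi>|lborel. indicator {1 / t..1 / sqrt t} (norm (\<xi>::'a)) * wave_profile b k1 k2 t (norm \<xi>))"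
        using eventually_ge_at_top[of T]
      proof eventually_elim
        case (elim t)
        have "T \<ge> 1" using pos by (simp add: T_def)
        then have t: "t \<ge> 1" using elim by simp
        have lnt: "ln t \<ge> 8 * (1 / (2 * b) + k2 / (4 * k1))"
        proof -
          have "ln T \<le> ln t" using elim \<open>T \<ge> 1\<close> by simp
          then show ?thesis by (simp add: T_def)
        qed
        have st: "sqrt t \<ge> 1" "sqrt t \<le> t" using t by (auto simp: real_sqrt_le_iff intro!: real_le_lsqrt self_le_power)
        \<comment> \<open>Not an exact antiderivative: integrating the cosine by parts leaves a
          remainder of size \<open>1 / (4 * b * x\<^sup>2 * t)\<close>, and the summand
          \<open>1 / (4 * b * x * t)\<close> is added so that the remainder has the favourable
          sign.\<close>
        let ?F = "\<lambda>x. k1 * (ln x / 2 - sin (2 * (b * x * t)) / (4 * b * x * t) + 1 / (4 * b * x * t)) - k2 * t\<^sup>2 * (x ^ 4 / 4)"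
        let ?F' = "\<lambda>x. k1 * (1 / (2 * x) - (cos (2 * (b * x * t)) / (2 * x) - sin (2 * (b * x * t)) / (4 * b * x\<^sup>2 * t)) - 1 / (4 * b * x\<^sup>2 * t)) - k2 * t\<^sup>2 * x ^ 3"
        have i1: "?S * (?F (1 / sqrt t) - ?F (1 / t)) \<le>
          (LINT \<xi>|lborel. indicator {1 / t..1 / sqrt t} (norm (\<xi>::'a)) * wave_profile b k1 k2 t (norm \<xi>))"
        proof (rule shell_integral_ge)
          show "0 < 1 / t" "1 / t \<le> 1 / sqrt t" using t st by (auto intro!: divide_left_mono mult_pos_pos)
          then show "continuous_on {1 / t..1 / sqrt t} (wave_profile b k1 k2 t)"
            by (intro continuous_on_wave_profile)
          fix x assume x: "x \<in> {1 / t..1 / sqrt t}"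
          then have x0: "x > 0" using \<open>0 < 1 / t\<close> by (smt (verit) atLeastAtMost_iff)
          show "(?F has_real_derivative ?F' x) (at x)"
            using x0 t pos by (auto intro!: derivative_eq_intros simp: field_simps power2_eq_square power3_eq_cube power4_eq_xxxx)
          have "sin (2 * (b * x * t)) / (4 * b * x\<^sup>2 * t) - 1 / (4 * b * x\<^sup>2 * t) \<le> 0"
            using x0 t pos by (simp add: field_simps)
          then have "1 / (2 * x) - (cos (2 * (b * x * t)) / (2 * x) - sin (2 * (b * x * t)) / (4 * b * x\<^sup>2 * t)) - 1 / (4 * b * x\<^sup>2 * t)
              \<le> 1 / (2 * x) - cos (2 * (b * x * t)) / (2 * x)" by linarith
          also have "\<dots> = x * ((sin (b * x * t))\<^sup>2 / x\<^sup>2)"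
            unfolding sin_square_double using x0 by (simp add: field_simps power2_eq_square)
          finally have "?F' x \<le> k1 * (x * ((sin (b * x * t))\<^sup>2 / x\<^sup>2)) - k2 * t\<^sup>2 * x ^ 3"
            using pos by (intro diff_right_mono mult_left_mono) auto
          also have "\<dots> = x ^ (DIM('a) - 1) * wave_profile b k1 k2 t x"
            using 2 by (simp add: wave_profile_def n_def right_diff_distrib power2_eq_square power3_eq_cube)
          finally show "?F' x \<le> x ^ (DIM('a) - 1) * wave_profile b k1 k2 t x" .
        qed
        have "k1 / 8 * ln t \<le> ?F (1 / sqrt t) - ?F (1 / t)"
        proof -
          define h where "h = 1 / (4 * b * (1 / sqrt t) * t)"
          have h: "h > 0" using t pos by (simp add: h_def)
          have "sin (2 * (b * (1 / sqrt t) * t)) * h \<le> 1 * h" using h by (intro mult_right_mono) auto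
          then have 1: "sin (2 * (b * (1 / sqrt t) * t)) / (4 * b * (1 / sqrt t) * t) \<le> h" by (simp add: h_def)
          have 2: "- (sin (2 * (b * (1 / t) * t)) / (4 * b * (1 / t) * t)) \<le> 1 / (4 * b)"
            using t pos sin_ge_minus_one[of "2 * b"] by (simp add: field_simps)
          have 3: "1 / (4 * b * (1 / t) * t) = 1 / (4 * b)" using t by simp
          have 4: "ln (1 / sqrt t) = - (ln t / 2)" "ln (1 / t) = - ln t" using t by (simp_all add: ln_div ln_sqrt)
          have 5: "t\<^sup>2 * ((1 / sqrt t) ^ 4 / 4) = 1 / 4"
          proof -
            have "(sqrt t) ^ 4 = t\<^sup>2" using t by (metis power2_eq_square power4_eq_xxxx real_sqrt_pow2 mult.assoc order_trans zero_le_one)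
            then show ?thesis using t by (simp add: power_divide)
          qed
          have 6: "ln t / 4 - 1 / (2 * b) \<le> (ln (1 / sqrt t) / 2 - sin (2 * (b * (1 / sqrt t) * t)) / (4 * b * (1 / sqrt t) * t) + 1 / (4 * b * (1 / sqrt t) * t))
              - (ln (1 / t) / 2 - sin (2 * (b * (1 / t) * t)) / (4 * b * (1 / t) * t) + 1 / (4 * b * (1 / t) * t))"
          proof -
            have "L / 4 - e' \<le> (- (L / 2) / 2 - s1 + h) - (- L / 2 - s2 + e)"
              if "s1 \<le> h" "- s2 \<le> e" "e' = e + e" for L e e' s1 s2
              using that by simp
            from this[OF 1 2] show ?thesis unfolding 4 3 h_def[symmetric] by simp
          qed
          have "k1 / 8 * ln t = k1 * (ln t / 4 - ln t / 8)" by simp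
          also have "\<dots> \<le> k1 * (ln t / 4 - (1 / (2 * b) + k2 / (4 * k1)))"
            using lnt pos by (intro mult_left_mono) auto
          also have "\<dots> = k1 * (ln t / 4 - 1 / (2 * b)) - k2 / 4" using pos by (simp add: field_simps)
          also have "\<dots> \<le> k1 * ((ln (1 / sqrt t) / 2 - sin (2 * (b * (1 / sqrt t) * t)) / (4 * b * (1 / sqrt t) * t) + 1 / (4 * b * (1 / sqrt t) * t))
              - (ln (1 / t) / 2 - sin (2 * (b * (1 / t) * t)) / (4 * b * (1 / t) * t) + 1 / (4 * b * (1 / t) * t))) - k2 * (t\<^sup>2 * ((1 / sqrt t) ^ 4 / 4))"
            unfolding 5 using pos by (intro diff_mono mult_left_mono 6) auto
          also have "\<dots> \<le> ?F (1 / sqrt t) - ?F (1 / t)"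
          proof -
            have "0 \<le> k2 * t\<^sup>2 * ((1 / t) ^ 4 / 4)" using pos by simp
            then show ?thesis by (simp only: right_diff_distrib mult.assoc)
          qed
          finally show ?thesis .
        qed
        then have i2: "?S * (k1 / 8 * ln t) \<le> ?S * (?F (1 / sqrt t) - ?F (1 / t))"
          using S by (intro mult_left_mono) auto
        have D: "(growth_rate DIM('a) t)\<^sup>2 = ln t" using t 2 by (simp add: growth_rate_power2 n_def)
        show ?case
        proof (intro conjI)
          show "0 < 1 / t" "1 / t \<le> 1 / sqrt t" using t st by (auto intro!: divide_left_mono mult_pos_pos)
          show "(1 / sqrt t)\<^sup>2 * t \<le> 1" using t by (simp add: power_divide)
          show "?S * (k1 / 8) * (growth_rate DIM('a) t)\<^sup>2 \<le>
            (LINT \<xi>|lborel. indicator {1 / t..1 / sqrt t} (norm (\<xi>::'a)) * wave_profile b k1 k2 t (norm \<xi>))"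
            unfolding D mult.assoc[of ?S] by (rule order_trans[OF i2 i1])
        qed
      qed
    qed
  next
    case 3
    \<comment> \<open>At frequencies of order \<open>1 / sqrt t\<close> the main and the subtracted
      term have the same order in \<open>t\<close>, but the latter has an additional factor
      \<open>\<epsilon> ^ 4\<close>, so a small \<epsilon> decides. The bound 1 / 2 for \<epsilon>
      gives \<open>(2 * R)\<^sup>2 * t <= 1\<close>.\<close>
    define K where "K = k2 * 2 ^ (n + 2)"
    define \<epsilon> where "\<epsilon> = min (1 / 2) (k1 / (8 * (K + 1)))"
    have K: "K \<ge> 0" using pos by (simp add: K_def)
    have \<epsilon>: "\<epsilon> > 0" "\<epsilon> \<le> 1 / 2" "\<epsilon> \<le> k1 / (8 * (K + 1))"
      unfolding \<epsilon>_def using pos K by (auto simp only: min_less_iff_conj min.cobounded1 min.cobounded2) simp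
    have \<epsilon>4: "K * \<epsilon> ^ 4 \<le> k1 / 8"
    proof -
      have "\<epsilon> ^ 4 \<le> \<epsilon> ^ 1" using \<epsilon> by (intro power_decreasing) auto
      then have "K * \<epsilon> ^ 4 \<le> (K + 1) * \<epsilon>" using K \<epsilon> by (intro mult_mono) auto
      also have "\<dots> \<le> (K + 1) * (k1 / (8 * (K + 1)))" using K \<epsilon> by (intro mult_left_mono) auto
      also have "\<dots> = k1 / 8" using K by (simp add: field_simps)
      finally show ?thesis .
    qed
    let ?R = "\<lambda>t. \<epsilon> / sqrt t"
    have D: "(growth_rate DIM('a) t)\<^sup>2 = (1 / sqrt t) ^ (k + 1)" if "t \<ge> 1" for t
    proof -
      have "(1 / sqrt t) ^ (k + 1) = t powr (- (real (k + 1) / 2))"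
        using that by (intro inverse_sqrt_power) simp
      also have "- (real (k + 1) / 2) = 1 - real n / 2" by (simp add: 3 field_simps)
      finally show ?thesis using that 3 by (simp add: growth_rate_power2 n_def)
    qed
    define T where "T = 1 + (2 / (b * \<epsilon>))\<^sup>2"
    show thesis
    proof (rule that[of "?S * (k1 / 8 * \<epsilon> ^ (k + 1))" "\<lambda>t. 2 * ?R t" ?R])
      show "0 < ?S * (k1 / 8 * \<epsilon> ^ (k + 1))" using S pos \<epsilon> by simp
      have "((\<lambda>t. 2 * \<epsilon> * inverse (sqrt t)) \<longlongrightarrow> 2 * \<epsilon> * 0) at_top"
        by (intro tendsto_intros tendsto_inverse_0_at_top sqrt_at_top)
      then show "((\<lambda>t. 2 * ?R t) \<longlongrightarrow> 0) at_top" by (simp add: field_simps)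
      have "((\<lambda>t. (2 * \<epsilon>) ^ n * inverse t) \<longlongrightarrow> (2 * \<epsilon>) ^ n * 0) at_top"
        by (intro tendsto_intros tendsto_inverse_0_at_top filterlim_ident)
      then have "((\<lambda>t. (2 * \<epsilon>) ^ n * inverse t) \<longlongrightarrow> 0) at_top" by simp
      moreover have "\<forall>\<^sub>F t in at_top. (2 * \<epsilon>) ^ n * inverse t = (2 * ?R t) ^ DIM('a) / (growth_rate DIM('a) t)\<^sup>2"
        using eventually_ge_at_top[of 1]
      proof eventually_elim
        case (elim t)
        define d where "d = 1 / sqrt t"
        have d: "d > 0" "d\<^sup>2 = inverse t" using elim by (auto simp: d_def power_divide field_simps)
        have "(2 * ?R t) ^ n = (2 * \<epsilon>) ^ n * (d ^ (k + 1) * d\<^sup>2)"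
          by (simp add: d_def 3 power_mult_distrib power_divide power_add power2_eq_square power3_eq_cube)
        then show ?case using d unfolding D[OF elim] unfolding n_def[symmetric] d_def[symmetric] by simp
      qed
      ultimately show "((\<lambda>t. (2 * ?R t) ^ DIM('a) / (growth_rate DIM('a) t)\<^sup>2) \<longlongrightarrow> 0) at_top"
        by (rule Lim_transform_eventually)
      show "\<forall>\<^sub>F t in at_top. 0 < ?R t \<and> ?R t \<le> 2 * ?R t \<and> (2 * ?R t)\<^sup>2 * t \<le> 1 \<and> ?S * (k1 / 8 * \<epsilon> ^ (k + 1)) * (growth_rate DIM('a) t)\<^sup>2 \<le>
          (LINT \<xi>|lborel. indicator {?R t..2 * ?R t} (norm (\<xi>::'a)) * wave_profile b k1 k2 t (norm \<xi>))"
        using eventually_ge_at_top[of T]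
      proof eventually_elim
        case (elim t)
        have "T \<ge> 1" "T \<ge> (2 / (b * \<epsilon>))\<^sup>2" by (auto simp: T_def)
        then have t: "t \<ge> 1" "t \<ge> (2 / (b * \<epsilon>))\<^sup>2" using elim by auto
        have st: "sqrt t \<ge> 2 / (b * \<epsilon>)" using t by (simp add: real_le_rsqrt)
        have R: "?R t > 0" using t \<epsilon> by simp
        have R2: "(?R t)\<^sup>2 * t = \<epsilon>\<^sup>2" using t by (simp add: power_divide)
        have i1: "?S * (k1 * ?R t ^ k * ?R t / 4 - k2 * t\<^sup>2 * (2 * ?R t) ^ (DIM('a) + 2)) \<le>
           (LINT \<xi>|lborel. indicator {?R t..2 * ?R t} (norm (\<xi>::'a)) * wave_profile b k1 k2 t (norm \<xi>))"
        proof (rule dyadic_shell_integral_ge[OF pos R])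
          have "b * ?R t * t = b * \<epsilon> * (t / sqrt t)" by simp
          also have "t / sqrt t = sqrt t" using t by (simp add: real_div_sqrt)
          finally show "2 \<le> b * ?R t * t" using st pos \<epsilon> by (simp add: field_simps)
          fix x assume x: "x \<in> {?R t..2 * ?R t}"
          then have "x > 0" using R by (meson atLeastAtMost_iff less_le_trans)
          moreover have "?R t ^ k \<le> x ^ k" using x R by (intro power_mono) auto
          ultimately show "?R t ^ k \<le> x ^ (DIM('a) - 1) / x\<^sup>2"
            using 3 by (simp add: n_def[symmetric] power_add power2_eq_square)
        qed (use t R in auto)
        have "k1 / 8 * ?R t ^ (k + 1) \<le> k1 * ?R t ^ k * ?R t / 4 - k2 * t\<^sup>2 * (2 * ?R t) ^ (DIM('a) + 2)"
        proof -
          have "k2 * t\<^sup>2 * (2 * ?R t) ^ (DIM('a) + 2) = K * ((?R t)\<^sup>2 * t)\<^sup>2 * ?R t ^ (k + 1)"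
          proof -
            have "?R t ^ (n + 2) = (?R t)\<^sup>2 * (?R t)\<^sup>2 * ?R t ^ (k + 1)"
              unfolding power_add[symmetric] by (intro arg_cong[of _ _ "(^) (?R t)"]) (simp add: 3)
            then show ?thesis
              unfolding n_def[symmetric] power_mult_distrib K_def by (simp add: power2_eq_square mult_ac)
          qed
          also have "\<dots> = K * \<epsilon> ^ 4 * ?R t ^ (k + 1)" by (simp only: R2 flip: power_mult) simp
          also have "\<dots> \<le> k1 / 8 * ?R t ^ (k + 1)" by (rule mult_right_mono[OF \<epsilon>4 zero_le_power[OF less_imp_le[OF R]]])
          finally have f: "k2 * t\<^sup>2 * (2 * ?R t) ^ (DIM('a) + 2) \<le> k1 / 8 * ?R t ^ (k + 1)" .
          have e: "k1 * ?R t ^ k * ?R t / 4 = k1 / 8 * ?R t ^ (k + 1) + k1 / 8 * ?R t ^ (k + 1)"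
            by (simp add: mult_ac)
          have "Q \<le> Q + Q - Y" if "Y \<le> Q" for Q Y :: real using that by simp
          from this[OF f] show ?thesis unfolding e .
        qed
        then have i2: "?S * (k1 / 8 * ?R t ^ (k + 1)) \<le> ?S * (k1 * ?R t ^ k * ?R t / 4 - k2 * t\<^sup>2 * (2 * ?R t) ^ (DIM('a) + 2))"
          using S by (intro mult_left_mono) auto
        have i3: "(2 * ?R t)\<^sup>2 * t \<le> 1"
        proof -
          have "(2 * ?R t)\<^sup>2 * t = 4 * \<epsilon>\<^sup>2" unfolding power_mult_distrib mult.assoc R2 by simp
          also have "\<dots> \<le> 4 * (1 / 2)\<^sup>2" using \<epsilon> by (intro mult_left_mono power_mono) auto
          finally show ?thesis by (simp add: power2_eq_square)
        qed
        have i4: "?S * (k1 / 8 * \<epsilon> ^ (k + 1)) * (growth_rate DIM('a) t)\<^sup>2 = ?S * (k1 / 8 * ?R t ^ (k + 1))"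
          by (simp add: D[OF t(1)] power_divide)
        show ?case
        proof (intro conjI)
          show "?S * (k1 / 8 * \<epsilon> ^ (k + 1)) * (growth_rate DIM('a) t)\<^sup>2 \<le>
            (LINT \<xi>|lborel. indicator {?R t..2 * ?R t} (norm (\<xi>::'a)) * wave_profile b k1 k2 t (norm \<xi>))"
            unfolding i4 by (rule order_trans[OF i2 i1])
        qed (use R i3 in linarith)+
      qed
    qed
  qed
qed

section \<open>Estimates in $L^2$\<close>

text \<open>From \<open>x / p <= exp (x / p)\<close>, raised to the power \<open>p\<close>. It
  exchanges exponential decay at high frequencies for the factor
  \<open>t powr (- l)\<close>.\<close>

lemma exp_minus_le_powr:
  fixes x p :: real
  assumes "x > 0" "p > 0"
  shows "exp (- x) \<le> (p / x) powr p"
proof -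
  have "x / p \<le> exp (x / p)"
    using exp_ge_add_one_self[of "x / p"] by linarith
  then have "(x / p) powr p \<le> exp (x / p) powr p"
    using assms by (intro powr_mono2) auto
  also have "\<dots> = exp x" using assms by (simp add: powr_def)
  finally have "1 / exp x \<le> 1 / (x / p) powr p"
    using assms by (intro divide_left_mono) auto
  then show ?thesis using assms by (simp add: exp_minus inverse_eq_divide powr_divide)
qed

context
  fixes \<tau> \<delta> m :: real
  assumes pos: "\<tau> > 0" "m > 0" "\<delta> \<ge> 0" "m * \<tau> < 1"
begin

lemma solution_decay:
  obtains C c where "C > 0" "c > 0"
    "\<And>r a0 a1 a2 y t. r \<ge> 0 \<Longrightarrow> solves_ode \<tau> \<delta> m r a0 a1 a2 y \<Longrightarrow> t \<ge> 0 \<Longrightarrow>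
      r * (cmod (y t))\<^sup>2 \<le> C * exp (- (c * decay_rate \<delta> r) * t) *
        ((cmod a1)\<^sup>2 + (cmod a2)\<^sup>2 + r * ((cmod a0)\<^sup>2 + (cmod a1)\<^sup>2))"
proof -
  obtain C c where C: "C > 0" "c > 0" and dec: "\<And>r a0 a1 a2 y t. r \<ge> 0 \<Longrightarrow> real_solution \<tau> \<delta> m r a0 a1 a2 y \<Longrightarrow> t \<ge> 0 \<Longrightarrow>
      r * (y t)\<^sup>2 \<le> C * exp (- (c * decay_rate \<delta> r) * t) * (a1\<^sup>2 + a2\<^sup>2 + r * (a0\<^sup>2 + a1\<^sup>2))"
    using real_solution_decay[OF pos] by metis
  show thesis
  proof (rule that[OF C])
    fix r t :: real and a0 a1 a2 y
    assume r: "r \<ge> 0" and sol: "solves_ode \<tau> \<delta> m r a0 a1 a2 y" and t: "t \<ge> 0"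
    note s = solves_ode_real_solution[OF sol pos(1)]
    show "r * (cmod (y t))\<^sup>2 \<le> C * exp (- (c * decay_rate \<delta> r) * t) *
        ((cmod a1)\<^sup>2 + (cmod a2)\<^sup>2 + r * ((cmod a0)\<^sup>2 + (cmod a1)\<^sup>2))"
      using add_mono[OF dec[OF r s(1) t] dec[OF r s(2) t]] unfolding cmod_power2
      by (simp add: algebra_simps)
  qed
qed

lemma solution_growth:
  obtains C where "C > 0"
    "\<And>r a0 a1 a2 y t. 0 \<le> r \<Longrightarrow> r \<le> 1 \<Longrightarrow> solves_ode \<tau> \<delta> m r a0 a1 a2 y \<Longrightarrow> t \<ge> 1 \<Longrightarrow>
      (cmod (y t))\<^sup>2 \<le> C * t\<^sup>2 * ((cmod a0)\<^sup>2 + (cmod a1)\<^sup>2 + (cmod a2)\<^sup>2)"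
proof -
  obtain K where K: "K > 0" and gr: "\<And>r a0 a1 a2 y t. 0 \<le> r \<Longrightarrow> r \<le> 1 \<Longrightarrow> real_solution \<tau> \<delta> m r a0 a1 a2 y \<Longrightarrow> t \<ge> 1 \<Longrightarrow>
      \<bar>y t\<bar> \<le> K * t * (\<bar>a0\<bar> + \<bar>a1\<bar> + \<bar>a2\<bar>)"
    using real_solution_growth[OF pos] by metis
  have sq: "(y t)\<^sup>2 \<le> 3 * K\<^sup>2 * t\<^sup>2 * (a0\<^sup>2 + a1\<^sup>2 + a2\<^sup>2)"
    if "0 \<le> r" "r \<le> 1" "real_solution \<tau> \<delta> m r a0 a1 a2 y" "t \<ge> 1" for r a0 a1 a2 y t
  proof -
    have "\<bar>y t\<bar>\<^sup>2 \<le> (K * t * (\<bar>a0\<bar> + \<bar>a1\<bar> + \<bar>a2\<bar>))\<^sup>2"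
      by (intro power_mono gr[OF that]) simp
    also have "\<dots> = K\<^sup>2 * t\<^sup>2 * (\<bar>a0\<bar> + \<bar>a1\<bar> + \<bar>a2\<bar>)\<^sup>2" by (simp only: power_mult_distrib)
    also have "\<dots> \<le> K\<^sup>2 * t\<^sup>2 * (3 * (\<bar>a0\<bar>\<^sup>2 + \<bar>a1\<bar>\<^sup>2 + \<bar>a2\<bar>\<^sup>2))"
      by (intro mult_left_mono square_add3_le) simp
    finally show ?thesis by (simp add: algebra_simps)
  qed
  show thesis
  proof (rule that[of "3 * K\<^sup>2"])
    fix r t :: real and a0 a1 a2 y
    assume r: "0 \<le> r" "r \<le> 1" and sol: "solves_ode \<tau> \<delta> m r a0 a1 a2 y" and t: "t \<ge> 1"
    note s = solves_ode_real_solution[OF sol pos(1)]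
    show "(cmod (y t))\<^sup>2 \<le> 3 * K\<^sup>2 * t\<^sup>2 * ((cmod a0)\<^sup>2 + (cmod a1)\<^sup>2 + (cmod a2)\<^sup>2)"
      using add_mono[OF sq[OF r s(1) t] sq[OF r s(2) t]] unfolding cmod_power2
      by (simp add: algebra_simps)
  qed (use K in simp)
qed

lemma solution_profile:
  obtains K where "K > 0"
    "\<And>r a0 a1 a2 y t. 0 \<le> r \<Longrightarrow> r \<le> 1 \<Longrightarrow> solves_ode \<tau> \<delta> m r a0 a1 a2 y \<Longrightarrow> t \<ge> 0 \<Longrightarrow>
      cmod (sqrt (r * (1 - m * \<tau>)) *\<^sub>R y t - sin (sqrt (r * (1 - m * \<tau>)) * t) *\<^sub>R (a1 + \<tau> *\<^sub>R a2)) \<le>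
      K * (r * t * cmod (a1 + \<tau> *\<^sub>R a2) + sqrt r * (1 + r * t) * (cmod a0 + cmod a1 + cmod a2))"
proof -
  obtain K where K: "K > 0" and pr: "\<And>r a0 a1 a2 y t. 0 \<le> r \<Longrightarrow> r \<le> 1 \<Longrightarrow> real_solution \<tau> \<delta> m r a0 a1 a2 y \<Longrightarrow> t \<ge> 0 \<Longrightarrow>
      \<bar>sqrt (r * (1 - m * \<tau>)) * y t - sin (sqrt (r * (1 - m * \<tau>)) * t) * (a1 + \<tau> * a2)\<bar> \<le>
      K * (r * t * \<bar>a1 + \<tau> * a2\<bar> + sqrt r * (1 + r * t) * (\<bar>a0\<bar> + \<bar>a1\<bar> + \<bar>a2\<bar>))"
    using real_solution_low_frequency_profile[OF pos] by metis
  show thesis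
  proof (rule that[of "2 * K"])
    fix r t :: real and a0 a1 a2 y
    assume r: "0 \<le> r" "r \<le> 1" and sol: "solves_ode \<tau> \<delta> m r a0 a1 a2 y" and t: "t \<ge> 0"
    note s = solves_ode_real_solution[OF sol pos(1)]
    let ?z = "sqrt (r * (1 - m * \<tau>)) *\<^sub>R y t - sin (sqrt (r * (1 - m * \<tau>)) * t) *\<^sub>R (a1 + \<tau> *\<^sub>R a2)"
    let ?B = "K * (r * t * cmod (a1 + \<tau> *\<^sub>R a2) + sqrt r * (1 + r * t) * (cmod a0 + cmod a1 + cmod a2))"
    have "\<bar>Re ?z\<bar> \<le> K * (r * t * \<bar>Re (a1 + \<tau> *\<^sub>R a2)\<bar> + sqrt r * (1 + r * t) * (\<bar>Re a0\<bar> + \<bar>Re a1\<bar> + \<bar>Re a2\<bar>))"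
      using pr[OF r s(1) t] by simp
    also have "\<dots> \<le> ?B"
      using K r t by (intro mult_left_mono add_mono abs_Re_le_cmod) auto
    finally have re: "\<bar>Re ?z\<bar> \<le> ?B" .
    have "\<bar>Im ?z\<bar> \<le> K * (r * t * \<bar>Im (a1 + \<tau> *\<^sub>R a2)\<bar> + sqrt r * (1 + r * t) * (\<bar>Im a0\<bar> + \<bar>Im a1\<bar> + \<bar>Im a2\<bar>))"
      using pr[OF r s(2) t] by simp
    also have "\<dots> \<le> ?B"
      using K r t by (intro mult_left_mono add_mono abs_Im_le_cmod) auto
    finally have im: "\<bar>Im ?z\<bar> \<le> ?B" .
    have "cmod ?z \<le> ?B + ?B"
      using cmod_le[of ?z] re im by linarith
    then show "cmod ?z \<le> 2 * K * (r * t * cmod (a1 + \<tau> *\<^sub>R a2) + sqrt r * (1 + r * t) * (cmod a0 + cmod a1 + cmod a2))"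
      by (simp only: mult_2 distrib_right)
  qed (use K in simp)
qed

lemma continuous_on_solution:
  fixes a0 a1 a2 :: "'a::euclidean_space \<Rightarrow> complex"
  assumes a: "continuous_on UNIV a0" "continuous_on UNIV a1" "continuous_on UNIV a2"
    and sol: "\<And>\<xi>. solves_ode \<tau> \<delta> m ((norm \<xi>)\<^sup>2) (a0 \<xi>) (a1 \<xi>) (a2 \<xi>) (\<lambda>t. u t \<xi>)" and t: "t \<ge> 0"
  shows "continuous_on UNIV (u t)"
proof -
  note s = solves_ode_real_solution[OF sol pos(1)]
  have "continuous_on UNIV (\<lambda>\<xi>. Re (u t \<xi>))"
    by (rule continuous_on_real_solution[OF pos _ _ _ s(1) t]) (intro continuous_intros a)+
  moreover have "continuous_on UNIV (\<lambda>\<xi>. Im (u t \<xi>))"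
    by (rule continuous_on_real_solution[OF pos _ _ _ s(2) t]) (intro continuous_intros a)+
  ultimately have "continuous_on UNIV (\<lambda>\<xi>. Complex (Re (u t \<xi>)) (Im (u t \<xi>)))"
    by (intro continuous_on_Complex)
  then show ?thesis by simp
qed

end

lemma solution_high_frequency:
  assumes pos: "\<tau> > 0" "m > 0" "m * \<tau> < 1"
  obtains C c where "C > 0" "c > 0"
    "\<And>r a0 a1 a2 y t. r \<ge> 1 \<Longrightarrow> solves_ode \<tau> 0 m r a0 a1 a2 y \<Longrightarrow> t \<ge> 0 \<Longrightarrow>
      r\<^sup>2 * (cmod (y t))\<^sup>2 \<le> C * exp (- (c * decay_rate 0 r) * t) *
        ((cmod a2)\<^sup>2 + r * (cmod a1)\<^sup>2 + r\<^sup>2 * (cmod a0)\<^sup>2)"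
proof -
  obtain C c where C: "C > 0" "c > 0" and dec: "\<And>r a0 a1 a2 y t. r \<ge> 1 \<Longrightarrow> real_solution \<tau> 0 m r a0 a1 a2 y \<Longrightarrow> t \<ge> 0 \<Longrightarrow>
      r\<^sup>2 * (y t)\<^sup>2 \<le> C * exp (- (c * decay_rate 0 r) * t) * (a2\<^sup>2 + r * a1\<^sup>2 + r\<^sup>2 * a0\<^sup>2)"
    using real_solution_high_frequency[OF pos] by metis
  show thesis
  proof (rule that[OF C])
    fix r t :: real and a0 a1 a2 y
    assume r: "r \<ge> 1" and sol: "solves_ode \<tau> 0 m r a0 a1 a2 y" and t: "t \<ge> 0"
    note s = solves_ode_real_solution[OF sol pos(1)]
    show "r\<^sup>2 * (cmod (y t))\<^sup>2 \<le> C * exp (- (c * decay_rate 0 r) * t) *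
        ((cmod a2)\<^sup>2 + r * (cmod a1)\<^sup>2 + r\<^sup>2 * (cmod a0)\<^sup>2)"
      using add_mono[OF dec[OF r s(1) t] dec[OF r s(2) t]] unfolding cmod_power2
      by (simp add: algebra_simps)
  qed
qed

text \<open>A density on the frequency side whose integral is bounded by the squared data norm, by
  Plancherel for positive \<delta> and directly from the Sobolev norms otherwise.\<close>

definition data_weight ::
  "real \<Rightarrow> real \<Rightarrow> ('a::euclidean_space \<Rightarrow> real) \<Rightarrow> ('a \<Rightarrow> real) \<Rightarrow> ('a \<Rightarrow> real) \<Rightarrow> 'a \<Rightarrow> real" where
  "data_weight \<delta> l \<psi>0 \<psi>1 \<psi>2 \<xi> =
     (if \<delta> > 0 then (cmod (fourier \<psi>0 \<xi>))\<^sup>2 + (cmod (fourier \<psi>1 \<xi>))\<^sup>2 + (cmod (fourier \<psi>2 \<xi>))\<^sup>2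
      else (1 + (norm \<xi>)\<^sup>2) powr l * (cmod (fourier \<psi>0 \<xi>))\<^sup>2 +
        (1 + (norm \<xi>)\<^sup>2) powr (max (l - 1) 0) * (cmod (fourier \<psi>1 \<xi>))\<^sup>2 +
        (1 + (norm \<xi>)\<^sup>2) powr (max (l - 2) 0) * (cmod (fourier \<psi>2 \<xi>))\<^sup>2)"

lemma data_weight_nonneg: "0 \<le> data_weight \<delta> l \<psi>0 \<psi>1 \<psi>2 \<xi>"
  by (simp add: data_weight_def)

lemma L1_norm_nonneg: "0 \<le> L1_norm f"
  by (simp add: L1_norm_def)

lemma Hs_norm_nonneg: "0 \<le> Hs_norm s f"
  by (simp add: Hs_norm_def)

lemma sum_squares3_le:
  fixes a b c A B C :: real
  assumes "0 \<le> a" "0 \<le> b" "0 \<le> c" "0 \<le> A" "0 \<le> B" "0 \<le> C"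
  shows "a\<^sup>2 + b\<^sup>2 + c\<^sup>2 \<le> ((a + A) + (b + B) + (c + C))\<^sup>2"
proof -
  have "a\<^sup>2 + b\<^sup>2 + c\<^sup>2 \<le> (a + b + c)\<^sup>2"
    using assms by (simp add: power2_eq_square algebra_simps)
  also have "\<dots> \<le> ((a + A) + (b + B) + (c + C))\<^sup>2"
    using assms by (intro power_mono) auto
  finally show ?thesis .
qed

lemma data_space_properties:
  fixes \<psi>0 \<psi>1 \<psi>2 :: "'a::euclidean_space \<Rightarrow> real"
  assumes "(\<psi>0, \<psi>1, \<psi>2) \<in> data_space \<delta> l"
  shows "integrable lborel \<psi>0" "integrable lborel \<psi>1" "integrable lborel \<psi>2"
    and "L1_norm \<psi>0 + L1_norm \<psi>1 + L1_norm \<psi>2 \<le> data_norm \<delta> l (\<psi>0, \<psi>1, \<psi>2)"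
    and "(L1_norm \<psi>0)\<^sup>2 + (L1_norm \<psi>1)\<^sup>2 + (L1_norm \<psi>2)\<^sup>2 \<le> (data_norm \<delta> l (\<psi>0, \<psi>1, \<psi>2))\<^sup>2"
    and "integrable lborel (data_weight \<delta> l \<psi>0 \<psi>1 \<psi>2)"
    and "integral\<^sup>L lborel (data_weight \<delta> l \<psi>0 \<psi>1 \<psi>2) \<le> (data_norm \<delta> l (\<psi>0, \<psi>1, \<psi>2))\<^sup>2"
    and "0 \<le> data_norm \<delta> l (\<psi>0, \<psi>1, \<psi>2)"
proof -
  note nn = L2_norm_nonneg[of \<psi>0] L2_norm_nonneg[of \<psi>1] L2_norm_nonneg[of \<psi>2]
    L1_norm_nonneg[of \<psi>0] L1_norm_nonneg[of \<psi>1] L1_norm_nonneg[of \<psi>2]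
    Hs_norm_nonneg[of _ \<psi>0] Hs_norm_nonneg[of _ \<psi>1] Hs_norm_nonneg[of _ \<psi>2]
  show int: "integrable lborel \<psi>0" "integrable lborel \<psi>1" "integrable lborel \<psi>2"
    using assms by (auto simp: data_space_def L2_L1_def Hs_L1_def split: if_splits)
  show "L1_norm \<psi>0 + L1_norm \<psi>1 + L1_norm \<psi>2 \<le> data_norm \<delta> l (\<psi>0, \<psi>1, \<psi>2)" "0 \<le> data_norm \<delta> l (\<psi>0, \<psi>1, \<psi>2)"
    using nn by (simp_all add: data_norm_def L2_L1_norm_def Hs_L1_norm_def add_mono)
  show "(L1_norm \<psi>0)\<^sup>2 + (L1_norm \<psi>1)\<^sup>2 + (L1_norm \<psi>2)\<^sup>2 \<le> (data_norm \<delta> l (\<psi>0, \<psi>1, \<psi>2))\<^sup>2"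
    unfolding data_norm_def L2_L1_norm_def Hs_L1_norm_def
    using sum_squares3_le[OF nn(4-6) nn(1-3)] sum_squares3_le[OF nn(4-6) nn(7-9)]
    by (simp add: add.commute)
  have "integrable lborel (data_weight \<delta> l \<psi>0 \<psi>1 \<psi>2) \<and>
      integral\<^sup>L lborel (data_weight \<delta> l \<psi>0 \<psi>1 \<psi>2) \<le> (data_norm \<delta> l (\<psi>0, \<psi>1, \<psi>2))\<^sup>2"
  proof (cases "\<delta> > 0")
    case True
    then have sq: "square_integrable \<psi>0" "square_integrable \<psi>1" "square_integrable \<psi>2"
      using assms by (auto simp: data_space_def L2_L1_def)
    have i: "integrable lborel (\<lambda>\<xi>. (cmod (fourier f \<xi>))\<^sup>2)"
      "(LINT \<xi>|lborel. (cmod (fourier f \<xi>))\<^sup>2) = (L2_norm f)\<^sup>2"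
      if "integrable lborel f" "square_integrable f" for f :: "'a \<Rightarrow> real"
      using plancherel[OF that] by (simp_all add: square_integrable_def L2_norm_power2[symmetric])
    note i0 = i[OF int(1) sq(1)] i[OF int(2) sq(2)] i[OF int(3) sq(3)]
    have w: "data_weight \<delta> l \<psi>0 \<psi>1 \<psi>2 = (\<lambda>\<xi>. (cmod (fourier \<psi>0 \<xi>))\<^sup>2 + (cmod (fourier \<psi>1 \<xi>))\<^sup>2 + (cmod (fourier \<psi>2 \<xi>))\<^sup>2)"
      using True by (simp add: data_weight_def fun_eq_iff)
    have "integral\<^sup>L lborel (data_weight \<delta> l \<psi>0 \<psi>1 \<psi>2) = (L2_norm \<psi>0)\<^sup>2 + (L2_norm \<psi>1)\<^sup>2 + (L2_norm \<psi>2)\<^sup>2"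
      unfolding w using i0 by simp
    also have "\<dots> \<le> (data_norm \<delta> l (\<psi>0, \<psi>1, \<psi>2))\<^sup>2"
      unfolding data_norm_def L2_L1_norm_def using True sum_squares3_le[OF nn(1-6)] by simp
    finally show ?thesis unfolding w using i0 by simp
  next
    case False
    let ?w = "\<lambda>s f \<xi>. (1 + (norm \<xi>)\<^sup>2) powr s * (cmod (fourier f \<xi>))\<^sup>2"
    have i0: "integrable lborel (?w l \<psi>0)" "integrable lborel (?w (max (l - 1) 0) \<psi>1)" "integrable lborel (?w (max (l - 2) 0) \<psi>2)"
      using assms False by (auto simp: data_space_def Hs_L1_def)
    have w: "data_weight \<delta> l \<psi>0 \<psi>1 \<psi>2 = (\<lambda>\<xi>. ?w l \<psi>0 \<xi> + ?w (max (l - 1) 0) \<psi>1 \<xi> + ?w (max (l - 2) 0) \<psi>2 \<xi>)"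
      using False by (simp add: data_weight_def fun_eq_iff)
    have h: "(LINT \<xi>|lborel. ?w s f \<xi>) = (Hs_norm s f)\<^sup>2" for s and f :: "'a \<Rightarrow> real"
      by (simp add: Hs_norm_def)
    have "integral\<^sup>L lborel (data_weight \<delta> l \<psi>0 \<psi>1 \<psi>2) =
        (LINT \<xi>|lborel. ?w l \<psi>0 \<xi>) + (LINT \<xi>|lborel. ?w (max (l - 1) 0) \<psi>1 \<xi>) + (LINT \<xi>|lborel. ?w (max (l - 2) 0) \<psi>2 \<xi>)"
      unfolding w using i0 by simp
    also have "\<dots> = (Hs_norm l \<psi>0)\<^sup>2 + (Hs_norm (max (l - 1) 0) \<psi>1)\<^sup>2 + (Hs_norm (max (l - 2) 0) \<psi>2)\<^sup>2"
      by (simp only: h)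
    also have "\<dots> \<le> (data_norm \<delta> l (\<psi>0, \<psi>1, \<psi>2))\<^sup>2"
      unfolding data_norm_def Hs_L1_norm_def using False sum_squares3_le[OF nn(7-9) nn(4-6)] by simp
    finally show ?thesis unfolding w using i0 by simp
  qed
  then show "integrable lborel (data_weight \<delta> l \<psi>0 \<psi>1 \<psi>2)"
    "integral\<^sup>L lborel (data_weight \<delta> l \<psi>0 \<psi>1 \<psi>2) \<le> (data_norm \<delta> l (\<psi>0, \<psi>1, \<psi>2))\<^sup>2" by auto
qed

text \<open>This is where the threshold \<open>n / 2 - 1\<close> for \<open>l\<close> comes from:
  the square of the high-frequency part decays like \<open>t powr (- l)\<close> and must not exceed
  the squared growth rate.\<close>

lemma growth_rate_power2_ge:
  assumes t: "t \<ge> 3" and l: "l > max (real n / 2 - 1) 0" and n: "n \<ge> 1"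
  shows "t powr (- l) \<le> (growth_rate n t)\<^sup>2"
proof -
  have "exp 1 \<le> t" using exp_le t by simp
  then have ln: "1 \<le> ln t" using t by (simp add: ln_ge_iff)
  have "t powr (- l) \<le> t powr (- max (real n / 2 - 1) 0)"
    using l t by (intro powr_mono) auto
  also have "\<dots> \<le> (growth_rate n t)\<^sup>2"
  proof (cases "n \<le> 2")
    case True
    then have "n = 1 \<or> n = 2" using n by auto
    then show ?thesis using t ln by (auto simp: growth_rate_power2)
  next
    case False
    then show ?thesis using t by (auto simp: growth_rate_power2 max_def)
  qed
  finally show ?thesis .
qed

text \<open>Each frequency needs only one of the two summands: the kernel for
  \<open>norm \<xi> <= 1\<close>, the weighted data beyond. There the Sobolev weight in the case
  \<delta> = 0 compensates the degenerate rate.\<close>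

lemma solution_pointwise_bound:
  fixes \<tau> \<delta> m l :: real
  assumes pos: "\<tau> > 0" "m > 0" "\<delta> \<ge> 0" "m * \<tau> < 1" and l: "l > 0"
  obtains C c where "C > 0" "c > 0"
    "\<And>(\<psi>0 :: 'a::euclidean_space \<Rightarrow> real) \<psi>1 \<psi>2 u \<xi> t. integrable lborel \<psi>0 \<Longrightarrow> integrable lborel \<psi>1 \<Longrightarrow> integrable lborel \<psi>2 \<Longrightarrow>
      solves_ode \<tau> \<delta> m ((norm \<xi>)\<^sup>2) (fourier \<psi>0 \<xi>) (fourier \<psi>1 \<xi>) (fourier \<psi>2 \<xi>) u \<Longrightarrow> t \<ge> 3 \<Longrightarrow>
      (cmod (u t))\<^sup>2 \<le> C * (((L1_norm \<psi>0)\<^sup>2 + (L1_norm \<psi>1)\<^sup>2 + (L1_norm \<psi>2)\<^sup>2) * low_kernel c t (norm \<xi>) +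
        t powr (- l) * data_weight \<delta> l \<psi>0 \<psi>1 \<psi>2 \<xi>)"
proof -
  obtain C0 c0 where C0: "C0 > 0" "c0 > 0" and dec: "\<And>r a0 a1 a2 y t. r \<ge> 0 \<Longrightarrow> solves_ode \<tau> \<delta> m r a0 a1 a2 y \<Longrightarrow> t \<ge> 0 \<Longrightarrow>
      r * (cmod (y t))\<^sup>2 \<le> C0 * exp (- (c0 * decay_rate \<delta> r) * t) *
        ((cmod a1)\<^sup>2 + (cmod a2)\<^sup>2 + r * ((cmod a0)\<^sup>2 + (cmod a1)\<^sup>2))"
    using solution_decay[OF pos] by metis
  obtain C1 where C1: "C1 > 0" and gr: "\<And>r a0 a1 a2 y t. 0 \<le> r \<Longrightarrow> r \<le> 1 \<Longrightarrow> solves_ode \<tau> \<delta> m r a0 a1 a2 y \<Longrightarrow> t \<ge> 1 \<Longrightarrow>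
      (cmod (y t))\<^sup>2 \<le> C1 * t\<^sup>2 * ((cmod a0)\<^sup>2 + (cmod a1)\<^sup>2 + (cmod a2)\<^sup>2)"
    using solution_growth[OF pos] by metis
  obtain C2 c2 where C2: "C2 > 0" "c2 > 0" and high: "\<And>r a0 a1 a2 y t. r \<ge> 1 \<Longrightarrow> solves_ode \<tau> 0 m r a0 a1 a2 y \<Longrightarrow> t \<ge> 0 \<Longrightarrow>
      r\<^sup>2 * (cmod (y t))\<^sup>2 \<le> C2 * exp (- (c2 * decay_rate 0 r) * t) *
        ((cmod a2)\<^sup>2 + r * (cmod a1)\<^sup>2 + r\<^sup>2 * (cmod a0)\<^sup>2)"
    using solution_high_frequency[OF pos(1,2,4)] by metis
  \<comment> \<open>For \<open>r <= 1\<close> both forms of \<open>decay_rate\<close> are at least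
    \<open>r / 4\<close>. The two summands of \<open>K\<close> are the constants of the
    high-frequency cases \<delta> > 0 and \<delta> = 0.\<close>
  define c where "c = c0 / 4"
  define K where "K = 2 * C0 * (2 * l / c0) powr l + C2 * (4 * l / c2) powr l"
  have K: "K > 0" using C0 C2 l by (auto simp: K_def intro!: add_pos_nonneg)
  define C where "C = C1 + 2 * C0 + K"
  have C: "C > 0" "C1 \<le> C" "2 * C0 \<le> C" "K \<le> C" using C0 C1 K by (auto simp: C_def)
  show thesis
  proof (rule that[of C c])
    show "C > 0" "c > 0" using C C0 by (auto simp: c_def)
    fix \<psi>0 \<psi>1 \<psi>2 :: "'a \<Rightarrow> real" and u and \<xi> :: 'a and t :: real
    assume int: "integrable lborel \<psi>0" "integrable lborel \<psi>1" "integrable lborel \<psi>2" and t: "t \<ge> 3"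
      and sol: "solves_ode \<tau> \<delta> m ((norm \<xi>)\<^sup>2) (fourier \<psi>0 \<xi>) (fourier \<psi>1 \<xi>) (fourier \<psi>2 \<xi>) u"
    define r where "r = (norm \<xi>)\<^sup>2"
    define b0 b1 b2 where "b0 = (cmod (fourier \<psi>0 \<xi>))\<^sup>2" and "b1 = (cmod (fourier \<psi>1 \<xi>))\<^sup>2" and "b2 = (cmod (fourier \<psi>2 \<xi>))\<^sup>2"
    have b: "b0 \<ge> 0" "b1 \<ge> 0" "b2 \<ge> 0" by (auto simp: b0_def b1_def b2_def)
    let ?M = "(L1_norm \<psi>0)\<^sup>2 + (L1_norm \<psi>1)\<^sup>2 + (L1_norm \<psi>2)\<^sup>2"
    let ?W = "data_weight \<delta> l \<psi>0 \<psi>1 \<psi>2 \<xi>"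
    have bM: "b0 + b1 + b2 \<le> ?M"
      unfolding b0_def b1_def b2_def by (intro add_mono power_mono norm_fourier_le int) auto
    have M: "?M \<ge> 0" by simp
    have r0: "r \<ge> 0" by (simp add: r_def)
    note sol' = sol[folded r_def]
    have dec': "r * (cmod (u t))\<^sup>2 \<le> C0 * exp (- (c0 * decay_rate \<delta> r) * t) * (b1 + b2 + r * (b0 + b1))"
      using dec[OF r0 sol'] t by (simp add: b0_def b1_def b2_def)
    have lk: "low_kernel c t (norm \<xi>) \<ge> 0" by (simp add: low_kernel_def)
    have W: "?W \<ge> 0" by (rule data_weight_nonneg)
    have "(cmod (u t))\<^sup>2 \<le> C * (?M * low_kernel c t (norm \<xi>)) \<or> (cmod (u t))\<^sup>2 \<le> C * (t powr (- l) * ?W)"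
    proof (cases "r \<le> 1")
      case True
      then have n1: "norm \<xi> \<le> 1" by (simp add: r_def power_le_one_iff abs_square_le_1)
      have "(cmod (u t))\<^sup>2 \<le> C * (?M * low_kernel c t (norm \<xi>))"
      proof (cases "norm \<xi> * t \<le> 1")
        case True
        have "(cmod (u t))\<^sup>2 \<le> C1 * t\<^sup>2 * (b0 + b1 + b2)"
          using gr[OF r0 \<open>r \<le> 1\<close> sol'] t by (simp add: b0_def b1_def b2_def)
        also have "\<dots> \<le> C * t\<^sup>2 * ?M" using C1 C bM b by (intro mult_mono) auto
        finally show ?thesis using True by (simp add: low_kernel_def mult_ac)
      next
        case False
        then have "norm \<xi> > 0" using t by (metis mult_zero_left norm_ge_zero order_le_less zero_le_one)
        then have rp: "r > 0" by (simp add: r_def)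
        have "r / 4 \<le> decay_rate \<delta> r"
        proof -
          have "(1 + r)\<^sup>2 \<le> (1 + 1)\<^sup>2" using \<open>r \<le> 1\<close> r0 by (intro power_mono) auto
          moreover have "1 + r \<le> 4" using \<open>r \<le> 1\<close> by simp
          moreover have "r / 4 \<le> r / x" if "0 < x" "x \<le> 4" for x
            using that rp by (intro divide_left_mono) auto
          ultimately have "r / 4 \<le> r / (1 + r)\<^sup>2" "r / 4 \<le> r / (1 + r)"
            using rp by simp_all
          then show ?thesis unfolding decay_rate_def by (simp only: split: if_splits) blast
        qed
        then have "c0 * (r / 4) * t \<le> c0 * decay_rate \<delta> r * t"
          using C0 t by (intro mult_right_mono mult_left_mono) auto
        then have "exp (- (c0 * decay_rate \<delta> r) * t) \<le> exp (- c * r * t)" by (simp add: c_def)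
        moreover have "b1 + b2 + r * (b0 + b1) \<le> 2 * ?M"
        proof -
          have "r * (b0 + b1) \<le> 1 * (b0 + b1)" using True b by (intro mult_right_mono) auto
          moreover have "b1 + b2 + x \<le> 2 * M" if "x \<le> 1 * (b0 + b1)" "b0 + b1 + b2 \<le> M" for x M
            using that b by simp
          ultimately show ?thesis using bM by blast
        qed
        ultimately have "C0 * exp (- (c0 * decay_rate \<delta> r) * t) * (b1 + b2 + r * (b0 + b1)) \<le> C0 * exp (- c * r * t) * (2 * ?M)"
          using C0 b r0 by (intro mult_mono) auto
        then have "r * (cmod (u t))\<^sup>2 \<le> (2 * C0) * (exp (- c * r * t) * ?M)"
          using order_trans[OF dec'] by (simp only: mult_ac)
        also have "\<dots> \<le> C * (exp (- c * r * t) * ?M)" using C M by (intro mult_right_mono) auto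
        finally have "(cmod (u t))\<^sup>2 \<le> C * (?M * (exp (- c * r * t) / r))"
          using rp by (simp add: field_simps)
        then show ?thesis using False n1 by (simp add: low_kernel_def r_def)
      qed
      then show ?thesis ..
    next
      case False
      then have r1: "r > 1" by simp
      have "(cmod (u t))\<^sup>2 \<le> C * (t powr (- l) * ?W)"
      proof (cases "\<delta> > 0")
        case True
        have "1 / 2 \<le> decay_rate \<delta> r" using r1 True by (simp add: decay_rate_def field_simps)
        then have "c0 * (1 / 2) * t \<le> c0 * decay_rate \<delta> r * t"
          using C0 t by (intro mult_right_mono mult_left_mono) auto
        then have "exp (- (c0 * decay_rate \<delta> r) * t) \<le> exp (- (c0 / 2 * t))" by simp
        also have "\<dots> \<le> (l / (c0 / 2 * t)) powr l"
          using C0 t l by (intro exp_minus_le_powr) auto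
        also have "l / (c0 / 2 * t) = (2 * l / c0) * (1 / t)" using C0 t by (simp add: field_simps)
        also have "\<dots> powr l = (2 * l / c0) powr l * t powr (- l)"
          using t l C0 by (simp add: powr_mult powr_divide powr_minus_divide)
        finally have ex: "exp (- (c0 * decay_rate \<delta> r) * t) \<le> (2 * l / c0) powr l * t powr (- l)" .
        have "b1 + b2 + r * (b0 + b1) \<le> r * (2 * (b0 + b1 + b2))"
        proof -
          have "1 * (b1 + b2) \<le> r * (b1 + b2)" using r1 b by (intro mult_right_mono) auto
          moreover have "0 \<le> r * (b0 + b2)" using r0 b by simp
          ultimately show ?thesis by (simp add: algebra_simps)
        qed
        then have "C0 * exp (- (c0 * decay_rate \<delta> r) * t) * (b1 + b2 + r * (b0 + b1)) \<le>
            C0 * ((2 * l / c0) powr l * t powr (- l)) * (r * (2 * (b0 + b1 + b2)))"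
          using C0 b r0 ex by (intro mult_mono) auto
        then have "r * (cmod (u t))\<^sup>2 \<le> r * ((2 * C0 * (2 * l / c0) powr l) * (t powr (- l) * (b0 + b1 + b2)))"
          using order_trans[OF dec'] by (simp only: mult_ac)
        then have "(cmod (u t))\<^sup>2 \<le> (2 * C0 * (2 * l / c0) powr l) * (t powr (- l) * (b0 + b1 + b2))"
          using r1 by simp
        also have "\<dots> \<le> C * (t powr (- l) * (b0 + b1 + b2))"
          using C C2 b by (intro mult_right_mono order_trans[OF _ C(4)]) (auto simp: K_def)
        finally show ?thesis using True by (simp add: data_weight_def b0_def b1_def b2_def)
      next
        case False
        then have \<delta>: "\<delta> = 0" using pos by simp
        \<comment> \<open>With a rate of order 1 / r the exponential can only be exchanged for
          \<open>t powr (- l) * r powr l\<close>, that is for \<open>l\<close> derivatives. Dividing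
          \<open>high\<close> by \<open>r\<^sup>2\<close> leaves the orders \<open>l\<close>,
          \<open>l - 1\<close> and \<open>l - 2\<close> for the three data.\<close>
        have "1 / (4 * r) \<le> decay_rate 0 r"
        proof -
          have "(1 + r)\<^sup>2 \<le> (r + r)\<^sup>2" using r1 by (intro power_mono) auto
          then show ?thesis using r1 by (simp add: decay_rate_def field_simps power2_eq_square)
        qed
        then have "c2 * (1 / (4 * r)) * t \<le> c2 * decay_rate 0 r * t"
          using C2 t by (intro mult_right_mono mult_left_mono) auto
        then have "exp (- (c2 * decay_rate 0 r) * t) \<le> exp (- (c2 / (4 * r) * t))" by simp
        also have "\<dots> \<le> (l / (c2 / (4 * r) * t)) powr l"
          using C2 t l r1 by (intro exp_minus_le_powr) auto
        also have "l / (c2 / (4 * r) * t) = (4 * l / c2) * (1 / t) * r" using C2 t r1 by (simp add: field_simps)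
        also have "\<dots> powr l = (4 * l / c2) powr l * t powr (- l) * r powr l"
          using t l C2 r1 by (simp add: powr_mult powr_divide powr_minus_divide)
        finally have ex: "exp (- (c2 * decay_rate 0 r) * t) \<le> (4 * l / c2) powr l * t powr (- l) * r powr l" .
        have "r\<^sup>2 * (cmod (u t))\<^sup>2 \<le> C2 * exp (- (c2 * decay_rate 0 r) * t) * (b2 + r * b1 + r\<^sup>2 * b0)"
          using high[OF _ sol'[unfolded \<delta>], of t] r1 t by (simp add: b0_def b1_def b2_def)
        also have "\<dots> \<le> C2 * ((4 * l / c2) powr l * t powr (- l) * r powr l) * (b2 + r * b1 + r\<^sup>2 * b0)"
          using C2 b r0 by (intro mult_right_mono mult_left_mono ex) auto
        also have "\<dots> = (C2 * (4 * l / c2) powr l) * (t powr (- l) * (r powr l * (b2 + r * b1 + r\<^sup>2 * b0)))"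
          by (simp only: mult_ac)
        also have "r powr l * (b2 + r * b1 + r\<^sup>2 * b0) = r\<^sup>2 * (r powr l * b0 + r powr (l - 1) * b1 + r powr (l - 2) * b2)"
        proof -
          have "r powr l = r powr (l - 1) * r" "r powr l = r powr (l - 2) * r\<^sup>2"
            using r1 by (simp_all add: powr_diff)
          then show ?thesis by (simp add: algebra_simps power2_eq_square)
        qed
        also have "C2 * (4 * l / c2) powr l * (t powr (- l) * (r\<^sup>2 * (r powr l * b0 + r powr (l - 1) * b1 + r powr (l - 2) * b2)))
            \<le> C * (t powr (- l) * (r\<^sup>2 * ?W))"
        proof (intro mult_mono order_refl)
          show "C2 * (4 * l / c2) powr l \<le> C" using C0 by (intro order_trans[OF _ C(4)]) (auto simp: K_def)
          \<comment> \<open>The exponents \<open>l - 1\<close> and \<open>l - 2\<close> may be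
            negative; as \<open>r > 1\<close> they may be raised to 0, which gives the maxima in the
            data space.\<close>
          have p: "r powr s \<le> (1 + r) powr (max s 0)" for s
          proof -
            have "r powr s \<le> r powr (max s 0)" using r1 by (intro powr_mono) auto
            also have "\<dots> \<le> (1 + r) powr (max s 0)" using r1 by (intro powr_mono2) auto
            finally show ?thesis .
          qed
          have "r powr l * b0 + r powr (l - 1) * b1 + r powr (l - 2) * b2 \<le>
              (1 + r) powr (max l 0) * b0 + (1 + r) powr (max (l - 1) 0) * b1 + (1 + r) powr (max (l - 2) 0) * b2"
            by (intro add_mono mult_right_mono p b)
          also have "\<dots> = ?W" using \<delta> l by (simp add: data_weight_def r_def b0_def b1_def b2_def)
          finally show "r powr l * b0 + r powr (l - 1) * b1 + r powr (l - 2) * b2 \<le> ?W" .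
        qed (use C b r0 W in auto)
        finally have "r\<^sup>2 * (cmod (u t))\<^sup>2 \<le> r\<^sup>2 * (C * (t powr (- l) * ?W))" by (simp only: mult_ac)
        then show ?thesis using r1 by simp
      qed
      then show ?thesis ..
    qed
    moreover have "0 \<le> C * (?M * low_kernel c t (norm \<xi>))" "0 \<le> C * (t powr (- l) * ?W)"
      using C M lk W by auto
    ultimately show "(cmod (u t))\<^sup>2 \<le> C * (?M * low_kernel c t (norm \<xi>) + t powr (- l) * ?W)"
      by (auto simp: distrib_left)
  qed
qed

text \<open>The pointwise bound is integrated as a nonnegative integral, so square integrability of
  \<open>u t\<close> comes out as a result. Continuity in \<xi> supplies the measurability.\<close>

lemma solution_L2_upper:
  fixes \<tau> \<delta> m l :: real
  assumes pos: "\<tau> > 0" "m > 0" "\<delta> \<ge> 0" "m * \<tau> < 1" and l: "l > max (real DIM('a::euclidean_space) / 2 - 1) 0"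
  obtains C where "C > 0"
    "\<And>(\<psi>0 :: 'a \<Rightarrow> real) \<psi>1 \<psi>2 u t. (\<psi>0, \<psi>1, \<psi>2) \<in> data_space \<delta> l \<Longrightarrow>
      (\<And>\<xi>. solves_ode \<tau> \<delta> m ((norm \<xi>)\<^sup>2) (fourier \<psi>0 \<xi>) (fourier \<psi>1 \<xi>) (fourier \<psi>2 \<xi>) (\<lambda>t. u t \<xi>)) \<Longrightarrow> t \<ge> 3 \<Longrightarrow>
      square_integrable (u t) \<and> L2_norm (u t) \<le> C * (growth_rate DIM('a) t * data_norm \<delta> l (\<psi>0, \<psi>1, \<psi>2))"
proof -
  have l0: "l > 0" using l by simp
  obtain C c where C: "C > 0" "c > 0" and bound: "\<And>(\<psi>0 :: 'a \<Rightarrow> real) \<psi>1 \<psi>2 u \<xi> t. integrable lborel \<psi>0 \<Longrightarrow> integrable lborel \<psi>1 \<Longrightarrow> integrable lborel \<psi>2 \<Longrightarrow>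
      solves_ode \<tau> \<delta> m ((norm \<xi>)\<^sup>2) (fourier \<psi>0 \<xi>) (fourier \<psi>1 \<xi>) (fourier \<psi>2 \<xi>) u \<Longrightarrow> t \<ge> 3 \<Longrightarrow>
      (cmod (u t))\<^sup>2 \<le> C * (((L1_norm \<psi>0)\<^sup>2 + (L1_norm \<psi>1)\<^sup>2 + (L1_norm \<psi>2)\<^sup>2) * low_kernel c t (norm \<xi>) +
        t powr (- l) * data_weight \<delta> l \<psi>0 \<psi>1 \<psi>2 \<xi>)"
    using solution_pointwise_bound[OF pos l0, where 'a = 'a] by metis
  obtain K where K: "K > 0" and ker: "\<And>t. t \<ge> 3 \<Longrightarrow>
    (\<integral>\<^sup>+\<xi>. ennreal (low_kernel c t (norm (\<xi>::'a))) \<partial>lborel) \<le> ennreal (K * (growth_rate DIM('a) t)\<^sup>2)"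
    using low_kernel_integral[OF C(2), where 'a = 'a] by metis
  show thesis
  proof (rule that[of "sqrt (C * (K + 1))"])
    show "sqrt (C * (K + 1)) > 0" using C K by simp
    fix \<psi>0 \<psi>1 \<psi>2 :: "'a \<Rightarrow> real" and u and t :: real
    assume data: "(\<psi>0, \<psi>1, \<psi>2) \<in> data_space \<delta> l" and t: "t \<ge> 3"
      and sol: "\<And>\<xi>. solves_ode \<tau> \<delta> m ((norm \<xi>)\<^sup>2) (fourier \<psi>0 \<xi>) (fourier \<psi>1 \<xi>) (fourier \<psi>2 \<xi>) (\<lambda>t. u t \<xi>)"
    note d = data_space_properties[OF data]
    let ?M = "(L1_norm \<psi>0)\<^sup>2 + (L1_norm \<psi>1)\<^sup>2 + (L1_norm \<psi>2)\<^sup>2" and ?W = "data_weight \<delta> l \<psi>0 \<psi>1 \<psi>2"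
    let ?D = "(growth_rate DIM('a) t)\<^sup>2" and ?N = "data_norm \<delta> l (\<psi>0, \<psi>1, \<psi>2)"
    have M: "?M \<ge> 0" by simp
    have "continuous_on UNIV (u t)"
      by (rule continuous_on_solution[OF pos _ _ _ sol]) (use t in \<open>auto intro!: continuous_fourier d\<close>)
    then have [measurable]: "u t \<in> borel_measurable borel"
      by (rule borel_measurable_continuous_onI)
    have [measurable]: "?W \<in> borel_measurable borel" using d(6) by auto
    have Wnn: "(\<integral>\<^sup>+\<xi>. ennreal (?W \<xi>) \<partial>lborel) = ennreal (integral\<^sup>L lborel ?W)"
      by (rule nn_integral_eq_integral[OF d(6)]) (simp add: data_weight_nonneg)
    have "(\<integral>\<^sup>+\<xi>. ennreal ((cmod (u t \<xi>))\<^sup>2) \<partial>lborel) \<le>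
        (\<integral>\<^sup>+\<xi>. ennreal (C * ?M) * ennreal (low_kernel c t (norm \<xi>)) + ennreal (C * t powr (- l)) * ennreal (?W \<xi>) \<partial>lborel)"
    proof (rule nn_integral_mono)
      fix \<xi>
      have "ennreal ((cmod (u t \<xi>))\<^sup>2) \<le> ennreal (C * ?M * low_kernel c t (norm \<xi>) + C * t powr (- l) * ?W \<xi>)"
        using bound[OF d(1-3) sol t] by (intro ennreal_leI) (simp add: algebra_simps)
      also have "\<dots> = ennreal (C * ?M) * ennreal (low_kernel c t (norm \<xi>)) + ennreal (C * t powr (- l)) * ennreal (?W \<xi>)"
      proof -
        have "ennreal (x * y + z * w) = ennreal x * ennreal y + ennreal z * ennreal w"
          if "x \<ge> 0" "y \<ge> 0" "z \<ge> 0" "w \<ge> 0" for x y z w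
          using that by (simp add: ennreal_mult)
        then show ?thesis by this (use C in \<open>auto simp: low_kernel_def data_weight_nonneg\<close>)
      qed
      finally show "ennreal ((cmod (u t \<xi>))\<^sup>2) \<le> ennreal (C * ?M) * ennreal (low_kernel c t (norm \<xi>)) + ennreal (C * t powr (- l)) * ennreal (?W \<xi>)" .
    qed
    also have "\<dots> = ennreal (C * ?M) * (\<integral>\<^sup>+\<xi>. ennreal (low_kernel c t (norm (\<xi>::'a))) \<partial>lborel) + ennreal (C * t powr (- l)) * ennreal (integral\<^sup>L lborel ?W)"
      by (simp add: nn_integral_add nn_integral_cmult Wnn)
    also have "\<dots> \<le> ennreal (C * ?N\<^sup>2) * ennreal (K * ?D) + ennreal (C * ?D) * ennreal (?N\<^sup>2)"
    proof (intro add_mono mult_mono ker[OF t] ennreal_leI d mult_left_mono)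
      show "t powr (- l) \<le> ?D"
        by (rule growth_rate_power2_ge[OF t l]) (simp add: Suc_leI)
    qed (use C in auto)
    also have "\<dots> = ennreal (C * (K + 1) * (?D * ?N\<^sup>2))"
      using C K by (simp add: ennreal_mult[symmetric] ennreal_plus[symmetric] algebra_simps del: ennreal_plus)
    finally have nn: "(\<integral>\<^sup>+\<xi>. ennreal ((cmod (u t \<xi>))\<^sup>2) \<partial>lborel) \<le> ennreal (C * (K + 1) * (?D * ?N\<^sup>2))" .
    have int: "integrable lborel (\<lambda>\<xi>. (cmod (u t \<xi>))\<^sup>2)"
      using le_less_trans[OF nn ennreal_less_top] by (intro integrableI_bounded) auto
    have "ennreal (LINT \<xi>|lborel. (cmod (u t \<xi>))\<^sup>2) \<le> ennreal (C * (K + 1) * (?D * ?N\<^sup>2))"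
      using nn by (subst nn_integral_eq_integral[OF int, symmetric]) auto
    then have le: "(LINT \<xi>|lborel. (cmod (u t \<xi>))\<^sup>2) \<le> C * (K + 1) * (growth_rate DIM('a) t * ?N)\<^sup>2"
      using C K by (subst (asm) ennreal_le_iff) (auto simp: power_mult_distrib)
    have g0: "growth_rate DIM('a) t \<ge> 0" using t by (simp add: growth_rate_def)
    have "L2_norm (u t) \<le> sqrt (C * (K + 1) * (growth_rate DIM('a) t * ?N)\<^sup>2)"
      unfolding L2_norm_def using le by simp
    also have "\<dots> = sqrt (C * (K + 1)) * (growth_rate DIM('a) t * ?N)"
      using g0 d(8) by (simp add: real_sqrt_mult)
    finally show "square_integrable (u t) \<and> L2_norm (u t) \<le> sqrt (C * (K + 1)) * (growth_rate DIM('a) t * ?N)"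
      using int by (simp add: square_integrable_def)
  qed
qed

lemma square_diff_ge: "x\<^sup>2 / 2 - y\<^sup>2 \<le> z\<^sup>2" if "x - y \<le> z" "0 \<le> x" "0 \<le> y" "0 \<le> z" for x y z :: real
proof -
  have "x\<^sup>2 \<le> (z + y)\<^sup>2" using that by (intro power_mono) auto
  also have "\<dots> \<le> 2 * z\<^sup>2 + 2 * y\<^sup>2"
    using zero_le_power2[of "z - y"] by (simp add: power2_eq_square algebra_simps)
  finally show ?thesis by simp
qed

text \<open>\<open>P\<close> is the size of \<open>a1 + \<tau> a2\<close> at frequency 0, met up to
  a factor 2 nearby. The triangle inequality for \<open>solution_profile\<close> is squared with
  \<open>square_diff_ge\<close>: the 8 in the denominator comes from \<open>(P / 2)^2 / 2\<close>,
  and the 8 in \<open>k\<close> from splitting the square of an error with the factor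
  \<open>2 * K\<close>.\<close>

lemma solution_pointwise_lower:
  fixes \<tau> \<delta> m :: real
  assumes pos: "\<tau> > 0" "m > 0" "\<delta> \<ge> 0" "m * \<tau> < 1"
  obtains k where "k > 0"
    "\<And>\<rho> t P Y a0 a1 a2 y. 0 < \<rho> \<Longrightarrow> \<rho> \<le> 1 \<Longrightarrow> 0 \<le> t \<Longrightarrow> \<rho>\<^sup>2 * t \<le> 1 \<Longrightarrow> solves_ode \<tau> \<delta> m (\<rho>\<^sup>2) a0 a1 a2 y \<Longrightarrow>
      0 \<le> P \<Longrightarrow> P / 2 \<le> cmod (a1 + \<tau> *\<^sub>R a2) \<Longrightarrow> cmod (a1 + \<tau> *\<^sub>R a2) \<le> 2 * P \<Longrightarrow>
      cmod a0 + cmod a1 + cmod a2 \<le> Y \<Longrightarrow>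
      P\<^sup>2 * wave_profile (sqrt (1 - m * \<tau>)) (1 / (8 * (1 - m * \<tau>))) k t \<rho> - k * Y\<^sup>2 \<le> (cmod (y t))\<^sup>2"
proof -
  obtain K where K: "K > 0" and pr: "\<And>r a0 a1 a2 y t. 0 \<le> r \<Longrightarrow> r \<le> 1 \<Longrightarrow> solves_ode \<tau> \<delta> m r a0 a1 a2 y \<Longrightarrow> t \<ge> 0 \<Longrightarrow>
      cmod (sqrt (r * (1 - m * \<tau>)) *\<^sub>R y t - sin (sqrt (r * (1 - m * \<tau>)) * t) *\<^sub>R (a1 + \<tau> *\<^sub>R a2)) \<le>
      K * (r * t * cmod (a1 + \<tau> *\<^sub>R a2) + sqrt r * (1 + r * t) * (cmod a0 + cmod a1 + cmod a2))"
    using solution_profile[OF pos] by metis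
  define \<beta> where "\<beta> = 1 - m * \<tau>"
  have be: "\<beta> > 0" using pos by (simp add: \<beta>_def)
  show thesis
  proof (rule that[of "8 * K\<^sup>2 / \<beta>"])
    show "8 * K\<^sup>2 / \<beta> > 0" using K be by simp
    fix \<rho> t P Y a0 a1 a2 y
    assume \<rho>: "0 < \<rho>" "\<rho> \<le> 1" and t: "0 \<le> t" "\<rho>\<^sup>2 * t \<le> 1" and sol: "solves_ode \<tau> \<delta> m (\<rho>\<^sup>2) a0 a1 a2 y"
      and P: "0 \<le> P" "P / 2 \<le> cmod (a1 + \<tau> *\<^sub>R a2)" "cmod (a1 + \<tau> *\<^sub>R a2) \<le> 2 * P"
      and Y: "cmod a0 + cmod a1 + cmod a2 \<le> Y"
    let ?s = "a1 + \<tau> *\<^sub>R a2" and ?\<omega> = "sqrt \<beta> * \<rho>"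
    have Y0: "Y \<ge> 0" using Y norm_ge_zero[of a0] norm_ge_zero[of a1] norm_ge_zero[of a2] by linarith
    have om: "sqrt (\<rho>\<^sup>2 * (1 - m * \<tau>)) = ?\<omega>" "?\<omega> > 0"
      using \<rho> be by (simp_all add: \<beta>_def real_sqrt_mult)
    have "cmod (?\<omega> *\<^sub>R y t - sin (?\<omega> * t) *\<^sub>R ?s) \<le>
        K * (\<rho>\<^sup>2 * t * cmod ?s + \<rho> * (1 + \<rho>\<^sup>2 * t) * (cmod a0 + cmod a1 + cmod a2))"
      using pr[OF _ _ sol t(1)] \<rho> unfolding om by (simp add: power_le_one)
    also have "\<dots> \<le> K * (\<rho>\<^sup>2 * t * (2 * P) + \<rho> * (1 + 1) * Y)"
      using K \<rho> t P Y by (intro mult_left_mono add_mono mult_mono) auto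
    finally have err: "cmod (?\<omega> *\<^sub>R y t - sin (?\<omega> * t) *\<^sub>R ?s) \<le> 2 * K * (\<rho>\<^sup>2 * t * P + \<rho> * Y)"
      by (simp add: algebra_simps)
    have "\<bar>sin (?\<omega> * t)\<bar> * (P / 2) \<le> \<bar>sin (?\<omega> * t)\<bar> * cmod ?s"
      using P by (intro mult_left_mono) auto
    also have "\<dots> = cmod (sin (?\<omega> * t) *\<^sub>R ?s)" by simp
    also have "\<dots> \<le> cmod (?\<omega> *\<^sub>R y t) + cmod (?\<omega> *\<^sub>R y t - sin (?\<omega> * t) *\<^sub>R ?s)"
      using norm_triangle_ineq4[of "?\<omega> *\<^sub>R y t" "?\<omega> *\<^sub>R y t - sin (?\<omega> * t) *\<^sub>R ?s"] by simp
    also have "cmod (?\<omega> *\<^sub>R y t) = ?\<omega> * cmod (y t)" using om by simp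
    finally have "\<bar>sin (?\<omega> * t)\<bar> * (P / 2) - 2 * K * (\<rho>\<^sup>2 * t * P + \<rho> * Y) \<le> ?\<omega> * cmod (y t)"
      using err by linarith
    from square_diff_ge[OF this] have
      sq: "(\<bar>sin (?\<omega> * t)\<bar> * (P / 2))\<^sup>2 / 2 - (2 * K * (\<rho>\<^sup>2 * t * P + \<rho> * Y))\<^sup>2 \<le> (?\<omega> * cmod (y t))\<^sup>2"
      using P K \<rho> t Y0 om by simp
    have "(2 * K * (\<rho>\<^sup>2 * t * P + \<rho> * Y))\<^sup>2 = 4 * K\<^sup>2 * (\<rho>\<^sup>2 * t * P + \<rho> * Y)\<^sup>2"
      by (simp add: power_mult_distrib)
    also have "\<dots> \<le> 4 * K\<^sup>2 * (2 * (\<rho>\<^sup>2 * t * P)\<^sup>2 + 2 * (\<rho> * Y)\<^sup>2)"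
      using zero_le_power2[of "\<rho>\<^sup>2 * t * P - \<rho> * Y"]
      by (intro mult_left_mono) (auto simp: power2_eq_square algebra_simps)
    finally have "(sin (?\<omega> * t))\<^sup>2 * P\<^sup>2 / 8 - 4 * K\<^sup>2 * (2 * (\<rho>\<^sup>2 * t * P)\<^sup>2 + 2 * (\<rho> * Y)\<^sup>2) \<le> \<beta> * \<rho>\<^sup>2 * (cmod (y t))\<^sup>2"
      using sq be by (simp add: power_mult_distrib power_divide)
    then have "((sin (?\<omega> * t))\<^sup>2 * P\<^sup>2 / 8 - 4 * K\<^sup>2 * (2 * (\<rho>\<^sup>2 * t * P)\<^sup>2 + 2 * (\<rho> * Y)\<^sup>2)) / (\<beta> * \<rho>\<^sup>2) \<le> (cmod (y t))\<^sup>2"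
      using be \<rho> by (simp add: pos_divide_le_eq mult.commute)
    also have "((sin (?\<omega> * t))\<^sup>2 * P\<^sup>2 / 8 - 4 * K\<^sup>2 * (2 * (\<rho>\<^sup>2 * t * P)\<^sup>2 + 2 * (\<rho> * Y)\<^sup>2)) / (\<beta> * \<rho>\<^sup>2) =
        P\<^sup>2 * wave_profile (sqrt \<beta>) (1 / (8 * \<beta>)) (8 * K\<^sup>2 / \<beta>) t \<rho> - 8 * K\<^sup>2 / \<beta> * Y\<^sup>2"
      unfolding wave_profile_def using be \<rho> by (simp add: field_simps power2_eq_square)
    finally show "P\<^sup>2 * wave_profile (sqrt (1 - m * \<tau>)) (1 / (8 * (1 - m * \<tau>))) (8 * K\<^sup>2 / \<beta>) t \<rho> - 8 * K\<^sup>2 / \<beta> * Y\<^sup>2 \<le> (cmod (y t))\<^sup>2"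
      unfolding \<beta>_def .
  qed
qed

text \<open>The constant involves only the shell constant \<open>c\<close> and the normalisation
  \<open>F\<close> of the transform. The data influence the threshold alone: the shell has to lie
  where \<open>s\<close> is within a factor 2 of \<open>s 0\<close>, and the bounded error over the
  shell has to fall below half of the main term.\<close>

lemma solution_L2_lower:
  fixes \<tau> \<delta> m l :: real
  assumes pos: "\<tau> > 0" "m > 0" "\<delta> \<ge> 0" "m * \<tau> < 1"
  obtains C where "C > 0"
    "\<And>(\<psi>0 :: 'a::euclidean_space \<Rightarrow> real) \<psi>1 \<psi>2 u. (\<psi>0, \<psi>1, \<psi>2) \<in> data_space \<delta> l \<Longrightarrow>
      (\<And>\<xi>. solves_ode \<tau> \<delta> m ((norm \<xi>)\<^sup>2) (fourier \<psi>0 \<xi>) (fourier \<psi>1 \<xi>) (fourier \<psi>2 \<xi>) (\<lambda>t. u t \<xi>)) \<Longrightarrow>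
      mean (\<lambda>x. \<psi>1 x + \<tau> * \<psi>2 x) \<noteq> 0 \<Longrightarrow> (\<And>t. t \<ge> 3 \<Longrightarrow> square_integrable (u t)) \<Longrightarrow>
      \<exists>T. \<forall>t\<ge>T. growth_rate DIM('a) t * \<bar>mean (\<lambda>x. \<psi>1 x + \<tau> * \<psi>2 x)\<bar> \<le> C * L2_norm (u t)"
proof -
  obtain k where k: "k > 0" and lower: "\<And>\<rho> t P Y a0 a1 a2 y. 0 < \<rho> \<Longrightarrow> \<rho> \<le> 1 \<Longrightarrow> 0 \<le> t \<Longrightarrow> \<rho>\<^sup>2 * t \<le> 1 \<Longrightarrow> solves_ode \<tau> \<delta> m (\<rho>\<^sup>2) a0 a1 a2 y \<Longrightarrow>
      0 \<le> P \<Longrightarrow> P / 2 \<le> cmod (a1 + \<tau> *\<^sub>R a2) \<Longrightarrow> cmod (a1 + \<tau> *\<^sub>R a2) \<le> 2 * P \<Longrightarrow>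
      cmod a0 + cmod a1 + cmod a2 \<le> Y \<Longrightarrow>
      P\<^sup>2 * wave_profile (sqrt (1 - m * \<tau>)) (1 / (8 * (1 - m * \<tau>))) k t \<rho> - k * Y\<^sup>2 \<le> (cmod (y t))\<^sup>2"
    using solution_pointwise_lower[OF pos] by blast
  define w where "w = wave_profile (sqrt (1 - m * \<tau>)) (1 / (8 * (1 - m * \<tau>))) k"
  have wpos: "sqrt (1 - m * \<tau>) > 0" "1 / (8 * (1 - m * \<tau>)) > 0" using pos by auto
  obtain c A B where c: "c > 0" and B0: "(B \<longlongrightarrow> 0) at_top"
    and B1: "((\<lambda>t. B t ^ DIM('a) / (growth_rate DIM('a) t)\<^sup>2) \<longlongrightarrow> 0) at_top"
    and AB: "\<forall>\<^sub>F t in at_top. 0 < A t \<and> A t \<le> B t \<and> (B t)\<^sup>2 * t \<le> 1 \<and> c * (growth_rate DIM('a) t)\<^sup>2 \<le>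
      (LINT \<xi>|lborel. indicator {A t..B t} (norm (\<xi>::'a)) * w t (norm \<xi>))"
    by (rule wave_profile_integral_ge[OF wpos less_imp_le[OF k], where 'a = 'a, folded w_def])
  define F where "F = (2 * pi) powr (- (real DIM('a) / 2))"
  have F: "F > 0" by (simp add: F_def)
  show thesis
  proof (rule that[of "1 / (F * sqrt (c / 2))"])
    show "1 / (F * sqrt (c / 2)) > 0" using F c by simp
    fix \<psi>0 \<psi>1 \<psi>2 :: "'a \<Rightarrow> real" and u
    assume data: "(\<psi>0, \<psi>1, \<psi>2) \<in> data_space \<delta> l"
      and sol: "\<And>\<xi>. solves_ode \<tau> \<delta> m ((norm \<xi>)\<^sup>2) (fourier \<psi>0 \<xi>) (fourier \<psi>1 \<xi>) (fourier \<psi>2 \<xi>) (\<lambda>t. u t \<xi>)"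
      and ne: "mean (\<lambda>x. \<psi>1 x + \<tau> * \<psi>2 x) \<noteq> 0" and sq: "\<And>t. t \<ge> 3 \<Longrightarrow> square_integrable (u t)"
    note d = data_space_properties[OF data]
    let ?m = "mean (\<lambda>x. \<psi>1 x + \<tau> * \<psi>2 x)"
    define s where "s \<xi> = fourier \<psi>1 \<xi> + \<tau> *\<^sub>R fourier \<psi>2 \<xi>" for \<xi>
    define P where "P = F * \<bar>?m\<bar>"
    have P: "P > 0" using F ne by (simp add: P_def)
    have s0: "cmod (s 0) = P"
    proof -
      have "?m = mean \<psi>1 + \<tau> * mean \<psi>2" using d by (simp add: mean_def)
      moreover have "s 0 = complex_of_real (F * (mean \<psi>1 + \<tau> * mean \<psi>2))"
        by (simp add: s_def fourier_def mean_def F_def scaleR_conv_of_real algebra_simps)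
      ultimately show ?thesis using F by (simp add: P_def abs_mult del: of_real_mult of_real_add)
    qed
    define Y where "Y = data_norm \<delta> l (\<psi>0, \<psi>1, \<psi>2)"
    have Y: "cmod (fourier \<psi>0 \<xi>) + cmod (fourier \<psi>1 \<xi>) + cmod (fourier \<psi>2 \<xi>) \<le> Y" for \<xi>
      using norm_fourier_le[OF d(1), of \<xi>] norm_fourier_le[OF d(2), of \<xi>] norm_fourier_le[OF d(3), of \<xi>] d(4)
      unfolding Y_def by linarith
    have "isCont s 0"
      unfolding s_def[abs_def] using continuous_fourier[OF d(2)] continuous_fourier[OF d(3)]
      by (intro continuous_intros) (auto simp: continuous_on_eq_continuous_at)
    then obtain e where e: "e > 0" "\<And>\<xi>. norm \<xi> < e \<Longrightarrow> cmod (s \<xi> - s 0) < P / 2"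
    proof -
      have "\<exists>d>0. \<forall>\<xi>. norm (\<xi> - 0) < d \<longrightarrow> cmod (s \<xi> - s 0) < P / 2"
        using \<open>isCont s 0\<close> half_gt_zero[OF P] unfolding continuous_at_eps_delta dist_norm by blast
      then show thesis using that by auto
    qed
    have sP: "P / 2 \<le> cmod (s \<xi>)" "cmod (s \<xi>) \<le> 2 * P" if "norm \<xi> < e" for \<xi>
      using e(2)[OF that] s0 P norm_triangle_ineq2[of "s \<xi>" "s 0"] norm_triangle_ineq3[of "s \<xi>" "s 0"] by linarith+
    let ?V = "unit_ball_vol (real DIM('a))"
    have lim: "((\<lambda>t. k * Y\<^sup>2 * ?V * (B t ^ DIM('a) / (growth_rate DIM('a) t)\<^sup>2)) \<longlongrightarrow> k * Y\<^sup>2 * ?V * 0) at_top"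
      by (intro tendsto_intros B1)
    have ev1: "\<forall>\<^sub>F t in at_top. k * Y\<^sup>2 * ?V * (B t ^ DIM('a) / (growth_rate DIM('a) t)\<^sup>2) < P\<^sup>2 * (c / 2)"
      using P c by (intro order_tendstoD(2)[OF lim]) simp
    have ev2: "\<forall>\<^sub>F t in at_top. B t < min 1 e"
      using order_tendstoD(2)[OF B0, of "min 1 e"] e by simp
    have "\<forall>\<^sub>F t in at_top. growth_rate DIM('a) t * \<bar>?m\<bar> \<le> 1 / (F * sqrt (c / 2)) * L2_norm (u t)"
      using AB ev1 ev2 eventually_ge_at_top[of 3]
    proof eventually_elim
      case (elim t)
      let ?D = "growth_rate DIM('a) t" and ?I = "\<lambda>\<xi>. indicator {A t..B t} (norm (\<xi>::'a)) :: real"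
      have D: "?D > 0"
      proof -
        have "ln t > 0" using elim by simp
        then show ?thesis using elim by (auto simp: growth_rate_def)
      qed
      \<comment> \<open>Integrability follows from the lower bound itself: a function that is not
        integrable has integral 0 by convention, whereas this integral is at least a positive
        number.\<close>
      have int: "integrable lborel (\<lambda>\<xi>. ?I \<xi> * w t (norm \<xi>))"
      proof (rule ccontr)
        assume "\<not> integrable lborel (\<lambda>\<xi>. ?I \<xi> * w t (norm \<xi>))"
        then have "(LINT \<xi>|lborel. ?I \<xi> * w t (norm \<xi>)) = 0" by (rule not_integrable_integral_eq)
        moreover have "c * ?D\<^sup>2 > 0" using c D by simp
        ultimately show False using elim by linarith
      qed
      have Ib: "?I \<xi> \<le> indicator (cball 0 (B t)) \<xi>" for \<xi>
        by (auto split: split_indicator)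
      have fin: "emeasure lborel (cball (0::'a) (B t)) < \<infinity>"
        by (rule emeasure_bounded_finite) simp
      have Iint: "integrable lborel ?I"
      proof (rule Bochner_Integration.integrable_bound)
        show "integrable lborel (indicator (cball (0::'a) (B t)) :: 'a \<Rightarrow> real)"
          using fin by (simp add: integrable_indicator_iff)
        show "AE \<xi> in lborel. norm (?I \<xi>) \<le> norm (indicator (cball 0 (B t)) \<xi> :: real)"
          using Ib by auto
      qed measurable
      have "integral\<^sup>L lborel ?I \<le> (LINT \<xi>|lborel. indicator (cball (0::'a) (B t)) \<xi>)"
        using fin by (intro integral_mono Iint Ib) (simp add: integrable_indicator_iff)
      also have "\<dots> = ?V * B t ^ DIM('a)"
        using elim by (simp add: content_cball)
      finally have V: "integral\<^sup>L lborel ?I \<le> ?V * B t ^ DIM('a)" .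
      have uint: "integrable lborel (\<lambda>\<xi>. (cmod (u t \<xi>))\<^sup>2)"
        using sq elim by (simp add: square_integrable_def)
      have "P\<^sup>2 * (LINT \<xi>|lborel. ?I \<xi> * w t (norm \<xi>)) - k * Y\<^sup>2 * integral\<^sup>L lborel ?I =
          (LINT \<xi>|lborel. P\<^sup>2 * (?I \<xi> * w t (norm \<xi>)) - k * Y\<^sup>2 * ?I \<xi>)"
        using int Iint by simp
      also have "\<dots> \<le> (LINT \<xi>|lborel. (cmod (u t \<xi>))\<^sup>2)"
      proof (rule integral_mono)
        fix \<xi> :: 'a
        show "P\<^sup>2 * (?I \<xi> * w t (norm \<xi>)) - k * Y\<^sup>2 * ?I \<xi> \<le> (cmod (u t \<xi>))\<^sup>2"
        proof (cases "norm \<xi> \<in> {A t..B t}")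
          case True
          then have n: "0 < norm \<xi>" "norm \<xi> \<le> 1" "norm \<xi> < e" "(norm \<xi>)\<^sup>2 \<le> (B t)\<^sup>2"
            using elim by (auto intro!: power_mono)
          have "(norm \<xi>)\<^sup>2 * t \<le> (B t)\<^sup>2 * t" using n elim by (intro mult_right_mono) auto
          then have "(norm \<xi>)\<^sup>2 * t \<le> 1" using elim by linarith
          then show ?thesis
            using lower[OF n(1,2) _ _ sol _ sP[OF n(3), unfolded s_def] Y] elim P True
            by (simp add: w_def)
        qed simp
      qed (use int Iint uint in auto)
      finally have "P\<^sup>2 * (LINT \<xi>|lborel. ?I \<xi> * w t (norm \<xi>)) - k * Y\<^sup>2 * integral\<^sup>L lborel ?I \<le> (L2_norm (u t))\<^sup>2"
        by (simp add: L2_norm_power2)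
      moreover have "P\<^sup>2 * (c * ?D\<^sup>2) \<le> P\<^sup>2 * (LINT \<xi>|lborel. ?I \<xi> * w t (norm \<xi>))"
        using elim by (intro mult_left_mono) auto
      moreover have "k * Y\<^sup>2 * integral\<^sup>L lborel ?I \<le> P\<^sup>2 * (c / 2) * ?D\<^sup>2"
      proof -
        have "k * Y\<^sup>2 * integral\<^sup>L lborel ?I \<le> k * Y\<^sup>2 * (?V * B t ^ DIM('a))"
          using k by (intro mult_left_mono V) auto
        also have "\<dots> = k * Y\<^sup>2 * ?V * (B t ^ DIM('a) / ?D\<^sup>2) * ?D\<^sup>2" using D by simp
        also have "\<dots> \<le> P\<^sup>2 * (c / 2) * ?D\<^sup>2" using elim by (intro mult_right_mono) auto
        finally show ?thesis .
      qed
      moreover have "P\<^sup>2 * (c * ?D\<^sup>2) = P\<^sup>2 * (c / 2) * ?D\<^sup>2 + P\<^sup>2 * (c / 2) * ?D\<^sup>2" by simp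
      \<comment> \<open>Half of the main term pays for the bounded error; the other half gives the
        factor \<open>sqrt (c / 2)\<close> in the constant.\<close>
      ultimately have "P\<^sup>2 * (c / 2) * ?D\<^sup>2 \<le> (L2_norm (u t))\<^sup>2" by linarith
      then have "(P * sqrt (c / 2) * ?D)\<^sup>2 \<le> (L2_norm (u t))\<^sup>2"
        using c by (simp only: power_mult_distrib) simp
      then have "P * sqrt (c / 2) * ?D \<le> L2_norm (u t)"
        by (rule power2_le_imp_le) simp
      then show ?case
        using F c by (simp add: P_def field_simps)
    qed
    then show "\<exists>T. \<forall>t\<ge>T. growth_rate DIM('a) t * \<bar>?m\<bar> \<le> 1 / (F * sqrt (c / 2)) * L2_norm (u t)"
      by (simp add: eventually_at_top_linorder)
  qed
qed

theorem theorem2p1: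
  fixes \<tau> \<delta> m l :: real
  assumes "\<tau> > 0" and "\<delta> \<ge> 0" and "m > 0" and "m * \<tau> < 1"
    and "l > max (real DIM('a::euclidean_space) / 2 - 1) 0"
  shows "\<exists>C>0. \<exists>T. \<forall>(\<psi>0 :: 'a \<Rightarrow> real) \<psi>1 \<psi>2 \<psi>.
    (\<psi>0, \<psi>1, \<psi>2) \<in> data_space \<delta> l \<longrightarrow>
    mean (\<lambda>x. \<psi>1 x + \<tau> * \<psi>2 x) \<noteq> 0 \<longrightarrow>
    is_solution \<tau> \<delta> m \<psi>0 \<psi>1 \<psi>2 \<psi> \<longrightarrow>
      (\<forall>t\<ge>T. square_integrable (\<psi> t) \<and>
        L2_norm (\<psi> t) \<le> C * (growth_rate DIM('a) t * data_norm \<delta> l (\<psi>0, \<psi>1, \<psi>2))) \<and>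
      (\<exists>T0. \<forall>t\<ge>T0.
        growth_rate DIM('a) t * \<bar>mean (\<lambda>x. \<psi>1 x + \<tau> * \<psi>2 x)\<bar> \<le> C * L2_norm (\<psi> t))"
proof -
  note pos = assms(1,3,2,4)
  obtain C1 where C1: "C1 > 0" and up: "\<And>(\<psi>0 :: 'a \<Rightarrow> real) \<psi>1 \<psi>2 u t. (\<psi>0, \<psi>1, \<psi>2) \<in> data_space \<delta> l \<Longrightarrow>
      (\<And>\<xi>. solves_ode \<tau> \<delta> m ((norm \<xi>)\<^sup>2) (fourier \<psi>0 \<xi>) (fourier \<psi>1 \<xi>) (fourier \<psi>2 \<xi>) (\<lambda>t. u t \<xi>)) \<Longrightarrow> t \<ge> 3 \<Longrightarrow>
      square_integrable (u t) \<and> L2_norm (u t) \<le> C1 * (growth_rate DIM('a) t * data_norm \<delta> l (\<psi>0, \<psi>1, \<psi>2))"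
    using solution_L2_upper[OF pos assms(5)] by blast
  obtain C2 where C2: "C2 > 0" and low: "\<And>(\<psi>0 :: 'a \<Rightarrow> real) \<psi>1 \<psi>2 u. (\<psi>0, \<psi>1, \<psi>2) \<in> data_space \<delta> l \<Longrightarrow>
      (\<And>\<xi>. solves_ode \<tau> \<delta> m ((norm \<xi>)\<^sup>2) (fourier \<psi>0 \<xi>) (fourier \<psi>1 \<xi>) (fourier \<psi>2 \<xi>) (\<lambda>t. u t \<xi>)) \<Longrightarrow>
      mean (\<lambda>x. \<psi>1 x + \<tau> * \<psi>2 x) \<noteq> 0 \<Longrightarrow> (\<And>t. t \<ge> 3 \<Longrightarrow> square_integrable (u t)) \<Longrightarrow>
      \<exists>T. \<forall>t\<ge>T. growth_rate DIM('a) t * \<bar>mean (\<lambda>x. \<psi>1 x + \<tau> * \<psi>2 x)\<bar> \<le> C2 * L2_norm (u t)"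
    using solution_L2_lower[OF pos, where 'a = 'a and l = l] by blast
  define C where "C = max C1 C2"
  have C: "C > 0" "C1 \<le> C" "C2 \<le> C" using C1 by (auto simp: C_def)
  show ?thesis
  proof (rule exI[of _ C], intro conjI, rule C(1), rule exI[of _ 3], intro allI impI, intro conjI allI impI)
    fix \<psi>0 \<psi>1 \<psi>2 :: "'a \<Rightarrow> real" and \<psi>
    assume data: "(\<psi>0, \<psi>1, \<psi>2) \<in> data_space \<delta> l" and ne: "mean (\<lambda>x. \<psi>1 x + \<tau> * \<psi>2 x) \<noteq> 0"
      and sol: "is_solution \<tau> \<delta> m \<psi>0 \<psi>1 \<psi>2 \<psi>"
    obtain u where u: "\<And>\<xi>. solves_ode \<tau> \<delta> m ((norm \<xi>)\<^sup>2) (fourier \<psi>0 \<xi>) (fourier \<psi>1 \<xi>) (fourier \<psi>2 \<xi>) (\<lambda>t. u t \<xi>)"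
      and inv: "\<And>t. t \<ge> 0 \<Longrightarrow> square_integrable (u t) \<Longrightarrow> has_L2_fourier (\<psi> t) (u t)"
      using sol unfolding is_solution_def by blast
    note up' = up[OF data u]
    \<comment> \<open>\<open>is_solution\<close> ties \<open>\<psi> t\<close> to \<open>u t\<close>
      only at times where \<open>u t\<close> is square integrable; the upper bound provides this
      from time 3 on, and Plancherel transfers the norms.\<close>
    have L2: "square_integrable (\<psi> t)" "L2_norm (\<psi> t) = L2_norm (u t)" if "t \<ge> 3" for t
      using has_L2_fourier_norm[OF inv[of t]] up'[OF that] that by auto
    have g: "0 \<le> growth_rate DIM('a) t" if "t \<ge> 3" for t
      using that by (simp add: growth_rate_def)
    show "square_integrable (\<psi> t)" if "t \<ge> 3" for t
      using L2[OF that] by simp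
    show "L2_norm (\<psi> t) \<le> C * (growth_rate DIM('a) t * data_norm \<delta> l (\<psi>0, \<psi>1, \<psi>2))" if t: "t \<ge> 3" for t
    proof -
      have "L2_norm (\<psi> t) \<le> C1 * (growth_rate DIM('a) t * data_norm \<delta> l (\<psi>0, \<psi>1, \<psi>2))"
        using up'[OF t] L2[OF t] by simp
      also have "\<dots> \<le> C * (growth_rate DIM('a) t * data_norm \<delta> l (\<psi>0, \<psi>1, \<psi>2))"
        using C g[OF t] data_space_properties(8)[OF data] by (intro mult_right_mono) auto
      finally show ?thesis .
    qed
    obtain T where T: "\<And>t. t \<ge> T \<Longrightarrow> growth_rate DIM('a) t * \<bar>mean (\<lambda>x. \<psi>1 x + \<tau> * \<psi>2 x)\<bar> \<le> C2 * L2_norm (u t)"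
      using low[OF data u ne] up' by blast
    show "\<exists>T0. \<forall>t\<ge>T0. growth_rate DIM('a) t * \<bar>mean (\<lambda>x. \<psi>1 x + \<tau> * \<psi>2 x)\<bar> \<le> C * L2_norm (\<psi> t)"
    proof (intro exI[of _ "max T 3"] allI impI)
      fix t assume t: "t \<ge> max T 3"
      have "growth_rate DIM('a) t * \<bar>mean (\<lambda>x. \<psi>1 x + \<tau> * \<psi>2 x)\<bar> \<le> C2 * L2_norm (u t)"
        using T t by simp
      also have "\<dots> \<le> C * L2_norm (u t)" using C by (intro mult_right_mono) auto
      finally show "growth_rate DIM('a) t * \<bar>mean (\<lambda>x. \<psi>1 x + \<tau> * \<psi>2 x)\<bar> \<le> C * L2_norm (\<psi> t)"
        using L2 t by simp
    qed
  qed
qed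

end
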